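(* Let $F$ be a field of characteristic $0$, $K=F(t)$, and let $\delta$ be the derivation on $K$ determined by $\delta(t)=t$ and $\delta(a)=0$ for $a\in F$. Let $P\in M_n(K)$ be a traceless matrix and let $\mathcal D_P(X)=\delta^c(X)+PX-XP$ for $X\in M_n(K)$. (i) If $P\in M_n(F)$, then $(M_n(K),\mathcal D_P)$ admits a finite splitting field if and only if $P$ is diagonalizable and every eigenvalue of $P$ is rational. (ii) If $P\notin M_n(F)$, then $(M_n(K),\mathcal D_P)$ admits a finite splitting field if $P$ has one of the following forms: (a) $P=\mathrm{diag}(d_1,d_2,\dots,d_n)$ and each $d_i\in\mathcal A$; (b) $P=(p_{ij})$ is an upper triangular matrix with $p_{ij}\in F[t]$, satisfying $p_{ii}\in\mathbb Q$ for all $i$ and $p_{ii}+\mathbb Z\neq p_{jj}+\mathbb Z$ in $\mathbb Q/\mathbb Z$ whenever $i\neq j$.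
   Context: For a differential field $(L,\delta_L)$, $\delta_L^c$ denotes the derivation of $M_n(L)$ obtained by applying $\delta_L$ to each matrix entry. A differential extension $(E,\delta_E)$ of $(K,\delta)$ is a field extension $E\supseteq K$ with a derivation $\delta_E$ such that $\delta_E|_K=\delta$. It is a splitting field of $(M_n(K),\mathcal D_P)$ if the base change $(M_n(K),\mathcal D_P)\otimes(E,\delta_E)$, which is $(M_n(E),\ X\mapsto\delta_E^c(X)+PX-XP)$, is isomorphic to $(M_n(E),\delta_E^c)$ as a differential algebra, i.e. by an $E$-algebra isomorphism commuting with the derivations; it is finite if $[E:K]<\infty$. The set $\mathcal A$ is $\{a\in K:\delta(y)=nay \text{ has a nonzero solution } y\in K\text{ for some } n\in\mathbb N\}$ ($\mathbb N$ the positive integers), equivalently the $\mathbb Q$-span of $\{\delta(b)b^{-1}: b\in K\setminus\{0\}\}$. *)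

theory Defs
  imports
    "HOL-Algebra.Algebraic_Closure_Type"
    "Jordan_Normal_Form.Char_Poly"
begin

section \<open>Differential fields and finite differential extensions\<close>

definition derivation_on :: "'b::comm_ring_1 set \<Rightarrow> ('b \<Rightarrow> 'b) \<Rightarrow> bool" where
  "derivation_on R d \<longleftrightarrow>
     (\<forall>x\<in>R. d x \<in> R) \<and>
     (\<forall>x\<in>R. \<forall>y\<in>R. d (x + y) = d x + d y) \<and>
     (\<forall>x\<in>R. \<forall>y\<in>R. d (x * y) = d x * y + x * d y)"

text \<open>
  A field extension of the field 'k consists of a subfield E of some ambient field 'b together
  with an embedding \<iota> of 'k into E.
\<close>
definition differential_extension ::
    "('k::field \<Rightarrow> 'k) \<Rightarrow> ('k \<Rightarrow> 'b::field) \<Rightarrow> 'b set \<Rightarrow> ('b \<Rightarrow> 'b) \<Rightarrow> bool" where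
  "differential_extension \<delta> \<iota> E \<delta>E \<longleftrightarrow>
     field_hom \<iota> \<and> subfield E ring_of_type_algebra \<and> range \<iota> \<subseteq> E \<and>
     derivation_on E \<delta>E \<and> (\<forall>x. \<delta>E (\<iota> x) = \<iota> (\<delta> x))"

definition finite_extension :: "('k::field \<Rightarrow> 'b::field) \<Rightarrow> 'b set \<Rightarrow> bool" where
  "finite_extension \<iota> E \<longleftrightarrow> (\<exists>B. finite B \<and> Modules.module.span (\<lambda>k x. \<iota> k * x) B = E)"

section \<open>Differential matrix algebras and their splitting fields\<close>

definition matrices_over :: "'b set \<Rightarrow> nat \<Rightarrow> 'b mat set" where
  "matrices_over E n = {A \<in> carrier_mat n n. elements_mat A \<subseteq> E}"

definition twisted_derivation :: "('b \<Rightarrow> 'b) \<Rightarrow> 'b mat \<Rightarrow> 'b mat \<Rightarrow> 'b::ring_1 mat" where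
  "twisted_derivation d P A = map_mat d A + P * A - A * P"

definition differential_algebra_iso ::
    "'b::field set \<Rightarrow> nat \<Rightarrow> ('b mat \<Rightarrow> 'b mat) \<Rightarrow> ('b mat \<Rightarrow> 'b mat) \<Rightarrow> ('b mat \<Rightarrow> 'b mat) \<Rightarrow> bool"
  where
  "differential_algebra_iso E n D D' \<phi> \<longleftrightarrow>
     bij_betw \<phi> (matrices_over E n) (matrices_over E n) \<and>
     \<phi> (1\<^sub>m n) = 1\<^sub>m n \<and>
     (\<forall>A\<in>matrices_over E n. \<forall>B\<in>matrices_over E n. \<phi> (A + B) = \<phi> A + \<phi> B) \<and>
     (\<forall>A\<in>matrices_over E n. \<forall>B\<in>matrices_over E n. \<phi> (A * B) = \<phi> A * \<phi> B) \<and>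
     (\<forall>c\<in>E. \<forall>A\<in>matrices_over E n. \<phi> (c \<cdot>\<^sub>m A) = c \<cdot>\<^sub>m \<phi> A) \<and>
     (\<forall>A\<in>matrices_over E n. \<phi> (D A) = D' (\<phi> A))"

text \<open>
  The base change along \<iota> of the matrix algebra over 'k with derivation
  \<open>twisted_derivation \<delta> P\<close> is the matrix algebra over E with derivation
  \<open>twisted_derivation \<delta>E (map_mat \<iota> P)\<close>.
\<close>
definition splitting_field ::
    "('k::field \<Rightarrow> 'k) \<Rightarrow> nat \<Rightarrow> 'k mat \<Rightarrow> ('k \<Rightarrow> 'b::field) \<Rightarrow> 'b set \<Rightarrow> ('b \<Rightarrow> 'b) \<Rightarrow> bool" where
  "splitting_field \<delta> n P \<iota> E \<delta>E \<longleftrightarrow>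
     differential_extension \<delta> \<iota> E \<delta>E \<and>
     (\<exists>\<phi>. differential_algebra_iso E n
            (twisted_derivation \<delta>E (map_mat \<iota> P)) (map_mat \<delta>E) \<phi>)"

text \<open>
  Types cannot be quantified over, so the ambient field is fixed to be the algebraic closure of
  'k. This is no restriction: \<open>admits_finite_splitting_fieldI\<close> below shows that a finite
  splitting field inside an arbitrary field type 'b yields one of this form.
\<close>
definition admits_finite_splitting_field :: "('k::field \<Rightarrow> 'k) \<Rightarrow> nat \<Rightarrow> 'k mat \<Rightarrow> bool" where
  "admits_finite_splitting_field \<delta> n P \<longleftrightarrow>
     (\<exists>(\<iota> :: 'k \<Rightarrow> 'k alg_closure) E \<delta>E. finite_extension \<iota> E \<and> splitting_field \<delta> n P \<iota> E \<delta>E)"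

section \<open>The rational function field\<close>

text \<open>The field F(t) is the type 'a poly fract, with t being \<open>to_fract [:0, 1:]\<close>.\<close>

definition const_fract :: "'a::field \<Rightarrow> 'a poly fract" where
  "const_fract c = to_fract [:c:]"

text \<open>There is exactly one such derivation, see \<open>euler_derivation_ex1\<close> below.\<close>
definition euler_derivation :: "('a::field poly fract \<Rightarrow> 'a poly fract) \<Rightarrow> bool" where
  "euler_derivation \<delta> \<longleftrightarrow>
     derivation_on UNIV \<delta> \<and> \<delta> (to_fract [:0, 1:]) = to_fract [:0, 1:] \<and>
     (\<forall>c. \<delta> (const_fract c) = 0)"

definition log_derivative_set :: "('k::field \<Rightarrow> 'k) \<Rightarrow> 'k set" where
  "log_derivative_set \<delta> = {a. \<exists>n>0. \<exists>y. y \<noteq> 0 \<and> \<delta> y = of_nat n * a * y}"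

definition diagonalizable_mat :: "'b::field mat \<Rightarrow> bool" where
  "diagonalizable_mat A \<longleftrightarrow> (\<exists>D. diagonal_mat D \<and> similar_mat A D)"

section \<open>Independence of the ambient field\<close>

definition subfield_set :: "'b::field set \<Rightarrow> bool" where
  "subfield_set L \<longleftrightarrow> 0 \<in> L \<and> 1 \<in> L \<and> (\<forall>x\<in>L. \<forall>y\<in>L. x + y \<in> L \<and> x * y \<in> L)
     \<and> (\<forall>x\<in>L. - x \<in> L \<and> inverse x \<in> L)"

definition hom_on :: "'b::field set \<Rightarrow> ('b \<Rightarrow> 'c::field) \<Rightarrow> bool" where
  "hom_on L \<sigma> \<longleftrightarrow> \<sigma> 1 = 1 \<and> (\<forall>x\<in>L. \<forall>y\<in>L. \<sigma> (x + y) = \<sigma> x + \<sigma> y \<and> \<sigma> (x * y) = \<sigma> x * \<sigma> y)"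

lemma subfield_iff_subfield_set:
  "subfield (E :: 'b::field set) ring_of_type_algebra \<longleftrightarrow> subfield_set E"
proof -
  let ?R = "ring_of_type_algebra :: 'b ring"
  interpret R: field ?R by rule
  have sel [simp]: "carrier ?R = UNIV" "\<zero>\<^bsub>?R\<^esub> = 0" "\<one>\<^bsub>?R\<^esub> = 1"
    "x \<oplus>\<^bsub>?R\<^esub> y = x + y" "x \<otimes>\<^bsub>?R\<^esub> y = x * y" for x y :: 'b
    by (auto simp: ring_of_type_algebra_def)
  have neg [simp]: "\<ominus>\<^bsub>?R\<^esub> x = - x" for x :: 'b
    by (rule R.minus_equality) auto
  have inv: "inv\<^bsub>?R\<^esub> x = inverse x" if "x \<noteq> 0" for x :: 'b
    by (rule R.inv_char) (use that in auto)
  show ?thesis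
  proof
    assume E: "subfield E ?R"
    note sr = subfieldE(1)[OF E]
    have "inverse x \<in> E" if "x \<in> E" for x
    proof (cases "x = 0")
      case True then show ?thesis using that by simp
    next
      case False
      then show ?thesis using R.subfield_m_inv(1)[OF E, of x] inv[of x] that by auto
    qed
    then show "subfield_set E"
      using subringE[OF sr] by (auto simp: subfield_set_def)
  next
    assume E: "subfield_set E"
    have cr: "subcring E ?R"
      by (rule R.subcringI')
         (rule R.subringI, use E in \<open>auto simp: subfield_set_def\<close>)
    show "subfield E ?R"
    proof (rule R.subfieldI'[OF subcring.axioms(1)[OF cr]])
      fix k assume "k \<in> E - {\<zero>\<^bsub>?R\<^esub>}"
      then show "inv\<^bsub>?R\<^esub> k \<in> E" using E inv by (auto simp: subfield_set_def)
    qed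
  qed
qed

lemma subfield_set_sum: "subfield_set L \<Longrightarrow> (\<And>i. i \<in> A \<Longrightarrow> f i \<in> L) \<Longrightarrow> sum f A \<in> L"
  by (induction A rule: infinite_finite_induct) (auto simp: subfield_set_def)

lemma hom_on_0: assumes "hom_on L \<sigma>" "subfield_set L" shows "\<sigma> 0 = 0"
proof -
  have "\<sigma> (0 + 0) = \<sigma> 0 + \<sigma> 0" using assms unfolding hom_on_def subfield_set_def by blast
  then show ?thesis by (metis add_0 add_cancel_right_right)
qed

lemma hom_on_minus: assumes "hom_on L \<sigma>" "subfield_set L" "x \<in> L" shows "\<sigma> (- x) = - \<sigma> x"
proof -
  have "\<sigma> (x + (- x)) = \<sigma> x + \<sigma> (- x)" using assms unfolding hom_on_def subfield_set_def by blast
  then show ?thesis using hom_on_0[OF assms(1,2)] by (simp add: eq_neg_iff_add_eq_0 add.commute)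
qed

lemma hom_on_sum:
  assumes "hom_on L \<sigma>" "subfield_set L" "\<And>i. i \<in> A \<Longrightarrow> f i \<in> L"
  shows "\<sigma> (sum f A) = (\<Sum>i\<in>A. \<sigma> (f i))"
  using assms(3)
proof (induction A rule: infinite_finite_induct)
  case (insert x F)
  have "f x \<in> L" "sum f F \<in> L" using insert by (auto intro: subfield_set_sum[OF assms(2)])
  then show ?case using insert assms(1) by (simp add: hom_on_def)
qed (simp_all add: hom_on_0[OF assms(1,2)])

lemma hom_on_inj: assumes "hom_on L \<sigma>" "subfield_set L" shows "inj_on \<sigma> L"
proof (rule inj_onI)
  fix x y assume xy: "x \<in> L" "y \<in> L" "\<sigma> x = \<sigma> y"
  have d: "x - y \<in> L" using assms(2) xy unfolding subfield_set_def by (metis diff_conv_add_uminus)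
  have "\<sigma> (x - y) = \<sigma> x + \<sigma> (- y)"
    using assms xy unfolding hom_on_def subfield_set_def diff_conv_add_uminus by blast
  then have z: "\<sigma> (x - y) = 0" using hom_on_minus[OF assms xy(2)] xy by simp
  show "x = y"
  proof (rule ccontr)
    assume "x \<noteq> y"
    then have "(x - y) * inverse (x - y) = 1" by simp
    then have "\<sigma> (x - y) * \<sigma> (inverse (x - y)) = 1"
      using assms d unfolding hom_on_def subfield_set_def by metis
    then show False using z by simp
  qed
qed

definition poly_over :: "'b::field set \<Rightarrow> 'b poly set" where
  "poly_over L = {p. \<forall>i. coeff p i \<in> L}"

lemma poly_over_ops:
  assumes "subfield_set L"
  shows "0 \<in> poly_over L" "1 \<in> poly_over L"
    "p \<in> poly_over L \<Longrightarrow> q \<in> poly_over L \<Longrightarrow> p + q \<in> poly_over L"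
    "p \<in> poly_over L \<Longrightarrow> - p \<in> poly_over L"
    "p \<in> poly_over L \<Longrightarrow> q \<in> poly_over L \<Longrightarrow> p * q \<in> poly_over L"
    "a \<in> L \<Longrightarrow> monom a k \<in> poly_over L" "a \<in> L \<Longrightarrow> [:a:] \<in> poly_over L"
    "a \<in> L \<Longrightarrow> p \<in> poly_over L \<Longrightarrow> smult a p \<in> poly_over L"
    "p \<in> poly_over L \<Longrightarrow> q \<in> poly_over L \<Longrightarrow> p - q \<in> poly_over L"
proof -
  show "p \<in> poly_over L \<Longrightarrow> q \<in> poly_over L \<Longrightarrow> p * q \<in> poly_over L"
    using assms by (auto simp: poly_over_def coeff_mult subfield_set_def intro!: subfield_set_sum[OF assms])
  show "p \<in> poly_over L \<Longrightarrow> q \<in> poly_over L \<Longrightarrow> p - q \<in> poly_over L"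
    using assms unfolding poly_over_def subfield_set_def by (simp add: diff_conv_add_uminus del: add_uminus_conv_diff)
qed (use assms in \<open>auto simp: poly_over_def subfield_set_def coeff_pCons split: nat.split\<close>)

lemma poly_over_division:
  assumes L: "subfield_set L" and g: "g \<in> poly_over L" "g \<noteq> 0" and f: "f \<in> poly_over L"
  shows "\<exists>q\<in>poly_over L. \<exists>r\<in>poly_over L. f = g * q + r \<and> (r = 0 \<or> degree r < degree g)"
  using f
proof (induction "degree f" arbitrary: f rule: less_induct)
  case less
  show ?case
  proof (cases "f = 0 \<or> degree f < degree g")
    case True
    then show ?thesis using less.prems poly_over_ops(1)[OF L]
      by (intro bexI[of _ 0] bexI[of _ f]) auto
  next
    case False
    define h where "h = monom (lead_coeff f * inverse (lead_coeff g)) (degree f - degree g)"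
    have h: "h \<in> poly_over L" unfolding h_def
      using L g less.prems by (intro poly_over_ops(6)[OF L]) (auto simp: poly_over_def subfield_set_def)
    define f' where "f' = f - g * h"
    have f': "f' \<in> poly_over L"
      unfolding f'_def by (intro poly_over_ops(5,9)[OF L] h g less.prems)
    have hz: "h \<noteq> 0" using False g by (auto simp: h_def)
    have dg: "degree (g * h) = degree f"
      using False g hz by (subst degree_mult_eq) (auto simp: h_def degree_monom_eq)
    have "lead_coeff h = lead_coeff f * inverse (lead_coeff g)"
      using False g unfolding h_def by (subst degree_monom_eq) auto
    then have lc: "coeff (g * h) (degree f) = lead_coeff f"
      using g lead_coeff_mult[of g h] dg by simp
    show ?thesis
    proof (cases "f' = 0")
      case True
      then show ?thesis using h poly_over_ops(1)[OF L] unfolding f'_def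
        by (intro bexI[of _ h] bexI[of _ 0]) auto
    next
      case nz: False
      have "degree f' \<le> degree f" unfolding f'_def using dg by (intro degree_diff_le) auto
      moreover have "coeff f' (degree f) = 0" unfolding f'_def using lc by simp
      ultimately have "degree f' < degree f"
        using nz by (metis leading_coeff_0_iff le_neq_implies_less)
      from less.hyps[OF this f'] obtain q r where
        "q\<in>poly_over L" "r\<in>poly_over L" "f' = g * q + r" "r = 0 \<or> degree r < degree g" by blast
      then show ?thesis using h poly_over_ops(3)[OF L] unfolding f'_def
        by (intro bexI[of _ "q + h"] bexI[of _ r]) (auto simp: algebra_simps)
    qed
  qed
qed

lemma map_poly_hom_on:
  assumes L: "subfield_set L" and s: "hom_on L \<sigma>" and p: "p \<in> poly_over L" "q \<in> poly_over L"
  shows "map_poly \<sigma> (p + q) = map_poly \<sigma> p + map_poly \<sigma> q"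
    and "map_poly \<sigma> (p * q) = map_poly \<sigma> p * map_poly \<sigma> q"
proof -
  note [simp] = hom_on_0[OF s L]
  show "map_poly \<sigma> (p + q) = map_poly \<sigma> p + map_poly \<sigma> q"
    using s p by (intro poly_eqI) (auto simp: coeff_map_poly poly_over_def hom_on_def)
  have "\<sigma> (coeff p i * coeff q j) = \<sigma> (coeff p i) * \<sigma> (coeff q j)" "coeff p i * coeff q j \<in> L" for i j
    using s p L by (auto simp: poly_over_def hom_on_def subfield_set_def)
  then show "map_poly \<sigma> (p * q) = map_poly \<sigma> p * map_poly \<sigma> q"
    by (intro poly_eqI) (simp add: coeff_map_poly coeff_mult hom_on_sum[OF s L])
qed

lemma hom_on_extend:
  fixes \<sigma> :: "'b::field \<Rightarrow> 'c::alg_closed_field"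
  assumes L: "subfield_set L" and s: "hom_on L \<sigma>"
    and alg: "p0 \<in> poly_over L" "p0 \<noteq> 0" "poly p0 x = 0"
  shows "\<exists>L' \<tau>. subfield_set L' \<and> hom_on L' \<tau> \<and> L \<subseteq> L' \<and> x \<in> L' \<and> (\<forall>y\<in>L. \<tau> y = \<sigma> y)"
proof -
  let ?P = "\<lambda>p. p \<in> poly_over L \<and> p \<noteq> 0 \<and> poly p x = 0"
  note ops = poly_over_ops[OF L]
  note [simp] = hom_on_0[OF s L]
  define m where "m = arg_min degree ?P"
  have m: "m \<in> poly_over L" "m \<noteq> 0" "poly m x = 0"
    using arg_min_natI[of ?P p0 degree] alg by (auto simp: m_def)
  have mmin: "degree m \<le> degree p" if "?P p" for p
    unfolding m_def by (rule arg_min_nat_le[of ?P]) (rule that)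
  have dm: "degree m > 0"
  proof (rule ccontr)
    assume "\<not> degree m > 0"
    then obtain a where "m = [:a:]" using degree_eq_zeroE by auto
    then show False using m by auto
  qed
  have ker: "\<exists>q\<in>poly_over L. p = m * q" if p: "p \<in> poly_over L" "poly p x = 0" for p
  proof -
    obtain q r where qr: "q\<in>poly_over L" "r\<in>poly_over L" "p = m * q + r" "r = 0 \<or> degree r < degree m"
      using poly_over_division[OF L m(1,2) p(1)] by blast
    have "poly r x = 0" using qr(3) p(2) m(3) by simp
    then have "r = 0" using mmin[of r] qr(2,4) by linarith
    then show ?thesis using qr by auto
  qed
  have inv: "\<exists>q\<in>poly_over L. poly p x * poly q x = 1"
    if "p \<in> poly_over L" "poly p x \<noteq> 0" "degree p < degree m" for p
    using that
  proof (induction "degree p" arbitrary: p rule: less_induct)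
    case less
    have pz: "p \<noteq> 0" using less.prems by auto
    show ?case
    proof (cases "degree p = 0")
      case True
      then obtain a where a: "p = [:a:]" using degree_eq_zeroE by auto
      have aL: "a \<in> L" using less.prems(1) a unfolding poly_over_def
        by (metis (mono_tags, lifting) coeff_pCons_0 mem_Collect_eq)
      then have "inverse a \<in> L" using L by (auto simp: subfield_set_def)
      then show ?thesis using ops(7) a pz by (intro bexI[of _ "[:inverse a:]"]) auto
    next
      case False
      obtain q r where qr: "q\<in>poly_over L" "r\<in>poly_over L" "m = p * q + r" "r = 0 \<or> degree r < degree p"
        using poly_over_division[OF L less.prems(1) pz m(1)] by blast
      have e: "poly p x * poly q x + poly r x = 0" using qr(3) m(3) by (metis poly_add poly_mult)
      have rx: "poly r x \<noteq> 0"
      proof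
        assume rx: "poly r x = 0"
        have r0: "r = 0" using mmin[of r] rx qr(2,4) less.prems(3) by linarith
        have qx: "poly q x = 0" using e rx less.prems by auto
        have qz: "q \<noteq> 0" using qr(3) r0 m(2) by auto
        have "degree m = degree p + degree q" using qr(3) r0 pz qz by (simp add: degree_mult_eq)
        then show False using mmin[of q] qx qz qr False by auto
      qed
      then have "degree r < degree p" using qr by auto
      from less.hyps[OF this qr(2) rx] this less.prems(3)
      obtain t where t: "t \<in> poly_over L" "poly r x * poly t x = 1" by auto
      have "poly p x * poly (- (q * t)) x = 1"
      proof -
        have "poly p x * poly q x = - poly r x" using e by (simp add: eq_neg_iff_add_eq_0)
        then have "poly p x * poly (- (q * t)) x = poly r x * poly t x"
          by (simp add: mult.assoc[symmetric])
        then show ?thesis using t by simp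
      qed
      then show ?thesis using t qr ops by blast
    qed
  qed
  define L' where "L' = (\<lambda>p. poly p x) ` poly_over L"
  have L'I: "poly p x \<in> L'" if "p \<in> poly_over L" for p using that by (auto simp: L'_def)
  have LL': "L \<subseteq> L'"
  proof
    fix a assume "a \<in> L"
    then show "a \<in> L'" using L'I[OF ops(7)[of a]] by simp
  qed
  have xL': "x \<in> L'"
  proof -
    have "[:0, 1:] \<in> poly_over L" using L
      by (auto simp: poly_over_def subfield_set_def coeff_pCons split: nat.split)
    from L'I[OF this] show ?thesis by simp
  qed
  have sub: "subfield_set L'"
    unfolding subfield_set_def
  proof (intro conjI ballI)
    show "0 \<in> L'" using L'I[OF ops(1)] by simp
    show "1 \<in> L'" using L'I[OF ops(2)] by simp
    fix y assume "y \<in> L'"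
    then obtain p where p: "p \<in> poly_over L" "y = poly p x" by (auto simp: L'_def)
    show "- y \<in> L'" using L'I[OF ops(4)[OF p(1)]] p by simp
    show "inverse y \<in> L'"
    proof (cases "y = 0")
      case True then show ?thesis using \<open>0 \<in> L'\<close> by simp
    next
      case False
      obtain q r where qr: "q\<in>poly_over L" "r\<in>poly_over L" "p = m * q + r" "r = 0 \<or> degree r < degree m"
        using poly_over_division[OF L m(1,2) p(1)] by blast
      have yr: "y = poly r x" using p qr(3) m(3) by simp
      then have "degree r < degree m" using qr False by auto
      with inv[of r] obtain t where t: "t \<in> poly_over L" "y * poly t x = 1"
        using qr yr False by auto
      then have "inverse y = poly t x" by (simp add: inverse_unique)
      then show ?thesis using L'I t by simp
    qed
    fix z assume "z \<in> L'"
    then obtain q where q: "q \<in> poly_over L" "z = poly q x" by (auto simp: L'_def)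
    show "y + z \<in> L'" using L'I[OF ops(3)[OF p(1) q(1)]] p q by simp
    show "y * z \<in> L'" using L'I[OF ops(5)[OF p(1) q(1)]] p q by simp
  qed
  have "\<sigma> (lead_coeff m) \<noteq> 0"
  proof
    assume "\<sigma> (lead_coeff m) = 0"
    then have "lead_coeff m = 0" using hom_on_inj[OF s L] m L
      by (intro inj_onD[OF hom_on_inj[OF s L]]) (auto simp: poly_over_def subfield_set_def)
    then show False using m by simp
  qed
  then have "degree (map_poly \<sigma> m) = degree m" by (intro map_poly_degree_eq) auto
  with dm obtain \<beta> where \<beta>: "poly (map_poly \<sigma> m) \<beta> = 0"
    using alg_closed_imp_poly_has_root[of "map_poly \<sigma> m"] by auto
  define rep where "rep y = (SOME p. p \<in> poly_over L \<and> poly p x = y)" for y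
  have rep: "rep y \<in> poly_over L" "poly (rep y) x = y" if "y \<in> L'" for y
    using someI_ex[of "\<lambda>p. p \<in> poly_over L \<and> poly p x = y"] that by (auto simp: rep_def L'_def)
  define \<tau> where "\<tau> y = poly (map_poly \<sigma> (rep y)) \<beta>" for y
  have tau: "\<tau> (poly p x) = poly (map_poly \<sigma> p) \<beta>" if p: "p \<in> poly_over L" for p
  proof -
    let ?r = "rep (poly p x)"
    note r = rep[OF L'I[OF p]]
    obtain q where q: "q \<in> poly_over L" "?r - p = m * q"
      using ker[OF ops(9)[OF r(1) p]] r by auto
    have "?r = p + m * q" using q by (simp add: algebra_simps)
    then have "map_poly \<sigma> ?r = map_poly \<sigma> p + map_poly \<sigma> m * map_poly \<sigma> q"
      using map_poly_hom_on[OF L s] p q m ops(5) by metis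
    then show ?thesis using \<beta> by (simp add: \<tau>_def)
  qed
  have on: "\<tau> y = \<sigma> y" if "y \<in> L" for y
    using tau[OF ops(7)[OF that]] by (cases "y = 0") (simp_all add: map_poly_pCons)
  have "hom_on L' \<tau>"
    unfolding hom_on_def
  proof (intro conjI ballI)
    show "\<tau> 1 = 1" using on[of 1] s L by (auto simp: hom_on_def subfield_set_def)
    fix y z assume "y \<in> L'" "z \<in> L'"
    then obtain p q where pq: "p \<in> poly_over L" "y = poly p x" "q \<in> poly_over L" "z = poly q x"
      by (auto simp: L'_def)
    show "\<tau> (y + z) = \<tau> y + \<tau> z"
      using tau[OF ops(3)[OF pq(1,3)]] tau[OF pq(1)] tau[OF pq(3)] pq map_poly_hom_on[OF L s pq(1,3)] by simp
    show "\<tau> (y * z) = \<tau> y * \<tau> z"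
      using tau[OF ops(5)[OF pq(1,3)]] tau[OF pq(1)] tau[OF pq(3)] pq map_poly_hom_on[OF L s pq(1,3)] by simp
  qed
  then show ?thesis using sub LL' xL' on by blast
qed


lemma vector_space_over_hom:
  assumes "field_hom (\<iota> :: 'k::field \<Rightarrow> 'b::field)"
  shows "vector_space (\<lambda>k x. \<iota> k * x)"
proof -
  interpret field_hom \<iota> by fact
  show ?thesis by unfold_locales (auto simp: algebra_simps hom_distribs)
qed

lemma algebraic_if_powers_in_span:
  assumes hom: "field_hom (\<iota> :: 'k::field \<Rightarrow> 'b::field)" and B: "finite B"
    and x: "\<And>i. x ^ i \<in> Modules.module.span (\<lambda>k x. \<iota> k * x) B"
  shows "\<exists>p\<in>poly_over (range \<iota>). p \<noteq> 0 \<and> poly p x = 0"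
proof -
  interpret h: field_hom \<iota> by fact
  interpret V: vector_space "\<lambda>k x. \<iota> k * x" by (rule vector_space_over_hom[OF hom])
  let ?N = "card B"
  have "\<exists>a. (\<exists>i\<le>?N. a i \<noteq> 0) \<and> (\<Sum>i\<le>?N. \<iota> (a i) * x ^ i) = 0"
  proof (cases "inj_on (\<lambda>i. x ^ i) {..?N}")
    case True
    let ?S = "(\<lambda>i. x ^ i) ` {..?N}"
    have "V.dependent ?S"
    proof (rule ccontr)
      assume ind: "\<not> V.dependent ?S"
      have "?S \<subseteq> V.span B" using x by auto
      with V.independent_span_bound[OF B ind] have "card ?S \<le> card B" by auto
      then show False using card_image[OF True] by simp
    qed
    then obtain u where u: "\<exists>v\<in>?S. u v \<noteq> 0" "(\<Sum>v\<in>?S. \<iota> (u v) * v) = 0"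
      using V.dependent_finite[of ?S] by auto
    then show ?thesis
      by (intro exI[of _ "\<lambda>i. u (x ^ i)"]) (auto simp: sum.reindex[OF True])
  next
    case False
    then obtain i j where ij: "i \<le> ?N" "j \<le> ?N" "i \<noteq> j" "x ^ i = x ^ j" by (auto simp: inj_on_def)
    have *: "(\<Sum>k\<le>?N. (if k = l then x ^ k else 0)) = x ^ l" if "l \<le> ?N" for l
      using that by (subst sum.delta) auto
    have "(\<Sum>k\<le>?N. \<iota> (if k = i then 1 else if k = j then - 1 else 0) * x ^ k)
        = (\<Sum>k\<le>?N. (if k = i then x ^ k else 0)) - (\<Sum>k\<le>?N. (if k = j then x ^ k else 0))"
      unfolding sum_subtractf[symmetric] using ij by (intro sum.cong) (auto simp: hom_distribs)
    then have "(\<Sum>k\<le>?N. \<iota> (if k = i then 1 else if k = j then - 1 else 0) * x ^ k) = 0"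
      using ij *[of i] *[of j] by simp
    then show ?thesis using ij
      by (intro exI[of _ "\<lambda>k. if k = i then 1 else if k = j then - 1 else 0"]) auto
  qed
  then obtain a i where a: "i \<le> ?N" "a i \<noteq> 0" "(\<Sum>i\<le>?N. \<iota> (a i) * x ^ i) = 0" by blast
  define p where "p = (\<Sum>i\<le>?N. monom (\<iota> (a i)) i)"
  have c: "coeff p k = (if k \<le> ?N then \<iota> (a k) else 0)" for k
    unfolding p_def coeff_sum by (simp add: coeff_monom)
  have "p \<in> poly_over (range \<iota>)"
    using h.hom_zero by (auto simp: poly_over_def c)
  moreover have "p \<noteq> 0" using a c[of i] by auto
  moreover have "poly p x = 0" using a(3) by (simp add: p_def poly_sum poly_monom)
  ultimately show ?thesis by blast
qed

lemma finite_extension_embed: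
  assumes i: "field_hom (\<iota> :: 'k::field \<Rightarrow> 'b::field)"
    and j: "field_hom (\<kappa> :: 'k \<Rightarrow> 'c::alg_closed_field)"
    and E: "subfield_set E" and fin: "finite_extension \<iota> E"
  shows "\<exists>\<sigma>. hom_on E \<sigma> \<and> (\<forall>k. \<sigma> (\<iota> k) = \<kappa> k)"
proof -
  interpret i: field_hom \<iota> by fact
  interpret j: field_hom \<kappa> by fact
  interpret V: vector_space "\<lambda>k x. \<iota> k * x" by (rule vector_space_over_hom[OF i])
  obtain B where B: "finite B" "V.span B = E" using fin by (auto simp: finite_extension_def)
  have "\<exists>L \<sigma>. subfield_set L \<and> hom_on L \<sigma> \<and> range \<iota> \<subseteq> L \<and> C \<subseteq> L \<and> (\<forall>k. \<sigma> (\<iota> k) = \<kappa> k)"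
    if "finite C" "C \<subseteq> E" for C
    using that
  proof (induction C rule: finite_induct)
    case empty
    have inv: "inv_into UNIV \<iota> (\<iota> k) = k" for k by (rule inv_f_f) (rule i.inj_f)
    have "subfield_set (range \<iota>)"
      unfolding subfield_set_def
      by (safe; (simp flip: i.hom_add i.hom_mult i.hom_uminus i.hom_inverse)?)
    moreover have "hom_on (range \<iota>) (\<lambda>y. \<kappa> (inv_into UNIV \<iota> y))"
      unfolding hom_on_def
      using inv[of 1] by (auto simp: inv j.hom_add j.hom_mult simp flip: i.hom_add i.hom_mult)
    ultimately show ?case by (intro exI[of _ "range \<iota>"] exI[of _ "\<lambda>y. \<kappa> (inv_into UNIV \<iota> y)"]) (auto simp: inv)
  next
    case (insert x C)
    then obtain L \<sigma> where L: "subfield_set L" "hom_on L \<sigma>" "range \<iota> \<subseteq> L" "C \<subseteq> L"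
      "\<And>k. \<sigma> (\<iota> k) = \<kappa> k" by auto
    have "x ^ n \<in> E" for n using E insert.prems by (induction n) (auto simp: subfield_set_def)
    then obtain p where p: "p\<in>poly_over (range \<iota>)" "p \<noteq> 0" "poly p x = 0"
      using algebraic_if_powers_in_span[OF i B(1), of x] B(2) by auto
    have "p \<in> poly_over L" using p(1) L(3) by (auto simp: poly_over_def)
    from hom_on_extend[OF L(1,2) this p(2,3)] obtain L' \<tau> where L': "subfield_set L'" "hom_on L' \<tau>"
      "L \<subseteq> L'" "x \<in> L'" "\<forall>y\<in>L. \<tau> y = \<sigma> y" by blast
    have "\<tau> (\<iota> k) = \<kappa> k" for k
    proof -
      have "\<iota> k \<in> L" using L(3) by blast
      then show ?thesis using L'(5) L(5) by simp
    qed
    then show ?case using L' L by (intro exI[of _ L'] exI[of _ \<tau>]) auto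
  qed
  moreover have "B \<subseteq> E" using B V.span_superset by blast
  ultimately obtain L \<sigma> where L: "subfield_set L" "hom_on L \<sigma>" "range \<iota> \<subseteq> L" "B \<subseteq> L"
      "\<And>k. \<sigma> (\<iota> k) = \<kappa> k" using B by meson
  have "V.subspace L" unfolding V.subspace_def using L(1,3) by (auto simp: subfield_set_def)
  then have "E \<subseteq> L" using V.span_minimal[of B L] L B by auto
  then have "hom_on E \<sigma>" using L(2) unfolding hom_on_def by blast
  then show ?thesis using L by blast
qed

lemma matrices_over_iff:
  "A \<in> matrices_over E n \<longleftrightarrow> A \<in> carrier_mat n n \<and> (\<forall>i<n. \<forall>j<n. A $$ (i, j) \<in> E)"
  unfolding matrices_over_def by (auto dest!: elements_matD)

lemma admits_finite_splitting_fieldI: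
  fixes \<delta> :: "'k::field \<Rightarrow> 'k" and \<iota> :: "'k \<Rightarrow> 'b::field"
  assumes P: "P \<in> carrier_mat n n"
    and fin: "finite_extension \<iota> E" and split: "splitting_field \<delta> n P \<iota> E \<delta>E"
  shows "admits_finite_splitting_field \<delta> n P"
proof -
  from split obtain \<phi> where i: "field_hom \<iota>" and E: "subfield_set E" and iE: "range \<iota> \<subseteq> E"
    and der: "derivation_on E \<delta>E" and ext: "\<And>x. \<delta>E (\<iota> x) = \<iota> (\<delta> x)"
    and phi: "differential_algebra_iso E n (twisted_derivation \<delta>E (map_mat \<iota> P)) (map_mat \<delta>E) \<phi>"
    unfolding splitting_field_def differential_extension_def subfield_iff_subfield_set by blast
  interpret i: field_hom \<iota> by fact
  have ac: "field_hom (to_ac :: 'k \<Rightarrow> 'k alg_closure)" by unfold_locales auto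
  interpret ac: field_hom "to_ac :: 'k \<Rightarrow> 'k alg_closure" by fact
  obtain \<sigma> :: "'b \<Rightarrow> 'k alg_closure" where s: "hom_on E \<sigma>" and si: "\<And>k. \<sigma> (\<iota> k) = to_ac k"
    using finite_extension_embed[OF i ac E fin] by blast
  have inj: "inj_on \<sigma> E" by (rule hom_on_inj[OF s E])
  define E' where "E' = \<sigma> ` E"
  define g where "g = inv_into E \<sigma>"
  have gs: "g (\<sigma> x) = x" if "x \<in> E" for x using inj that by (simp add: g_def)
  have sE: "\<sigma> x \<in> E'" if "x \<in> E" for x using that by (simp add: E'_def)
  have gE: "g y \<in> E" "\<sigma> (g y) = y" if "y \<in> E'" for y using that gs by (auto simp: E'_def)
  have E_ops: "x + y \<in> E" "x * y \<in> E" "- x \<in> E" "inverse x \<in> E" "x - y \<in> E"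
    "0 \<in> E" "1 \<in> E" if "x \<in> E" "y \<in> E" for x y
  proof -
    show "x + y \<in> E" "x * y \<in> E" "- x \<in> E" "inverse x \<in> E" "0 \<in> E" "1 \<in> E"
      using that E by (auto simp: subfield_set_def)
    then show "x - y \<in> E" using that E unfolding subfield_set_def by (metis diff_conv_add_uminus)
  qed
  have s_ops: "\<sigma> (x + y) = \<sigma> x + \<sigma> y" "\<sigma> (x * y) = \<sigma> x * \<sigma> y" "\<sigma> (- x) = - \<sigma> x"
    "\<sigma> (x - y) = \<sigma> x - \<sigma> y" if "x \<in> E" "y \<in> E" for x y
  proof -
    show "\<sigma> (x + y) = \<sigma> x + \<sigma> y" "\<sigma> (x * y) = \<sigma> x * \<sigma> y" using s that by (auto simp: hom_on_def)
    show m: "\<sigma> (- x) = - \<sigma> x" using hom_on_minus[OF s E] that by blast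
    have "\<sigma> (x + - y) = \<sigma> x + \<sigma> (- y)" using s that E_ops unfolding hom_on_def by blast
    then show "\<sigma> (x - y) = \<sigma> x - \<sigma> y" using hom_on_minus[OF s E] that by simp
  qed
  have s0: "\<sigma> 0 = 0" by (rule hom_on_0[OF s E])
  have s1: "\<sigma> 1 = 1" using s by (simp add: hom_on_def)
  have sinv: "\<sigma> (inverse x) = inverse (\<sigma> x)" if "x \<in> E" for x
  proof (cases "x = 0")
    case False
    then have "\<sigma> x * \<sigma> (inverse x) = 1" using s_ops(2)[of x "inverse x"] E_ops that s1 by simp
    then show ?thesis by (simp add: inverse_unique)
  qed (simp add: s0)
  have E': "subfield_set E'"
    unfolding subfield_set_def E'_def
  proof (safe)
    show "0 \<in> \<sigma> ` E" using s0 E by (metis imageI subfield_set_def)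
    show "1 \<in> \<sigma> ` E" using s1 E by (metis imageI subfield_set_def)
    fix x y assume xy: "x \<in> E" "y \<in> E"
    show "\<sigma> x + \<sigma> y \<in> \<sigma> ` E" "\<sigma> x * \<sigma> y \<in> \<sigma> ` E"
      using xy E_ops by (auto simp flip: s_ops(1,2))
  next
    fix x assume x: "x \<in> E"
    show "- \<sigma> x \<in> \<sigma> ` E" using x E_ops s_ops(3)[OF x x] by (metis imageI)
    show "inverse (\<sigma> x) \<in> \<sigma> ` E" using x E_ops sinv[OF x] by (metis imageI)
  qed
  define \<delta>' where "\<delta>' y = \<sigma> (\<delta>E (g y))" for y
  have dE: "\<delta>E x \<in> E" if "x \<in> E" for x using der that by (simp add: derivation_on_def)
  have d's: "\<delta>' (\<sigma> x) = \<sigma> (\<delta>E x)" if "x \<in> E" for x by (simp add: \<delta>'_def gs that)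
  have "derivation_on E' \<delta>'"
    unfolding derivation_on_def
  proof (intro conjI ballI)
    fix x' assume "x' \<in> E'"
    then obtain x where x: "x \<in> E" "x' = \<sigma> x" by (auto simp: E'_def)
    show "\<delta>' x' \<in> E'" using x by (simp add: d's sE dE)
    fix y' assume "y' \<in> E'"
    then obtain y where y: "y \<in> E" "y' = \<sigma> y" by (auto simp: E'_def)
    have "\<delta>' (\<sigma> (x + y)) = \<sigma> (\<delta>E x + \<delta>E y)"
      using d's[of "x + y"] der x y E_ops by (simp add: derivation_on_def)
    then show "\<delta>' (x' + y') = \<delta>' x' + \<delta>' y'" using x y by (simp add: d's s_ops dE)
    have "\<delta>' (\<sigma> (x * y)) = \<sigma> (\<delta>E x * y + x * \<delta>E y)"
      using d's[of "x * y"] der x y E_ops by (simp add: derivation_on_def)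
    then show "\<delta>' (x' * y') = \<delta>' x' * y' + x' * \<delta>' y'" using x y by (simp add: d's s_ops dE E_ops)
  qed
  then have de: "differential_extension \<delta> to_ac E' \<delta>'"
    unfolding differential_extension_def subfield_iff_subfield_set
    using E' ac iE ext d's si by (auto simp: E'_def) (metis image_iff rangeI subsetD)+
  have fe: "finite_extension to_ac E'"
  proof -
    interpret V: vector_space "\<lambda>k x. \<iota> k * x" by (rule vector_space_over_hom[OF i])
    interpret W: vector_space "\<lambda>(k::'k) x. to_ac k * x" by (rule vector_space_over_hom[OF ac])
    obtain B where B: "finite B" "V.span B = E" using fin by (auto simp: finite_extension_def)
    have BE: "B \<subseteq> E" using B V.span_superset by blast
    have "\<sigma> x \<in> W.span (\<sigma> ` B)" if x: "x \<in> E" for x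
    proof -
      from x B obtain u where u: "x = (\<Sum>b\<in>B. \<iota> (u b) * b)"
        using V.span_finite[OF B(1)] by auto
      have "\<iota> (u b) \<in> E" for b using iE by auto
      then have "\<sigma> x = (\<Sum>b\<in>B. to_ac (u b) * \<sigma> b)"
        unfolding u using BE E_ops
        by (subst hom_on_sum[OF s E]) (auto intro!: sum.cong simp: s_ops si subset_iff)
      then show ?thesis by (simp only:) (intro W.span_sum W.span_scale W.span_base imageI)
    qed
    moreover have "W.span (\<sigma> ` B) \<subseteq> E'"
    proof (rule W.span_minimal)
      show "\<sigma> ` B \<subseteq> E'" using BE by (auto simp: E'_def)
      have "to_ac k \<in> E'" for k using si[of k] sE[of "\<iota> k"] iE by auto
      then show "W.subspace E'" unfolding W.subspace_def using E' by (auto simp: subfield_set_def)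
    qed
    ultimately have "W.span (\<sigma> ` B) = E'" by (auto simp: E'_def)
    then show ?thesis unfolding finite_extension_def using B by blast
  qed
  let ?M = "matrices_over E n" and ?M' = "matrices_over E' n"
  let ?H = "map_mat \<sigma>" and ?G = "map_mat g"
  have H: "?H A \<in> ?M'" if "A \<in> ?M" for A using that sE by (auto simp: matrices_over_iff)
  have G: "?G A \<in> ?M" if "A \<in> ?M'" for A using that gE by (auto simp: matrices_over_iff)
  have GH: "?G (?H A) = A" if "A \<in> ?M" for A
    using that gs by (intro eq_matI) (auto simp: matrices_over_iff)
  have HG: "?H (?G A) = A" if "A \<in> ?M'" for A
    using that gE by (intro eq_matI) (auto simp: matrices_over_iff)
  have M_mult: "A * B \<in> ?M" "?H (A * B) = ?H A * ?H B" if "A \<in> ?M" "B \<in> ?M" for A B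
  proof -
    have car: "A \<in> carrier_mat n n" "B \<in> carrier_mat n n" using that by (auto simp: matrices_over_iff)
    have ent: "A $$ (i,k) * B $$ (k,j) \<in> E" if "i < n" "j < n" "k < n" for i j k
      using that \<open>A \<in> ?M\<close> \<open>B \<in> ?M\<close> E_ops by (auto simp: matrices_over_iff)
    show "A * B \<in> ?M"
      using car ent by (auto simp: matrices_over_iff scalar_prod_def intro!: subfield_set_sum[OF E])
    show "?H (A * B) = ?H A * ?H B"
    proof (rule eq_matI)
      fix i j assume "i < dim_row (?H A * ?H B)" "j < dim_col (?H A * ?H B)"
      then have ij: "i < n" "j < n" using car by auto
      have "\<sigma> (\<Sum>k = 0..<n. A $$ (i,k) * B $$ (k,j)) = (\<Sum>k = 0..<n. \<sigma> (A $$ (i,k) * B $$ (k,j)))"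
        using ent ij by (intro hom_on_sum[OF s E]) auto
      also have "\<dots> = (\<Sum>k = 0..<n. \<sigma> (A $$ (i,k)) * \<sigma> (B $$ (k,j)))"
        using that ij by (intro sum.cong s_ops) (auto simp: matrices_over_iff)
      finally show "?H (A * B) $$ (i, j) = (?H A * ?H B) $$ (i, j)"
        using ij car by (simp add: scalar_prod_def)
    qed (use car in auto)
  qed
  have M_add: "A + B \<in> ?M" "?H (A + B) = ?H A + ?H B" if "A \<in> ?M" "B \<in> ?M" for A B
    using that E_ops s_ops by (auto simp: matrices_over_iff)
  have M_diff: "A - B \<in> ?M" "?H (A - B) = ?H A - ?H B" if "A \<in> ?M" "B \<in> ?M" for A B
    using that E_ops s_ops by (auto simp: matrices_over_iff)
  have M_smult: "c \<cdot>\<^sub>m A \<in> ?M" "?H (c \<cdot>\<^sub>m A) = \<sigma> c \<cdot>\<^sub>m ?H A" if "c \<in> E" "A \<in> ?M" for c A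
    using that E_ops s_ops by (auto simp: matrices_over_iff)
  have M_der: "map_mat \<delta>E A \<in> ?M" "?H (map_mat \<delta>E A) = map_mat \<delta>' (?H A)" if "A \<in> ?M" for A
    using that dE d's by (auto simp: matrices_over_iff)
  have H1: "?H (1\<^sub>m n) = 1\<^sub>m n" "1\<^sub>m n \<in> ?M"
    using s0 s1 E by (auto simp: matrices_over_iff subfield_set_def)
  let ?P = "map_mat \<iota> P" and ?D = "twisted_derivation \<delta>E (map_mat \<iota> P)"
  let ?D' = "twisted_derivation \<delta>' (map_mat to_ac P)"
  have PM: "?P \<in> ?M" using P iE by (auto simp: matrices_over_iff)
  have HP: "?H ?P = map_mat to_ac P" by (auto simp: si)
  have DM: "?D A \<in> ?M" "?H (?D A) = ?D' (?H A)" if "A \<in> ?M" for A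
    using that PM M_der M_mult M_add M_diff HP by (simp_all add: twisted_derivation_def)
  have bij: "bij_betw \<phi> ?M ?M" and phi1: "\<phi> (1\<^sub>m n) = 1\<^sub>m n"
    and phi_add: "\<And>A B. A \<in> ?M \<Longrightarrow> B \<in> ?M \<Longrightarrow> \<phi> (A + B) = \<phi> A + \<phi> B"
    and phi_mult: "\<And>A B. A \<in> ?M \<Longrightarrow> B \<in> ?M \<Longrightarrow> \<phi> (A * B) = \<phi> A * \<phi> B"
    and phi_smult: "\<And>c A. c \<in> E \<Longrightarrow> A \<in> ?M \<Longrightarrow> \<phi> (c \<cdot>\<^sub>m A) = c \<cdot>\<^sub>m \<phi> A"
    and phi_D: "\<And>A. A \<in> ?M \<Longrightarrow> \<phi> (?D A) = map_mat \<delta>E (\<phi> A)"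
    using phi unfolding differential_algebra_iso_def by blast+
  have phiM: "\<phi> A \<in> ?M" if "A \<in> ?M" for A using bij that by (auto simp: bij_betw_def)
  define \<psi> where "\<psi> A = ?H (\<phi> (?G A))" for A
  have psi: "\<psi> (?H A) = ?H (\<phi> A)" if "A \<in> ?M" for A by (simp add: \<psi>_def GH that)
  have HM: "\<exists>B\<in>?M. A = ?H B" if "A \<in> ?M'" for A using HG G that by metis
  have bH: "bij_betw ?H ?M ?M'" and bG: "bij_betw ?G ?M' ?M"
    by (rule bij_betw_byWitness[where f' = ?G]; use H G GH HG in auto)
       (rule bij_betw_byWitness[where f' = ?H]; use H G GH HG in auto)
  have "bij_betw \<psi> ?M' ?M'"
    using bij_betw_trans[OF bij_betw_trans[OF bG bij] bH] unfolding \<psi>_def[abs_def] comp_def .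
  moreover have "\<psi> (1\<^sub>m n) = 1\<^sub>m n" using psi[of "1\<^sub>m n"] H1 phi1 by simp
  moreover have "\<psi> (A + B) = \<psi> A + \<psi> B" "\<psi> (A * B) = \<psi> A * \<psi> B" if AB: "A \<in> ?M'" "B \<in> ?M'" for A B
  proof -
    obtain A0 B0 where [simp]: "A0 \<in> ?M" "B0 \<in> ?M" and e: "A = ?H A0" "B = ?H B0"
      using AB HM by metis
    have "\<psi> (?H A0 + ?H B0) = \<psi> (?H (A0 + B0))" by (simp only: M_add(2) \<open>A0 \<in> ?M\<close> \<open>B0 \<in> ?M\<close>)
    also have "\<dots> = ?H (\<phi> (A0 + B0))" by (rule psi) (rule M_add(1); fact)
    also have "\<dots> = ?H (\<phi> A0) + ?H (\<phi> B0)" by (simp only: phi_add M_add(2) phiM \<open>A0 \<in> ?M\<close> \<open>B0 \<in> ?M\<close>)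
    finally show "\<psi> (A + B) = \<psi> A + \<psi> B" unfolding e by (simp only: psi \<open>A0 \<in> ?M\<close> \<open>B0 \<in> ?M\<close>)
    have "\<psi> (?H A0 * ?H B0) = \<psi> (?H (A0 * B0))" by (simp only: M_mult(2) \<open>A0 \<in> ?M\<close> \<open>B0 \<in> ?M\<close>)
    also have "\<dots> = ?H (\<phi> (A0 * B0))" by (rule psi) (rule M_mult(1); fact)
    also have "\<dots> = ?H (\<phi> A0) * ?H (\<phi> B0)" by (simp only: phi_mult M_mult(2) phiM \<open>A0 \<in> ?M\<close> \<open>B0 \<in> ?M\<close>)
    finally show "\<psi> (A * B) = \<psi> A * \<psi> B" unfolding e by (simp only: psi \<open>A0 \<in> ?M\<close> \<open>B0 \<in> ?M\<close>)
  qed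
  moreover have "\<psi> (c \<cdot>\<^sub>m A) = c \<cdot>\<^sub>m \<psi> A" if cA: "c \<in> E'" "A \<in> ?M'" for c A
  proof -
    obtain A0 where A0: "A0 \<in> ?M" "A = ?H A0" using cA HM by metis
    obtain c0 where c0: "c0 \<in> E" "c = \<sigma> c0" using cA by (auto simp: E'_def)
    have "\<psi> (\<sigma> c0 \<cdot>\<^sub>m ?H A0) = \<psi> (?H (c0 \<cdot>\<^sub>m A0))" by (simp only: M_smult(2) A0(1) c0(1))
    also have "\<dots> = ?H (\<phi> (c0 \<cdot>\<^sub>m A0))" by (rule psi) (rule M_smult(1)[OF c0(1) A0(1)])
    also have "\<dots> = \<sigma> c0 \<cdot>\<^sub>m ?H (\<phi> A0)" by (simp only: phi_smult M_smult(2) phiM A0(1) c0(1))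
    finally show ?thesis unfolding A0(2) c0(2) by (simp only: psi A0(1))
  qed
  moreover have "\<psi> (?D' A) = map_mat \<delta>' (\<psi> A)" if AM: "A \<in> ?M'" for A
  proof -
    obtain A0 where A0: "A0 \<in> ?M" "A = ?H A0" using HM[OF AM] by blast
    have "\<psi> (?D' (?H A0)) = \<psi> (?H (?D A0))" by (simp only: DM(2) A0(1))
    also have "\<dots> = ?H (\<phi> (?D A0))" by (rule psi) (rule DM(1)[OF A0(1)])
    also have "\<dots> = map_mat \<delta>' (?H (\<phi> A0))" by (simp only: phi_D M_der(2) phiM A0(1))
    finally show ?thesis unfolding A0(2) by (simp only: psi A0(1))
  qed
  ultimately have "differential_algebra_iso E' n ?D' (map_mat \<delta>') \<psi>"
    unfolding differential_algebra_iso_def by blast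
  then show ?thesis
    unfolding admits_finite_splitting_field_def splitting_field_def using de fe by blast
qed

section \<open>Existence and uniqueness of the derivation\<close>

lemma derivation_on_0: "derivation_on UNIV d \<Longrightarrow> d 0 = 0"
  unfolding derivation_on_def by (metis UNIV_I add_0 add_cancel_right_right)

lemma fract_as_quotient:
  fixes x :: "'a::idom fract"
  obtains p q where "q \<noteq> 0" "x = to_fract p / to_fract q"
  by (cases x) (auto simp: to_fract_def)

lemma euler_derivation_ex1: "\<exists>!\<delta> :: 'a::field poly fract \<Rightarrow> _. euler_derivation \<delta>"
proof -
  define e :: "'a poly \<Rightarrow> 'a poly" where "e p = [:0, 1:] * pderiv p" for p
  have e_add: "e (p + q) = e p + e q" and e_mult: "e (p * q) = e p * q + p * e q" for p q
    by (simp_all add: e_def pderiv_add pderiv_mult algebra_simps)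
  define rep :: "'a poly fract \<Rightarrow> 'a poly \<times> 'a poly" where
    "rep x = (SOME pq. snd pq \<noteq> 0 \<and> x = to_fract (fst pq) / to_fract (snd pq))" for x
  have rep: "snd (rep x) \<noteq> 0" "x = to_fract (fst (rep x)) / to_fract (snd (rep x))" for x
  proof -
    obtain p q where "q \<noteq> 0" "x = to_fract p / to_fract q" by (rule fract_as_quotient)
    then have "\<exists>pq :: 'a poly \<times> 'a poly. snd pq \<noteq> 0 \<and> x = to_fract (fst pq) / to_fract (snd pq)"
      by (intro exI[of _ "(p, q)"]) auto
    from someI_ex[OF this]
    show "snd (rep x) \<noteq> 0" "x = to_fract (fst (rep x)) / to_fract (snd (rep x))"
      unfolding rep_def by blast+
  qed
  define D :: "'a poly fract \<Rightarrow> 'a poly fract" where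
    "D x = (case rep x of (p, q) \<Rightarrow> to_fract (e p * q - p * e q) / to_fract (q * q))" for x
  have D: "D (to_fract p / to_fract q) = to_fract (e p * q - p * e q) / to_fract (q * q)"
    if q: "q \<noteq> 0" for p q
  proof -
    obtain p' q' where pq: "rep (to_fract p / to_fract q) = (p', q')" by fastforce
    have q': "q' \<noteq> 0" "to_fract p / to_fract q = to_fract p' / to_fract q'"
      using rep[of "to_fract p / to_fract q"] pq by auto
    then have "to_fract (p * q') = to_fract (p' * q)" using q by (simp add: field_simps)
    then have x: "p * q' = p' * q" by (simp only: to_fract_eq_iff)
    then have "e p * q' + p * e q' = e p' * q + p' * e q" by (metis e_mult)
    moreover have "(e p' * q' - p' * e q') * (q * q) - (e p * q - p * e q) * (q' * q')
      = - q * q' * ((e p * q' + p * e q') - (e p' * q + p' * e q))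
        + (p * q' - p' * q) * (q * e q' + q' * e q)"
      by (simp add: algebra_simps)
    ultimately have "(e p' * q' - p' * e q') * (q * q) = (e p * q - p * e q) * (q' * q')"
      using x by simp
    then have "to_fract (e p' * q' - p' * e q') * to_fract (q * q)
        = to_fract (e p * q - p * e q) * to_fract (q' * q')"
      by (simp only: to_fract_mult [symmetric])
    then show ?thesis using q q' by (simp add: D_def pq frac_eq_eq del: to_fract_mult to_fract_diff) 
  qed
  have D_poly: "D (to_fract p) = to_fract (e p)" for p
    using D[of 1 p] by (simp add: e_def)
  have "euler_derivation D"
    unfolding euler_derivation_def derivation_on_def
  proof (intro conjI ballI allI)
    show "D (to_fract [:0, 1:]) = to_fract [:0, 1:]" by (simp add: D_poly e_def pderiv_pCons)
    show "D (const_fract c) = 0" for c by (simp add: const_fract_def D_poly e_def pderiv_pCons)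
    fix x y :: "'a poly fract"
    obtain p q where pq: "q \<noteq> 0" "x = to_fract p / to_fract q" by (rule fract_as_quotient)
    obtain r s where rs: "s \<noteq> 0" "y = to_fract r / to_fract s" by (rule fract_as_quotient)
    have qs: "q * s \<noteq> 0" using pq rs by simp
    have "x + y = to_fract (p * s + r * q) / to_fract (q * s)"
      using pq rs by (simp add: field_simps)
    then show "D (x + y) = D x + D y"
      using pq(1) rs(1) unfolding pq(2) rs(2)
      by (simp only: D[OF qs] D[OF pq(1)] D[OF rs(1)] e_add e_mult) (simp add: field_simps)
    have "x * y = to_fract (p * r) / to_fract (q * s)" using pq rs by simp
    then show "D (x * y) = D x * y + x * D y"
      using pq(1) rs(1) unfolding pq(2) rs(2)
      by (simp only: D[OF qs] D[OF pq(1)] D[OF rs(1)] e_mult) (simp add: field_simps)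
  qed auto
  moreover have "\<delta> = D" if ed: "euler_derivation \<delta>" for \<delta>
  proof
    have add: "\<delta> (x + y) = \<delta> x + \<delta> y" and mult: "\<delta> (x * y) = \<delta> x * y + x * \<delta> y" for x y
      using ed by (auto simp: euler_derivation_def derivation_on_def)
    have t: "\<delta> (to_fract [:0, 1:]) = to_fract [:0, 1:]" and c: "\<delta> (to_fract [:c:]) = 0" for c
      using ed by (auto simp: euler_derivation_def const_fract_def)
    have pol: "\<delta> (to_fract p) = to_fract (e p)" for p
    proof (induction p)
      case 0 show ?case using c[of 0] by (simp add: e_def)
    next
      case (pCons a p)
      have s: "pCons a p = [:a:] + [:0, 1:] * p" by simp
      have ee: "e [:a:] = 0" "e [:0, 1:] = [:0, 1:]" by (simp_all add: e_def pderiv_pCons)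
      show ?case
        unfolding s e_add e_mult ee to_fract_add to_fract_mult add mult t c pCons.IH by simp
    qed
    fix x :: "'a poly fract"
    obtain p q where pq: "q \<noteq> 0" "x = to_fract p / to_fract q" by (rule fract_as_quotient)
    then have "to_fract p = x * to_fract q" by simp
    then have "to_fract (e p) = \<delta> x * to_fract q + x * to_fract (e q)" by (metis pol mult)
    then have "\<delta> x = (to_fract (e p) - x * to_fract (e q)) / to_fract q"
      using pq(1) by (simp add: nonzero_eq_divide_eq)
    then show "\<delta> x = D x" using pq by (simp add: D) (simp add: field_simps)
  qed
  ultimately show ?thesis by blast
qed

end

theory Submission
  imports Defs "Jordan_Normal_Form.Jordan_Normal_Form_Existence"
begin

text \<open>
  Everything turns on the linear system \<open>Y' = - P Y\<close>. An invertible solution \<open>Y\<close> over a finite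
  extension \<open>E\<close> splits the algebra, because conjugation \<open>A \<mapsto> Y\<inverse> A Y\<close> carries the derivation
  \<open>A' + P A - A P\<close> to the entrywise one (\<open>gauge_iso\<close>). Suppose that some invertible \<open>B\<close> over \<open>K\<close>
  transforms \<open>P\<close> into a diagonal matrix with entries \<open>a\<^sub>i\<close> such that \<open>y\<^sub>i' = N\<^sub>i a\<^sub>i y\<^sub>i\<close> is solvable in
  \<open>K\<close>. Then the matrix \<open>B\<close> times the diagonal matrix of the radicals \<open>x\<^sub>i\<close>, where \<open>x\<^sub>i\<close> is a root of
  order \<open>N\<^sub>i\<close> of \<open>1 / y\<^sub>i\<close>, is such a solution, and only finitely many roots have to be adjoined
  (\<open>splitting_gauge_criterion\<close>). All three sufficient conditions supply a matrix \<open>B\<close>. If \<open>P\<close> is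
  constant and diagonalizable, the columns of \<open>B\<close> are eigenvectors, and a rational eigenvalue \<open>a / N\<close> belongs
  to the power \<open>t\<^sup>a\<close>. If \<open>P\<close> is diagonal, \<open>B\<close> is the identity. If \<open>P\<close> is triangular, \<open>B\<close> is
  unipotent with polynomial entries that solve equations \<open>t b' + (r\<^sub>i - r\<^sub>j) b = q\<close>; the left hand side
  multiplies \<open>t\<^sup>m\<close> by \<open>m + r\<^sub>i - r\<^sub>j\<close>, which is nonzero because \<open>r\<^sub>i - r\<^sub>j\<close> is not an integer.

  Conversely, let \<open>P\<^sub>0\<close> be constant and let \<open>E\<close> split the algebra. The preimages of the matrix units
  are horizontal, that is, they satisfy \<open>A' = A P\<^sub>0 - P\<^sub>0 A\<close>, and they span all matrices over \<open>E\<close>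
  (\<open>horizontal_matrices_span\<close>). A left eigenvector \<open>l\<close> of \<open>P\<^sub>0\<close> for \<open>\<alpha>\<close> and a right eigenvector \<open>r\<close>
  for \<open>\<beta>\<close> therefore give a nonzero \<open>y = l A r\<close> with \<open>y' = (\<beta> - \<alpha>) y\<close>. As \<open>y\<close> is algebraic over
  \<open>F(t)\<close>, finitely many monomials \<open>t\<^sup>j y\<^sup>i\<close> are linearly dependent over the constants; they are
  eigenvectors of the derivation for \<open>j + i (\<beta> - \<alpha>)\<close>, so two of these numbers agree and \<open>\<beta> - \<alpha>\<close> is
  rational (\<open>exponential_rational\<close>). Since the trace vanishes, all eigenvalues are then rational. If
  \<open>P\<^sub>0\<close> had a Jordan chain \<open>P\<^sub>0 s = c s\<close>, \<open>P\<^sub>0 r = c r + s\<close>, then \<open>y = l A r\<close> and \<open>z = l A s\<close> with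
  \<open>l P\<^sub>0 = c l\<close> would satisfy \<open>y' = z\<close> and \<open>z' = 0\<close>, and \<open>y / z\<close> would be a logarithm of \<open>t\<close>, which is
  not algebraic (\<open>no_logarithm\<close>). Hence \<open>P\<^sub>0\<close> is diagonalizable.

  The numbers \<open>\<alpha>\<close>, \<open>\<beta>\<close> and the entries of \<open>l\<close>, \<open>r\<close> are algebraic over \<open>F\<close> but may lie outside \<open>E\<close>.
  They are adjoined to \<open>E\<close> first; the derivation extends, and they become constants
  (\<open>adjoin_roots\<close>).
\<close>

section \<open>Derivations on subfields\<close>

text \<open>
  Separability of the adjoined roots and the comparison of exponents of \<open>t\<close> need nonzero integers to
  be invertible in \<open>F(t)\<close> and in its algebraic closure; both inherit characteristic 0 from here.
\<close>
instance fract :: ("{idom,ring_char_0}") field_char_0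
proof
  show "inj (of_nat :: nat \<Rightarrow> 'a fract)"
  proof (rule injI)
    fix m n :: nat
    assume "(of_nat m :: 'a fract) = of_nat n"
    then have "to_fract (of_nat m :: 'a) = to_fract (of_nat n)"
      by (simp add: to_fract_def of_nat_fract)
    then show "m = n" by (simp only: to_fract_eq_iff of_nat_eq_iff)
  qed
qed

lemma poly_over_pCons: "pCons a p \<in> poly_over L \<longleftrightarrow> a \<in> L \<and> p \<in> poly_over L"
proof
  assume *: "pCons a p \<in> poly_over L"
  then have "coeff (pCons a p) 0 \<in> L" "coeff (pCons a p) (Suc i) \<in> L" for i
    unfolding poly_over_def by blast+
  then show "a \<in> L \<and> p \<in> poly_over L" by (simp add: poly_over_def)
qed (auto simp: poly_over_def coeff_pCons split: nat.splits)

locale differential_subfield =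
  fixes E :: "'b::field set" and d :: "'b \<Rightarrow> 'b"
  assumes subfield: "subfield_set E" and derivation: "derivation_on E d"
begin

lemma closed [simp, intro]:
  "0 \<in> E" "1 \<in> E" "x \<in> E \<Longrightarrow> y \<in> E \<Longrightarrow> x + y \<in> E" "x \<in> E \<Longrightarrow> y \<in> E \<Longrightarrow> x * y \<in> E"
  "x \<in> E \<Longrightarrow> - x \<in> E" "x \<in> E \<Longrightarrow> inverse x \<in> E"
  using subfield by (auto simp: subfield_set_def)

lemma closed' [simp, intro]:
  "x \<in> E \<Longrightarrow> y \<in> E \<Longrightarrow> x - y \<in> E" "x \<in> E \<Longrightarrow> y \<in> E \<Longrightarrow> x / y \<in> E"
  using closed(3)[of x "- y"] closed(4)[of x "inverse y"] closed(5,6)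
  by (auto simp: field_class.field_divide_inverse)

lemma closed_of_nat [simp, intro]: "of_nat n \<in> E" by (induction n) auto

lemma closed_power [simp, intro]: "x \<in> E \<Longrightarrow> x ^ n \<in> E" by (induction n) auto

lemma closed_sum: "(\<And>i. i \<in> A \<Longrightarrow> f i \<in> E) \<Longrightarrow> sum f A \<in> E"
  by (rule subfield_set_sum[OF subfield])

lemma closed_poly: "p \<in> poly_over E \<Longrightarrow> x \<in> E \<Longrightarrow> poly p x \<in> E"
  by (auto simp: poly_altdef poly_over_def intro!: closed_sum)

lemma d_closed [simp, intro]: "x \<in> E \<Longrightarrow> d x \<in> E"
  and d_add: "x \<in> E \<Longrightarrow> y \<in> E \<Longrightarrow> d (x + y) = d x + d y"
  and d_mult: "x \<in> E \<Longrightarrow> y \<in> E \<Longrightarrow> d (x * y) = d x * y + x * d y"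
  using derivation by (auto simp: derivation_on_def)

lemma d_0 [simp]: "d 0 = 0"
  using d_add[of 0 0] by (metis add_0 add_cancel_right_right closed(1))

lemma d_1 [simp]: "d 1 = 0"
  using d_mult[of 1 1] by (metis add_cancel_right_right closed(2) mult_1 mult_1_right)

lemma d_minus: "x \<in> E \<Longrightarrow> d (- x) = - d x"
  using d_add[of x "- x"] by (simp add: eq_neg_iff_add_eq_0 add.commute)

lemma d_diff: "x \<in> E \<Longrightarrow> y \<in> E \<Longrightarrow> d (x - y) = d x - d y"
  using d_add[of x "- y"] d_minus[of y] by simp

lemma d_sum: "(\<And>i. i \<in> A \<Longrightarrow> f i \<in> E) \<Longrightarrow> d (sum f A) = (\<Sum>i\<in>A. d (f i))"
  by (induction A rule: infinite_finite_induct) (auto simp: d_add closed_sum)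

lemma d_of_nat [simp]: "d (of_nat n) = 0" by (induction n) (auto simp: d_add)

lemma d_power: "x \<in> E \<Longrightarrow> d (x ^ n) = of_nat n * x ^ (n - 1) * d x"
proof (induction n)
  case (Suc n)
  then show ?case by (cases n) (auto simp: d_mult algebra_simps)
qed simp

lemma poly_over_pderiv: "p \<in> poly_over E \<Longrightarrow> pderiv p \<in> poly_over E"
  by (auto simp: poly_over_def coeff_pderiv simp del: of_nat_Suc)

lemma poly_over_map_d: "p \<in> poly_over E \<Longrightarrow> map_poly d p \<in> poly_over E"
  by (auto simp: poly_over_def coeff_map_poly)

lemma map_poly_d_add:
  "p \<in> poly_over E \<Longrightarrow> q \<in> poly_over E \<Longrightarrow> map_poly d (p + q) = map_poly d p + map_poly d q"
  by (rule poly_eqI) (auto simp: coeff_map_poly poly_over_def d_add)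

lemma map_poly_d_mult:
  assumes "p \<in> poly_over E" "q \<in> poly_over E"
  shows "map_poly d (p * q) = map_poly d p * q + p * map_poly d q"
proof (rule poly_eqI)
  fix n
  have "d (\<Sum>i\<le>n. coeff p i * coeff q (n - i))
      = (\<Sum>i\<le>n. d (coeff p i) * coeff q (n - i) + coeff p i * d (coeff q (n - i)))"
    using assms by (subst d_sum) (auto simp: poly_over_def d_mult)
  then show "coeff (map_poly d (p * q)) n = coeff (map_poly d p * q + p * map_poly d q) n"
    by (simp add: coeff_map_poly coeff_mult sum.distrib)
qed

lemma d_poly:
  assumes "p \<in> poly_over E" "x \<in> E"
  shows "d (poly p x) = poly (map_poly d p) x + poly (pderiv p) x * d x"
  using assms(1)
proof (induction p)
  case (pCons a p)
  have ap: "a \<in> E" "p \<in> poly_over E"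
    using pCons.prems by (auto simp: poly_over_pCons)
  have "map_poly d (pCons a p) = pCons (d a) (map_poly d p)"
    by (rule poly_eqI) (simp add: coeff_map_poly coeff_pCons split: nat.split)
  then show ?case using ap assms(2) pCons.IH
    by (simp add: closed_poly d_add d_mult pderiv_pCons algebra_simps)
qed simp

end

locale finite_differential_extension =
  fixes \<delta> :: "'k::field \<Rightarrow> 'k" and \<iota> :: "'k \<Rightarrow> 'b::field" and E :: "'b set" and d :: "'b \<Rightarrow> 'b"
  assumes extension: "differential_extension \<delta> \<iota> E d" and finite: "finite_extension \<iota> E"
begin

sublocale differential_subfield E d
  using extension by unfold_locales (auto simp: differential_extension_def subfield_iff_subfield_set)

lemma hom: "field_hom \<iota>" and range_subset: "range \<iota> \<subseteq> E" and d_hom: "d (\<iota> k) = \<iota> (\<delta> k)"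
  using extension by (auto simp: differential_extension_def)

lemma hom_closed [simp, intro]: "\<iota> k \<in> E" using range_subset by auto

lemma algebraic:
  assumes "x \<in> E"
  shows "\<exists>p\<in>poly_over (range \<iota>). p \<noteq> 0 \<and> poly p x = 0"
proof -
  obtain B where B: "finite B" "Modules.module.span (\<lambda>k x. \<iota> k * x) B = E"
    using finite by (auto simp: finite_extension_def)
  show ?thesis
    by (rule algebraic_if_powers_in_span[OF hom B(1)]) (use assms B(2) in auto)
qed

end

text \<open>
  The inverse of \<open>x\<close> is a polynomial in \<open>x\<close>: an algebraic equation for \<open>x\<close>, divided by a power of
  \<open>x\<close>, has a nonzero constant term \<open>a\<close> and reads \<open>x g(x) = - a\<close>.
\<close>
lemma finite_subring_is_subfield:
  fixes \<iota> :: "'k::field \<Rightarrow> 'b::field"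
  assumes hom: "field_hom \<iota>" and fin: "finite_extension \<iota> R"
    and one: "1 \<in> R" and mult: "\<And>x y. x \<in> R \<Longrightarrow> y \<in> R \<Longrightarrow> x * y \<in> R"
  shows "subfield_set R"
proof -
  interpret h: field_hom \<iota> by fact
  interpret V: vector_space "\<lambda>k x. \<iota> k * x" by (rule vector_space_over_hom[OF hom])
  obtain B where B: "finite B" "V.span B = R" using fin by (auto simp: finite_extension_def)
  have lin: "0 \<in> R" "\<And>x y. x \<in> R \<Longrightarrow> y \<in> R \<Longrightarrow> x + y \<in> R" "\<And>x k. x \<in> R \<Longrightarrow> \<iota> k * x \<in> R"
    unfolding B(2)[symmetric] by (rule V.span_zero V.span_add V.span_scale; assumption)+
  have neg: "- x \<in> R" if "x \<in> R" for x using lin(3)[OF that, of "- 1"] by (simp add: h.hom_uminus)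
  have \<iota>R: "\<iota> k \<in> R" for k using lin(3)[OF one, of k] by simp
  have pR: "poly p x \<in> R" if "x \<in> R" "p \<in> poly_over (range \<iota>)" for p x
    using that(2)
  proof (induction p)
    case (pCons a p)
    then have "a \<in> range \<iota>" "p \<in> poly_over (range \<iota>)"
      by (auto simp: poly_over_pCons)
    then show ?case using pCons.IH mult[OF that(1)] lin(2) \<iota>R by auto
  qed (simp add: lin)
  have inv: "inverse x \<in> R" if x: "x \<in> R" "x \<noteq> 0" for x
  proof -
    have "x ^ n \<in> R" for n by (induction n) (simp_all add: one mult x)
    then obtain p where p: "p \<in> poly_over (range \<iota>)" "p \<noteq> 0" "poly p x = 0"
      using algebraic_if_powers_in_span[OF hom B(1), of x] B(2) by auto
    then show ?thesis
    proof (induction p)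
      case (pCons a p)
      then have a: "a \<in> range \<iota>" "p \<in> poly_over (range \<iota>)"
        by (auto simp: poly_over_pCons)
      show ?case
      proof (cases "a = 0")
        case True
        then show ?thesis using pCons.IH[OF a(2)] pCons.prems x(2) by simp
      next
        case False
        obtain k where k: "a = \<iota> k" using a by auto
        have "x * poly p x = - a" using pCons.prems(3) by (simp add: eq_neg_iff_add_eq_0 add.commute)
        then have "x * (\<iota> (- inverse k) * poly p x) = 1"
          using False by (simp add: k h.hom_uminus h.hom_inverse mult.left_commute[of x])
        then have "inverse x = \<iota> (- inverse k) * poly p x" by (rule inverse_unique)
        then show ?thesis using lin(3)[OF pR[OF x(1) a(2)], of "- inverse k"] by simp
      qed
    qed simp
  qed
  have "inverse x \<in> R" if "x \<in> R" for x using inv[OF that] lin(1) by (cases "x = 0") auto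
  then show ?thesis unfolding subfield_set_def using lin(1,2) one mult neg by simp
qed

section \<open>Adjoining roots to finite differential extensions\<close>

context finite_differential_extension
begin

text \<open>
  The field is \<open>E[x]\<close>, and the derivative of \<open>p(x)\<close> can only be \<open>p\<^sup>d(x) + p'(x) u\<close>, where \<open>p\<^sup>d\<close> has
  the differentiated coefficients and \<open>u\<close> is forced by \<open>f(x) = 0\<close>. It depends on \<open>p(x)\<close> alone
  because it vanishes for multiples of the minimal polynomial \<open>m\<close>: at the simple root \<open>x\<close> the
  cofactor \<open>g\<close> in \<open>f = m g\<close> is nonzero, so what holds for \<open>f\<close> holds for \<open>m\<close>.
\<close>
lemma adjoin_root:
  assumes f: "f \<in> poly_over E" "poly f x = 0" "poly (pderiv f) x \<noteq> 0"
  shows "\<exists>E' d'. finite_differential_extension \<delta> \<iota> E' d' \<and> E \<subseteq> E' \<and> x \<in> E' \<and> (\<forall>y\<in>E. d' y = d y)"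
proof -
  let ?P = "\<lambda>p. p \<in> poly_over E \<and> p \<noteq> 0 \<and> poly p x = 0"
  note ops = poly_over_ops[OF subfield]
  have "?P f" using f by auto
  define m where "m = arg_min degree ?P"
  have m: "m \<in> poly_over E" "m \<noteq> 0" "poly m x = 0"
    using arg_min_natI[of ?P f degree] \<open>?P f\<close> by (auto simp: m_def)
  have mmin: "degree m \<le> degree p" if "?P p" for p
    unfolding m_def by (rule arg_min_nat_le[of ?P]) (rule that)
  have reduce: "\<exists>q r. q \<in> poly_over E \<and> r \<in> poly_over E \<and> p = m * q + r \<and> (r = 0 \<or> degree r < degree m)"
    if "p \<in> poly_over E" for p
    using poly_over_division[OF subfield m(1,2) that] by blast
  have ker: "\<exists>q\<in>poly_over E. p = m * q" if p: "p \<in> poly_over E" "poly p x = 0" for p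
  proof -
    obtain q r where qr: "q\<in>poly_over E" "r\<in>poly_over E" "p = m * q + r" "r = 0 \<or> degree r < degree m"
      using reduce[OF p(1)] by blast
    have "poly r x = 0" using qr(3) p(2) m(3) by simp
    then have "r = 0" using mmin[of r] qr(2,4) by linarith
    then show ?thesis using qr by auto
  qed
  define R where "R = (\<lambda>p. poly p x) ` poly_over E"
  have RI: "poly p x \<in> R" if "p \<in> poly_over E" for p using that by (auto simp: R_def)
  have RE: "\<exists>p\<in>poly_over E. y = poly p x" if "y \<in> R" for y using that by (auto simp: R_def)
  have ER: "E \<subseteq> R"
  proof
    fix e assume "e \<in> E"
    then show "e \<in> R" using RI[OF ops(7)[of e]] by simp
  qed
  have xR: "x \<in> R" using RI[of "[:0, 1:]"] by (simp add: poly_over_pCons ops(1))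
  have R_mult: "y * z \<in> R" if yz: "y \<in> R" "z \<in> R" for y z
  proof -
    obtain p q where pq: "p \<in> poly_over E" "y = poly p x" "q \<in> poly_over E" "z = poly q x"
      using RE[OF yz(1)] RE[OF yz(2)] by blast
    show ?thesis using RI[OF ops(5)[OF pq(1,3)]] by (simp add: pq(2,4))
  qed
  interpret V: vector_space "\<lambda>k x. \<iota> k * x" by (rule vector_space_over_hom[OF hom])
  have finR: "finite_extension \<iota> R"
  proof -
    obtain B where B: "finite B" "V.span B = E"
      using finite by (auto simp: finite_extension_def)
    define C where "C = (\<lambda>(b, k). b * x ^ k) ` (B \<times> {..<degree m})"
    have step: "e * x ^ k \<in> V.span C" if "e \<in> E" "k < degree m" for e k
    proof -
      have "e \<in> range (\<lambda>u. \<Sum>b\<in>B. \<iota> (u b) * b)"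
        using \<open>e \<in> E\<close> unfolding V.span_finite[OF B(1), symmetric] B(2) .
      then obtain u where "e = (\<Sum>b\<in>B. \<iota> (u b) * b)" by blast
      then have e: "e * x ^ k = (\<Sum>b\<in>B. \<iota> (u b) * (b * x ^ k))"
        by (simp add: sum_distrib_right mult.assoc)
      show ?thesis unfolding e
      proof (rule V.span_sum, rule V.span_scale, rule V.span_base)
        fix b assume "b \<in> B"
        then show "b * x ^ k \<in> C" using \<open>k < degree m\<close> by (auto simp: C_def)
      qed
    qed
    have BE: "B \<subseteq> E" using V.span_superset[of B] unfolding B(2) .
    have "C \<subseteq> R"
    proof
      fix c assume "c \<in> C"
      then obtain b k where "b \<in> B" "c = b * x ^ k" by (auto simp: C_def)
      then show "c \<in> R" using RI[OF ops(6)[of b k]] BE by (auto simp: poly_monom)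
    qed
    moreover have "V.subspace R"
      proof (rule V.subspaceI)
        show "0 \<in> R" using ER by auto
        show "y + z \<in> R" if yz: "y \<in> R" "z \<in> R" for y z
        proof -
          obtain p q where pq: "p \<in> poly_over E" "y = poly p x" "q \<in> poly_over E" "z = poly q x"
            using RE[OF yz(1)] RE[OF yz(2)] by blast
          show ?thesis using RI[OF ops(3)[OF pq(1,3)]] by (simp add: pq(2,4))
        qed
        show "\<iota> c * y \<in> R" if "y \<in> R" for c y using R_mult that ER by auto
      qed
    ultimately have "V.span C \<subseteq> R" by (rule V.span_minimal)
    moreover have "R \<subseteq> V.span C"
    proof
      fix y assume "y \<in> R"
      then obtain p where p: "p \<in> poly_over E" "y = poly p x" by (auto simp: R_def)
      obtain q r where qr: "r\<in>poly_over E" "p = m * q + r" "r = 0 \<or> degree r < degree m"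
        using reduce[OF p(1)] by blast
      have "poly p x = (\<Sum>k\<le>degree r. coeff r k * x ^ k)"
        using m(3) unfolding qr(2) by (simp flip: poly_altdef)
      also have "\<dots> \<in> V.span C"
      proof (rule V.span_sum)
        fix k assume k: "k \<in> {..degree r}"
        show "coeff r k * x ^ k \<in> V.span C"
        proof (cases "r = 0")
          case False
          then show ?thesis using qr k by (intro step) (auto simp: poly_over_def)
        qed (simp add: V.span_zero)
      qed
      finally show "y \<in> V.span C" using p by simp
    qed
    ultimately have "V.span C = R" by (rule antisym)
    moreover have "finite C" using B(1) by (auto simp: C_def)
    ultimately show ?thesis unfolding finite_extension_def by blast
  qed
  have subR: "subfield_set R"
    by (rule finite_subring_is_subfield[OF hom finR]) (use ER R_mult in auto)
  \<comment> \<open>The value of the derivation at \<open>x\<close> is forced by differentiating \<open>f x = 0\<close>.\<close>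
  define u where "u = - poly (map_poly d f) x / poly (pderiv f) x"
  have u: "u \<in> R"
    unfolding u_def field_class.field_divide_inverse
    using subR RI poly_over_map_d poly_over_pderiv f(1) by (auto simp: subfield_set_def intro!: R_mult)
  define D where "D p = poly (map_poly d p) x + poly (pderiv p) x * u" for p
  have D_add: "D (p + q) = D p + D q" if "p \<in> poly_over E" "q \<in> poly_over E" for p q
    using that by (simp add: D_def map_poly_d_add pderiv_add algebra_simps)
  have D_mult: "D (p * q) = D p * poly q x + poly p x * D q" if "p \<in> poly_over E" "q \<in> poly_over E" for p q
    using that by (simp add: D_def map_poly_d_mult pderiv_mult algebra_simps)
  have Df: "D f = 0" using f by (simp add: D_def u_def)
  have Dm: "D m = 0"
  proof -
    obtain g where g: "g \<in> poly_over E" "f = m * g" using ker f by blast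
    have "poly g x \<noteq> 0" using f(3) m(3) by (auto simp: g(2) pderiv_mult)
    then show ?thesis using Df D_mult[OF m(1) g(1)] m(3) by (simp add: g(2))
  qed
  have D_ker: "D p = 0" if "p \<in> poly_over E" "poly p x = 0" for p
    using ker[OF that] D_mult[OF m(1)] Dm m(3) by auto
  have D_cong: "D p = D q" if "p \<in> poly_over E" "q \<in> poly_over E" "poly p x = poly q x" for p q
    using D_ker[OF ops(9)[OF that(1,2)]] D_add[OF ops(9)[OF that(1,2)] that(2)] that(3) by simp
  define rep where "rep y = (SOME p. p \<in> poly_over E \<and> poly p x = y)" for y
  have rep: "rep y \<in> poly_over E" "poly (rep y) x = y" if "y \<in> R" for y
    using someI_ex[of "\<lambda>p. p \<in> poly_over E \<and> poly p x = y"] that by (auto simp: rep_def R_def)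
  define d' where "d' y = D (rep y)" for y
  have d': "d' (poly p x) = D p" if "p \<in> poly_over E" for p
    unfolding d'_def using rep[OF RI[OF that]] that by (intro D_cong) auto
  have der: "derivation_on R d'"
    unfolding derivation_on_def
  proof (intro conjI ballI)
    fix y assume "y \<in> R"
    then obtain p where p: "p \<in> poly_over E" "y = poly p x" by (auto simp: R_def)
    show "d' y \<in> R"
      unfolding p(2) d'[OF p(1)] D_def
      using subR R_mult u RI[OF poly_over_map_d[OF p(1)]] RI[OF poly_over_pderiv[OF p(1)]]
      by (simp add: subfield_set_def)
    fix z assume "z \<in> R"
    then obtain q where q: "q \<in> poly_over E" "z = poly q x" by (auto simp: R_def)
    show "d' (y + z) = d' y + d' z"
      using d'[OF ops(3)[OF p(1) q(1)]] d' p q D_add by simp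
    show "d' (y * z) = d' y * z + y * d' z"
      using d'[OF ops(5)[OF p(1) q(1)]] d' p q D_mult by simp
  qed
  have d'_eq: "d' y = d y" if "y \<in> E" for y
  proof -
    have "map_poly d [:y:] = [:d y:]"
      by (rule poly_eqI) (simp add: coeff_map_poly coeff_pCons split: nat.split)
    then show ?thesis using d'[OF ops(7)[OF that]] by (simp add: D_def pderiv_pCons)
  qed
  have "range \<iota> \<subseteq> R" using ER range_subset by simp
  then have "differential_extension \<delta> \<iota> R d'"
    unfolding differential_extension_def subfield_iff_subfield_set
    using hom der subR d'_eq d_hom by simp
  then have "finite_differential_extension \<delta> \<iota> R d'"
    using finR by (rule finite_differential_extension.intro)
  then show ?thesis using ER xR d'_eq by blast
qed

lemma adjoin_roots:
  assumes "finite S"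
    and "\<And>x. x \<in> S \<Longrightarrow> \<exists>f\<in>poly_over E. poly f x = 0 \<and> poly (pderiv f) x \<noteq> 0"
  shows "\<exists>E' d'. finite_differential_extension \<delta> \<iota> E' d' \<and> E \<subseteq> E' \<and> S \<subseteq> E' \<and> (\<forall>y\<in>E. d' y = d y)"
  using assms
proof (induction S rule: finite_induct)
  case empty
  show ?case using finite_differential_extension_axioms by blast
next
  case (insert x S)
  then obtain E1 d1 where E1: "finite_differential_extension \<delta> \<iota> E1 d1" "E \<subseteq> E1" "S \<subseteq> E1"
    "\<forall>y\<in>E. d1 y = d y" by auto
  interpret E1: finite_differential_extension \<delta> \<iota> E1 d1 by (rule E1(1))
  obtain f where f: "f \<in> poly_over E" "poly f x = 0" "poly (pderiv f) x \<noteq> 0"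
    using insert.prems by blast
  then have "f \<in> poly_over E1" using E1(2) by (auto simp: poly_over_def)
  from E1.adjoin_root[OF this f(2,3)] obtain E2 d2 where
    "finite_differential_extension \<delta> \<iota> E2 d2" "E1 \<subseteq> E2" "x \<in> E2" "\<forall>y\<in>E1. d2 y = d1 y" by blast
  then show ?case using E1 by (intro exI[of _ E2] exI[of _ d2]) auto
qed

end

section \<open>Splitting by a change of gauge\<close>

lemma matrices_overD [dest]: "A \<in> matrices_over E n \<Longrightarrow> A \<in> carrier_mat n n"
  by (simp add: matrices_over_iff)

context differential_subfield
begin

lemma matrices_over_add: "A \<in> matrices_over E n \<Longrightarrow> B \<in> matrices_over E n \<Longrightarrow> A + B \<in> matrices_over E n"
  by (auto simp: matrices_over_iff)

lemma matrices_over_diff: "A \<in> matrices_over E n \<Longrightarrow> B \<in> matrices_over E n \<Longrightarrow> A - B \<in> matrices_over E n"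
  by (auto simp: matrices_over_iff)

lemma matrices_over_mult: "A \<in> matrices_over E n \<Longrightarrow> B \<in> matrices_over E n \<Longrightarrow> A * B \<in> matrices_over E n"
  by (auto simp: matrices_over_iff scalar_prod_def intro!: closed_sum)

lemma matrices_over_d: "A \<in> matrices_over E n \<Longrightarrow> map_mat d A \<in> matrices_over E n"
  by (auto simp: matrices_over_iff)

lemma map_mat_d_mult:
  assumes A: "A \<in> matrices_over E n" and B: "B \<in> matrices_over E n"
  shows "map_mat d (A * B) = map_mat d A * B + A * map_mat d B"
proof (rule eq_matI)
  fix i j assume "i < dim_row (map_mat d A * B + A * map_mat d B)"
    "j < dim_col (map_mat d A * B + A * map_mat d B)"
  then have ij: "i < n" "j < n" using A B by (auto simp: matrices_over_iff)
  have "d (\<Sum>k = 0..<n. A $$ (i, k) * B $$ (k, j))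
      = (\<Sum>k = 0..<n. d (A $$ (i, k)) * B $$ (k, j) + A $$ (i, k) * d (B $$ (k, j)))"
    using A B ij by (subst d_sum) (auto simp: matrices_over_iff d_mult)
  then show "map_mat d (A * B) $$ (i, j) = (map_mat d A * B + A * map_mat d B) $$ (i, j)"
    using A B ij by (auto simp: matrices_over_iff scalar_prod_def sum.distrib)
qed (use A B in auto)

text \<open>
  Differentiating \<open>Z Y = 1\<close> gives \<open>Z' = Z Q\<close>, so the two outer factors of \<open>Z A Y\<close> contribute exactly
  the terms \<open>Q A\<close> and \<open>- A Q\<close> of the twisted derivation.
\<close>
lemma gauge_iso:
  assumes Q: "Q \<in> matrices_over E n" and Y: "Y \<in> matrices_over E n" and Z: "Z \<in> matrices_over E n"
    and YZ: "Y * Z = 1\<^sub>m n" and ZY: "Z * Y = 1\<^sub>m n" and dY: "map_mat d Y = - (Q * Y)"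
  shows "differential_algebra_iso E n (twisted_derivation d Q) (map_mat d) (\<lambda>A. Z * A * Y)"
proof -
  let ?M = "matrices_over E n"
  note c = Q[THEN matrices_overD] Y[THEN matrices_overD] Z[THEN matrices_overD]
  have dZ: "map_mat d Z = Z * Q"
  proof -
    note cdZ = matrices_overD[OF matrices_over_d[OF Z]]
    have "0\<^sub>m n n = map_mat d (Z * Y)" by (rule eq_matI) (auto simp: ZY)
    also have "\<dots> = map_mat d Z * Y - Z * (Q * Y)"
      using c cdZ by (simp add: map_mat_d_mult[OF Z Y] dY)
        (simp add: minus_add_uminus_mat[of _ n n])
    finally have e: "map_mat d Z * Y - Z * (Q * Y) = 0\<^sub>m n n" by simp
    have "map_mat d Z * Y = Z * (Q * Y)"
    proof (rule eq_matI)
      fix i j assume "i < dim_row (Z * (Q * Y))" "j < dim_col (Z * (Q * Y))"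
      moreover have "(map_mat d Z * Y - Z * (Q * Y)) $$ (i, j) = 0\<^sub>m n n $$ (i, j)" by (simp add: e)
      ultimately show "(map_mat d Z * Y) $$ (i, j) = (Z * (Q * Y)) $$ (i, j)"
        using c by simp
    qed (use c in auto)
    then have "map_mat d Z * Y * Z = Z * (Q * Y) * Z" by simp
    moreover have "map_mat d Z * Y * Z = map_mat d Z"
      using c cdZ YZ by (simp add: assoc_mult_mat[of _ n n _ n _ n])
    moreover have "Z * (Q * Y) * Z = Z * Q"
      using c YZ by (simp add: assoc_mult_mat[of _ n n _ n _ n])
    ultimately show ?thesis by simp
  qed
  have M: "Z * A * Y \<in> ?M" "Y * A * Z \<in> ?M" if "A \<in> ?M" for A
    using that Y Z by (auto intro: matrices_over_mult)
  have cancel: "Y * (Z * A * Y) * Z = A" "Z * (Y * A * Z) * Y = A" if "A \<in> ?M" for A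
  proof -
    note cA = matrices_overD[OF that]
    have "Y * (Z * A * Y) * Z = (Y * Z) * A * (Y * Z)"
      using c cA by (simp add: assoc_mult_mat[of _ n n _ n _ n])
    then show "Y * (Z * A * Y) * Z = A" using cA by (simp add: YZ)
    have "Z * (Y * A * Z) * Y = (Z * Y) * A * (Z * Y)"
      using c cA by (simp add: assoc_mult_mat[of _ n n _ n _ n])
    then show "Z * (Y * A * Z) * Y = A" using cA by (simp add: ZY)
  qed
  have bij: "bij_betw (\<lambda>A. Z * A * Y) ?M ?M"
    by (rule bij_betw_byWitness[where f' = "\<lambda>A. Y * A * Z"]) (use M cancel in auto)
  have "Z * (A + B) * Y = Z * A * Y + Z * B * Y" if "A \<in> ?M" "B \<in> ?M" for A B
    using c that[THEN matrices_overD]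
    by (simp add: mult_add_distrib_mat[of _ n n _ n] add_mult_distrib_mat[of _ n n _ _ n])
  moreover have "Z * (A * B) * Y = (Z * A * Y) * (Z * B * Y)" if "A \<in> ?M" "B \<in> ?M" for A B
  proof -
    note cAB = that[THEN matrices_overD]
    have "(Z * A * Y) * (Z * B * Y) = Z * A * (Y * Z) * (B * Y)"
      using c cAB by (simp add: assoc_mult_mat[of _ n n _ n _ n])
    also have "\<dots> = Z * (A * B) * Y" using c cAB by (simp add: YZ assoc_mult_mat[of _ n n _ n _ n])
    finally show ?thesis by simp
  qed
  moreover have "Z * (a \<cdot>\<^sub>m A) * Y = a \<cdot>\<^sub>m (Z * A * Y)" if "A \<in> ?M" for a A
    using c that[THEN matrices_overD]
    by (simp add: mult_smult_distrib[of _ n n _ n] mult_smult_assoc_mat[of _ n n _ n])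
  moreover have "Z * twisted_derivation d Q A * Y = map_mat d (Z * A * Y)" if A: "A \<in> ?M" for A
  proof -
    note cA = matrices_overD[OF A] and cdA = matrices_overD[OF matrices_over_d[OF A]]
    have "map_mat d (Z * A * Y) = (Z * Q * A + Z * map_mat d A) * Y + Z * A * (- (Q * Y))"
      by (simp add: map_mat_d_mult[OF matrices_over_mult[OF Z A] Y] map_mat_d_mult[OF Z A] dZ dY)
    also have "\<dots> = Z * Q * A * Y + Z * map_mat d A * Y - Z * A * Q * Y"
      using c cA cdA
      by (simp add: add_mult_distrib_mat[of _ n n _ _ n] assoc_mult_mat[of _ n n _ n _ n]
          minus_add_uminus_mat[of _ n n])
    finally have 1: "map_mat d (Z * A * Y) = Z * Q * A * Y + Z * map_mat d A * Y - Z * A * Q * Y" .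
    have "Z * twisted_derivation d Q A * Y
        = Z * map_mat d A * Y + Z * Q * A * Y - Z * A * Q * Y"
      unfolding twisted_derivation_def using c cA cdA
      by (simp add: mult_minus_distrib_mat[of _ n n _ n] minus_mult_distrib_mat[of _ n n _ _ n]
          mult_add_distrib_mat[of _ n n _ n] add_mult_distrib_mat[of _ n n _ _ n]
          assoc_mult_mat[of _ n n _ n _ n])
    also have "Z * map_mat d A * Y + Z * Q * A * Y = Z * Q * A * Y + Z * map_mat d A * Y"
      using c cA cdA by (intro comm_add_mat[of _ n n]) auto
    finally show ?thesis by (simp add: 1)
  qed
  ultimately show ?thesis
    unfolding differential_algebra_iso_def using bij c ZY by auto
qed

end

text \<open>
  The hypothesis on \<open>B\<close> says that it transforms \<open>P\<close> into the diagonal system with entries \<open>a i\<close>.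
  The latter is solved by the radicals \<open>x\<close> with \<open>x\<^sup>N = 1 / y\<close>, where \<open>y' = N (a i) y\<close>.
\<close>
lemma splitting_gauge_criterion:
  fixes \<delta> :: "'k::field_char_0 \<Rightarrow> 'k" and P B C :: "'k mat" and a :: "nat \<Rightarrow> 'k"
  assumes \<delta>: "derivation_on UNIV \<delta>"
    and P: "P \<in> carrier_mat n n" and B: "B \<in> carrier_mat n n" and C: "C \<in> carrier_mat n n"
    and BC: "B * C = 1\<^sub>m n" and CB: "C * B = 1\<^sub>m n"
    and a: "\<And>i. i < n \<Longrightarrow> a i \<in> log_derivative_set \<delta>"
    and dB: "map_mat \<delta> B + P * B = B * mat_diag n a"
  shows "admits_finite_splitting_field \<delta> n P"
proof -
  let ?\<iota> = "to_ac :: 'k \<Rightarrow> 'k alg_closure"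
  have hom: "field_hom ?\<iota>" by unfold_locales auto
  interpret h: field_hom ?\<iota> by (rule hom)
  define E0 where "E0 = range ?\<iota>"
  define d0 where "d0 y = ?\<iota> (\<delta> (of_ac y))" for y
  have d0: "d0 (?\<iota> k) = ?\<iota> (\<delta> k)" for k by (simp add: d0_def)
  have fin: "finite_extension ?\<iota> E0"
  proof -
    interpret V: vector_space "\<lambda>k x. ?\<iota> k * x" by (rule vector_space_over_hom[OF hom])
    have "V.span {1} = E0" by (simp add: V.span_singleton E0_def)
    then show ?thesis unfolding finite_extension_def by blast
  qed
  have "subfield_set E0"
  proof (rule finite_subring_is_subfield[OF hom fin])
    show "1 \<in> E0" unfolding E0_def by (rule range_eqI[of _ _ 1]) simp
    fix y z assume "y \<in> E0" "z \<in> E0"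
    then obtain k l where "y = ?\<iota> k" "z = ?\<iota> l" by (auto simp: E0_def)
    then have "y * z = ?\<iota> (k * l)" by simp
    then show "y * z \<in> E0" unfolding E0_def by (rule range_eqI)
  qed
  moreover have "derivation_on E0 d0"
    using \<delta> unfolding derivation_on_def E0_def
    by (auto simp: d0 simp flip: to_ac_add to_ac_mult)
  ultimately have "differential_extension \<delta> ?\<iota> E0 d0"
    unfolding differential_extension_def subfield_iff_subfield_set
    using hom d0 by (simp add: E0_def)
  then interpret E0: finite_differential_extension \<delta> ?\<iota> E0 d0
    using fin by (rule finite_differential_extension.intro)
  have "\<exists>N y. N > 0 \<and> y \<noteq> 0 \<and> \<delta> y = of_nat N * a i * y" if "i < n" for i
    using a[OF that] by (auto simp: log_derivative_set_def)
  then obtain N y where y: "\<And>i. i < n \<Longrightarrow> N i > 0 \<and> y i \<noteq> 0 \<and> \<delta> (y i) = of_nat (N i) * a i * y i"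
    by metis
  have "\<exists>x. x ^ N i = ?\<iota> (inverse (y i))" if "i < n" for i
    using nth_root_exists[of "N i"] y[OF that] by auto
  then obtain x where x: "\<And>i. i < n \<Longrightarrow> x i ^ N i = ?\<iota> (inverse (y i))" by metis
  have x0: "x i \<noteq> 0" if "i < n" for i
    using x[OF that] y[OF that] by (auto simp: zero_power)
  have roots: "\<exists>f\<in>poly_over E0. poly f z = 0 \<and> poly (pderiv f) z \<noteq> 0" if z: "z \<in> x ` {..<n}" for z
  proof -
    obtain i where i: "i < n" "z = x i" using z by auto
    let ?f = "monom 1 (N i) + [:- ?\<iota> (inverse (y i)):]"
    have "?f \<in> poly_over E0"
      by (intro poly_over_ops(3,6,7)[OF E0.subfield] E0.closed E0.hom_closed)
    moreover have "poly ?f z = 0" using i x by (simp add: poly_monom)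
    moreover have "poly (pderiv ?f) z \<noteq> 0"
      using i x0 y[OF i(1)] by (simp add: pderiv_add pderiv_monom poly_monom pderiv_pCons)
    ultimately show ?thesis by blast
  qed
  have "\<exists>E d. finite_differential_extension \<delta> ?\<iota> E d \<and> x ` {..<n} \<subseteq> E"
    using E0.adjoin_roots[of "x ` {..<n}", OF _ roots] by blast
  then obtain E d where
    E: "finite_differential_extension \<delta> ?\<iota> E d" and xE: "x ` {..<n} \<subseteq> E" by blast
  interpret E: finite_differential_extension \<delta> ?\<iota> E d by (rule E)
  have xE: "x i \<in> E" if "i < n" for i using xE that by auto
  have dx: "d (x i) = - ?\<iota> (a i) * x i" if "i < n" for i
  proof -
    note N = y[OF that]
    have "?\<iota> (y i) * x i ^ N i = 1" using x[OF that] N by simp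
    then have "d (?\<iota> (y i) * x i ^ N i) = 0" by simp
    then have "?\<iota> (of_nat (N i) * a i * y i) * x i ^ N i
        + ?\<iota> (y i) * (of_nat (N i) * x i ^ (N i - 1) * d (x i)) = 0"
      using xE[OF that] N by (simp add: E.d_mult E.d_power E.d_hom)
    moreover have "x i ^ N i = x i ^ (N i - 1) * x i" using N power_minus_mult[of "N i" "x i"] by simp
    ultimately have "?\<iota> (y i) * of_nat (N i) * x i ^ (N i - 1) * (d (x i) + ?\<iota> (a i) * x i) = 0"
      unfolding to_ac_mult to_ac_of_nat by (simp only: algebra_simps)
    then have "d (x i) + ?\<iota> (a i) * x i = 0" using N x0[OF that] by simp
    then show ?thesis by (simp add: eq_neg_iff_add_eq_0)
  qed
  let ?h = "map_mat ?\<iota>"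
  define S where "S = mat_diag n x"
  define W where "W = mat_diag n (\<lambda>i. inverse (x i))"
  have S: "S \<in> matrices_over E n" "W \<in> matrices_over E n"
    using xE by (auto simp: S_def W_def matrices_over_iff mat_diag_def)
  have H: "?h A \<in> matrices_over E n" if "A \<in> carrier_mat n n" for A
    using that by (auto simp: matrices_over_iff)
  have SW: "S * W = 1\<^sub>m n" "W * S = 1\<^sub>m n"
    using x0 by (auto simp: S_def W_def) (auto simp: mat_diag_def)
  have HB: "?h B * ?h C = 1\<^sub>m n" "?h C * ?h B = 1\<^sub>m n"
    using h.mat_hom_mult[OF B C] h.mat_hom_mult[OF C B] by (simp_all add: BC CB h.mat_hom_one)
  note cS = S[THEN matrices_overD] and cH = H[OF P, THEN matrices_overD]
    H[OF B, THEN matrices_overD] H[OF C, THEN matrices_overD]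
  define G where "G = ?h (mat_diag n a)"
  have G: "G \<in> carrier_mat n n" by (simp add: G_def)
  have dS: "map_mat d S = - (G * S)"
  proof -
    have "G = mat_diag n (\<lambda>i. ?\<iota> (a i))" by (auto simp: G_def mat_diag_def)
    then have "G * S = mat_diag n (\<lambda>i. ?\<iota> (a i) * x i)" by (simp add: S_def)
    then show ?thesis using dx by (auto simp: S_def mat_diag_def)
  qed
  have dHB: "map_mat d (?h B) + ?h P * ?h B = ?h B * G"
  proof -
    have "map_mat d (?h B) = ?h (map_mat \<delta> B)" by (auto simp: E.d_hom)
    then have "map_mat d (?h B) + ?h P * ?h B = ?h (map_mat \<delta> B + P * B)"
      using P B by (simp add: h.mat_hom_mult[OF P B, symmetric]) (auto simp: h.hom_add)
    then show ?thesis by (simp add: dB G_def h.mat_hom_mult[OF B mat_diag_dim])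
  qed
  have "differential_algebra_iso E n (twisted_derivation d (?h P)) (map_mat d)
      (\<lambda>A. (W * ?h C) * A * (?h B * S))"
  proof (rule E.gauge_iso)
    show "?h P \<in> matrices_over E n" "?h B * S \<in> matrices_over E n" "W * ?h C \<in> matrices_over E n"
      by (intro E.matrices_over_mult S H P B C)+
    have "?h B * S * (W * ?h C) = ?h B * (S * W) * ?h C"
      using cS cH by (simp add: assoc_mult_mat[of _ n n _ n _ n])
    then show "?h B * S * (W * ?h C) = 1\<^sub>m n" using cH by (simp add: SW HB)
    have "W * ?h C * (?h B * S) = W * (?h C * ?h B) * S"
      using cS cH by (simp add: assoc_mult_mat[of _ n n _ n _ n])
    then show "W * ?h C * (?h B * S) = 1\<^sub>m n" using cS by (simp add: SW HB)
    have c2: "map_mat d (?h B) \<in> carrier_mat n n" using cH by simp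
    have "map_mat d (?h B * S) = map_mat d (?h B) * S + ?h B * (- (G * S))"
      by (simp add: E.map_mat_d_mult[OF H[OF B] S(1)] dS)
    also have "\<dots> = map_mat d (?h B) * S - (?h B * G) * S"
      using cS cH G c2 by (simp add: assoc_mult_mat[of _ n n _ n _ n] minus_add_uminus_mat[of _ n n])
    also have "\<dots> = - (?h P * (?h B * S))"
      unfolding dHB[symmetric] using cS cH c2
      by (auto simp: add_mult_distrib_mat[of _ n n _ _ n] assoc_mult_mat[of _ n n _ n _ n])
    finally show "map_mat d (?h B * S) = - (?h P * (?h B * S))" .
  qed
  then show ?thesis
    unfolding admits_finite_splitting_field_def splitting_field_def
    using E.extension E.finite by blast
qed

section \<open>Diagonal, constant and triangular systems for the Euler derivation\<close>

abbreviation euler_poly :: "'a::field poly \<Rightarrow> 'a poly" where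
  "euler_poly p \<equiv> pCons 0 (pderiv p)"

lemma const_fract_hom: "field_hom (const_fract :: 'a::field \<Rightarrow> 'a poly fract)"
  by unfold_locales (auto simp: const_fract_def simp flip: to_fract_add to_fract_mult one_pCons)

lemma const_fract_simps [simp]:
  "const_fract (a + b) = const_fract a + const_fract b"
  "const_fract (a * b) = const_fract a * const_fract b"
  "const_fract (a - b) = const_fract a - const_fract b"
  "const_fract 0 = 0" "const_fract 1 = 1"
  by (simp_all add: const_fract_def flip: to_fract_add to_fract_mult to_fract_diff one_pCons)

locale euler_derivation_field =
  fixes \<delta> :: "'a::field_char_0 poly fract \<Rightarrow> 'a poly fract"
  assumes euler: "euler_derivation \<delta>"
begin

sublocale K: differential_subfield UNIV \<delta>
  using euler by unfold_locales (auto simp: euler_derivation_def subfield_set_def)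

lemma \<delta>_const [simp]: "\<delta> (const_fract c) = 0"
  using euler by (simp add: euler_derivation_def)

lemma \<delta>_to_fract: "\<delta> (to_fract p) = to_fract (euler_poly p)"
proof (induction p)
  case 0 show ?case by simp
next
  case (pCons a p)
  have "\<delta> (to_fract [:0, 1:]) = to_fract [:0, 1:]" using euler by (simp add: euler_derivation_def)
  moreover have "to_fract (pCons a p) = const_fract a + to_fract [:0, 1:] * to_fract p"
    by (simp add: const_fract_def flip: to_fract_add to_fract_mult)
  ultimately have "\<delta> (to_fract (pCons a p)) = to_fract ([:0, 1:] * p + [:0, 1:] * euler_poly p)"
    by (simp only: K.d_add K.d_mult pCons.IH to_fract_add to_fract_mult \<delta>_const UNIV_I add_0_left)
  then show ?case by (simp add: pderiv_pCons)
qed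

text \<open>
  For \<open>q = a / N\<close> the witness is \<open>t\<^sup>a\<close>, whose logarithmic derivative is \<open>a\<close>.
\<close>
lemma rational_in_log_derivative_set: "const_fract (of_rat q) \<in> log_derivative_set \<delta>"
proof -
  obtain a b where ab: "q = Rat.Fract a b" "b > 0" by (cases q) auto
  define N where "N = nat b"
  have N: "N > 0" "of_int b = (of_nat N :: 'a)" using ab by (simp_all add: N_def)
  have "of_nat N * of_rat q = (of_int a :: 'a)" using N ab by (simp add: of_rat_rat)
  then have "const_fract (of_nat N * of_rat q) = (const_fract (of_int a) :: 'a poly fract)" by simp
  interpret c: field_hom "const_fract :: 'a \<Rightarrow> 'a poly fract" by (rule const_fract_hom)
  have eq: "of_nat N * const_fract (of_rat q) = (of_int a :: 'a poly fract)"
    using \<open>const_fract (of_nat N * of_rat q) = _\<close> by (simp add: c.hom_of_nat c.hom_of_int)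
  define y :: "nat \<Rightarrow> 'a poly fract" where "y k = to_fract (monom 1 k)" for k
  have y0: "y k \<noteq> 0" for k by (simp add: y_def)
  have dy: "\<delta> (y k) = of_nat k * y k" for k
  proof -
    have "euler_poly (monom 1 k) = [:of_nat k:] * monom (1::'a) k"
      by (cases k) (simp_all add: pderiv_monom smult_monom flip: monom_Suc)
    then have "\<delta> (y k) = const_fract (of_nat k) * y k"
      unfolding y_def \<delta>_to_fract const_fract_def by (simp only: to_fract_mult)
    then show ?thesis by (simp add: c.hom_of_nat)
  qed
  have "\<exists>z. z \<noteq> 0 \<and> \<delta> z = of_int a * z"
  proof (cases "a \<ge> 0")
    case True
    then show ?thesis using y0[of "nat a"] dy[of "nat a"] by (intro exI[of _ "y (nat a)"]) simp
  next
    case False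
    let ?k = "nat (- a)"
    have "\<delta> (y ?k * inverse (y ?k)) = 0" using y0 by simp
    then have "y ?k * (of_nat ?k * inverse (y ?k) + \<delta> (inverse (y ?k))) = 0"
      by (simp add: K.d_mult dy algebra_simps)
    then have "\<delta> (inverse (y ?k)) = - of_nat ?k * inverse (y ?k)"
      using y0[of ?k] by (simp add: eq_neg_iff_add_eq_0 add.commute)
    then show ?thesis using False y0[of ?k] by (intro exI[of _ "inverse (y ?k)"]) simp
  qed
  then show ?thesis unfolding log_derivative_set_def using N(1) eq by (metis (mono_tags, lifting) mem_Collect_eq)
qed

end

text \<open>
  The operator multiplies the monomial of degree \<open>m\<close> by \<open>m + c\<close> and so can be inverted on each
  coefficient.
\<close>
lemma euler_poly_shift_surj:
  fixes q :: "'a::field poly"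
  assumes "\<And>m. of_nat m + c \<noteq> 0"
  shows "\<exists>p. euler_poly p + smult c p = q"
proof
  define p where "p = (\<Sum>m\<le>degree q. monom (coeff q m / (of_nat m + c)) m)"
  have p: "coeff p m = coeff q m / (of_nat m + c)" for m
    unfolding p_def coeff_sum by (auto simp: coeff_monom coeff_eq_0)
  show "euler_poly p + smult c p = q"
  proof (rule poly_eqI)
    fix m
    have "coeff (euler_poly p) m = of_nat m * coeff p m"
      by (cases m) (simp_all add: coeff_pderiv)
    then have "coeff (euler_poly p + smult c p) m = (of_nat m + c) * coeff p m"
      by (simp add: algebra_simps)
    then show "coeff (euler_poly p + smult c p) m = coeff q m"
      using assms[of m] by (simp add: p)
  qed
qed

text \<open>
  These are the entries of column \<open>j\<close> of the unipotent gauge matrix. They are found from the diagonal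
  upwards, since the equation in row \<open>i\<close> contains besides \<open>f i\<close> only entries below row \<open>i\<close>.
\<close>
lemma triangular_euler_system_column:
  fixes p :: "nat \<Rightarrow> nat \<Rightarrow> 'a::field poly" and r :: "nat \<Rightarrow> 'a"
  assumes j: "j < n" and r: "\<And>i m. i < j \<Longrightarrow> of_nat m + (r i - r j) \<noteq> 0"
  shows "\<exists>f. f j = 1 \<and> (\<forall>i. j < i \<longrightarrow> f i = 0) \<and>
    (\<forall>i<n. euler_poly (f i) + smult (r i - r j) (f i) + (\<Sum>l\<in>{i<..<n}. p i l * f l) = 0)"
proof -
  let ?eq = "\<lambda>f i. euler_poly (f i) + smult (r i - r j) (f i) + (\<Sum>l\<in>{i<..<n}. p i l * f l) = 0"
  \<comment> \<open>Induction on the number \<open>k\<close> of rows above the diagonal that are already solved.\<close>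
  have "\<exists>f. f j = 1 \<and> (\<forall>i. j < i \<longrightarrow> f i = 0) \<and> (\<forall>i<n. j - k \<le> i \<longrightarrow> ?eq f i)" if "k \<le> j" for k
    using that
  proof (induction k)
    case 0
    let ?f = "\<lambda>i. if i = j then 1 else 0 :: 'a poly"
    have "(\<Sum>l\<in>{i<..<n}. p i l * ?f l) = 0" if "j \<le> i" for i
      using that by (intro sum.neutral) auto
    then show ?case by (intro exI[of _ ?f]) (auto simp: pderiv_1)
  next
    case (Suc k)
    then obtain f where f: "f j = 1" "\<forall>i. j < i \<longrightarrow> f i = 0" "\<And>i. i < n \<Longrightarrow> j - k \<le> i \<Longrightarrow> ?eq f i"
      by auto
    define s where "s = j - Suc k"
    have s: "s < j" "j - k = Suc s" using Suc.prems by (auto simp: s_def)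
    obtain g where g: "euler_poly g + smult (r s - r j) g = - (\<Sum>l\<in>{s<..<n}. p s l * f l)"
      using euler_poly_shift_surj[of "r s - r j"] r[OF s(1)] by metis
    let ?f = "f(s := g)"
    have "?eq ?f i" if "i < n" "s \<le> i" for i
    proof -
      have "(\<Sum>l\<in>{i<..<n}. p i l * ?f l) = (\<Sum>l\<in>{i<..<n}. p i l * f l)"
        using that by (intro sum.cong) auto
      then show ?thesis using that f(3)[of i] g s by (cases "i = s") auto
    qed
    then show ?case using f s by (intro exI[of _ ?f]) (auto simp: s_def)
  qed
  from this[of j] show ?thesis by simp
qed

lemma unit_upper_triangular_invertible:
  fixes B :: "'k::field mat"
  assumes B: "B \<in> carrier_mat n n" and ut: "upper_triangular B" and diag: "\<And>i. i < n \<Longrightarrow> B $$ (i, i) = 1"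
  shows "\<exists>C\<in>carrier_mat n n. B * C = 1\<^sub>m n \<and> C * B = 1\<^sub>m n"
proof -
  have "diag_mat B = replicate n 1"
    using B diag by (intro nth_equalityI) (auto simp: diag_mat_def)
  then have "det B = 1" using det_upper_triangular[OF ut B] by simp
  then have "B \<in> Units (ring_mat TYPE('k) n ())" by (intro det_non_zero_imp_unit[OF B]) simp
  then show ?thesis by (auto simp: Units_def ring_mat_def)
qed

context euler_derivation_field
begin

lemma diagonal_splits:
  assumes "P = mat_diag n a" "\<And>i. i < n \<Longrightarrow> a i \<in> log_derivative_set \<delta>"
  shows "admits_finite_splitting_field \<delta> n P"
proof (rule splitting_gauge_criterion)
  show "derivation_on UNIV \<delta>" by (rule K.derivation)
  show "1\<^sub>m n \<in> carrier_mat n n" "1\<^sub>m n \<in> carrier_mat n n" "1\<^sub>m n * 1\<^sub>m n = (1\<^sub>m n :: 'a poly fract mat)"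
      "1\<^sub>m n * 1\<^sub>m n = (1\<^sub>m n :: 'a poly fract mat)"
    by (simp_all add: left_mult_one_mat[of _ n n])
  show "map_mat \<delta> (1\<^sub>m n) + P * 1\<^sub>m n = 1\<^sub>m n * mat_diag n a"
    unfolding assms(1) by (auto simp: mat_diag_def)
qed (use assms in auto)

text \<open>
  The gauge matrix consists of eigenvectors; it is constant, so the system becomes diagonal by mere
  conjugation.
\<close>
lemma constant_diagonalizable_splits:
  assumes P0: "P0 \<in> carrier_mat n n" and diag: "diagonalizable_mat P0"
    and rat: "\<And>c. eigenvalue P0 c \<Longrightarrow> c \<in> \<rat>"
  shows "admits_finite_splitting_field \<delta> n (map_mat const_fract P0)"
proof -
  let ?h = "map_mat (const_fract :: 'a \<Rightarrow> _)"
  interpret c: field_hom "const_fract :: 'a \<Rightarrow> 'a poly fract" by (rule const_fract_hom)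
  obtain D S T where D: "diagonal_mat D" and wit: "similar_mat_wit P0 D S T"
    using diag by (auto simp: diagonalizable_mat_def similar_mat_def)
  note w = similar_mat_witD2[OF P0 wit]
  define a where "a i = D $$ (i, i)" for i
  have Da: "D = mat_diag n a"
    using D w(5) by (auto simp: diagonal_mat_def mat_diag_def a_def)
  have "a i \<in> \<rat>" if i: "i < n" for i
  proof -
    have "upper_triangular D" using D w(5) by (auto simp: diagonal_mat_def)
    then have "char_poly D = (\<Prod>b\<leftarrow>diag_mat D. [:- b, 1:])"
      using w(5) by (intro char_poly_upper_triangular)
    moreover have "a i \<in> set (diag_mat D)" using i w(5) by (auto simp: diag_mat_def a_def)
    ultimately have "poly (char_poly D) (a i) = 0"
      by (auto simp: poly_prod_list prod_list_zero_iff)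
    moreover have "char_poly P0 = char_poly D"
      by (rule char_poly_similar) (use wit in \<open>auto simp: similar_mat_def\<close>)
    ultimately show ?thesis using rat eigenvalue_root_char_poly[OF P0] by simp
  qed
  then have "\<exists>q. a i = of_rat q" if "i < n" for i using that by (auto elim!: Rats_cases)
  then have a: "const_fract (a i) \<in> log_derivative_set \<delta>" if "i < n" for i
    using rational_in_log_derivative_set that by metis
  show ?thesis
  proof (rule splitting_gauge_criterion[where B = "?h S" and C = "?h T" and a = "\<lambda>i. const_fract (a i)"])
    show "?h S * ?h T = 1\<^sub>m n" "?h T * ?h S = 1\<^sub>m n"
      using c.mat_hom_mult[OF w(6,7)] c.mat_hom_mult[OF w(7,6)] w(1,2) by (simp_all add: c.mat_hom_one)
    have "P0 * S = S * D"
      using w P0 by (simp add: assoc_mult_mat[of _ n n _ n _ n])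
    then have "?h P0 * ?h S = ?h S * ?h D"
      using c.mat_hom_mult[OF P0 w(6)] c.mat_hom_mult[OF w(6,5)] by simp
    moreover have "?h D = mat_diag n (\<lambda>i. const_fract (a i))" by (auto simp: Da mat_diag_def)
    moreover have "map_mat \<delta> (?h S) = 0\<^sub>m n n" using w(6) by auto
    ultimately show "map_mat \<delta> (?h S) + ?h P0 * ?h S = ?h S * mat_diag n (\<lambda>i. const_fract (a i))"
      using w(6) P0 by simp
  qed (use w P0 a K.derivation in auto)
qed

text \<open>
  The columns solved above form a unipotent matrix \<open>B\<close> that transforms \<open>P\<close> into its diagonal part.
\<close>
lemma triangular_splits:
  assumes P: "P \<in> carrier_mat n n" and ut: "upper_triangular P" and pol: "elements_mat P \<subseteq> range to_fract"
    and r: "\<And>i. i < n \<Longrightarrow> P $$ (i, i) = const_fract (of_rat (r i))"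
    and distinct: "\<And>i j. i < n \<Longrightarrow> j < n \<Longrightarrow> i \<noteq> j \<Longrightarrow> r i - r j \<notin> \<int>"
  shows "admits_finite_splitting_field \<delta> n P"
proof -
  let ?r = "\<lambda>i. of_rat (r i) :: 'a"
  define p where "p i j = (SOME p. P $$ (i, j) = to_fract p)" for i j
  have p: "P $$ (i, j) = to_fract (p i j)" if "i < n" "j < n" for i j
  proof -
    have "P $$ (i, j) \<in> elements_mat P" using P that by (intro elements_matI) auto
    then have "\<exists>p. P $$ (i, j) = to_fract p" using pol by auto
    then show ?thesis unfolding p_def by (rule someI_ex)
  qed
  have nonres: "of_nat m + (?r i - ?r j) \<noteq> 0" if "i < j" "j < n" for i j m
  proof
    assume "of_nat m + (?r i - ?r j) = 0"
    then have "of_rat (of_nat m + (r i - r j)) = (of_rat 0 :: 'a)"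
      by (simp add: of_rat_add of_rat_diff)
    then have "r i - r j = - of_nat m" by (simp only: of_rat_eq_iff eq_neg_iff_add_eq_0 add.commute)
    then have "r i - r j \<in> \<int>" by simp
    then show False using distinct[of i j] that by simp
  qed
  let ?column = "\<lambda>j f. f j = 1 \<and> (\<forall>i. j < i \<longrightarrow> f i = 0) \<and>
    (\<forall>i<n. euler_poly (f i) + smult (?r i - ?r j) (f i) + (\<Sum>l\<in>{i<..<n}. p i l * f l) = 0)"
  define f where "f j = (SOME f. ?column j f)" for j
  have "?column j (f j)" if "j < n" for j
  proof -
    have "\<exists>f. ?column j f"
      by (rule triangular_euler_system_column[OF that]) (rule nonres[OF _ that])
    then show ?thesis unfolding f_def by (rule someI_ex)
  qed
  then have f: "\<And>j. j < n \<Longrightarrow> f j j = 1" "\<And>i j. j < i \<Longrightarrow> j < n \<Longrightarrow> f j i = 0"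
    "\<And>i j. i < n \<Longrightarrow> j < n \<Longrightarrow>
      euler_poly (f j i) + smult (?r i - ?r j) (f j i) + (\<Sum>l\<in>{i<..<n}. p i l * f j l) = 0"
    by simp_all
  define B where "B = Matrix.mat n n (\<lambda>(i, j). to_fract (f j i))"
  have B: "B \<in> carrier_mat n n" by (simp add: B_def)
  have "upper_triangular B" using f(2) by (auto simp: B_def)
  then obtain C where C: "C \<in> carrier_mat n n" "B * C = 1\<^sub>m n" "C * B = 1\<^sub>m n"
    using unit_upper_triangular_invertible[OF B] f(1) by (auto simp: B_def)
  let ?a = "\<lambda>i. const_fract (?r i)"
  have "map_mat \<delta> B + P * B = B * mat_diag n ?a"
  proof (rule eq_matI)
    fix i j assume "i < dim_row (B * mat_diag n ?a)" "j < dim_col (B * mat_diag n ?a)"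
    then have ij: "i < n" "j < n" by (simp_all add: B_def mat_diag_def)
    have "(P * B) $$ (i, j) = (\<Sum>l = 0..<n. P $$ (i, l) * to_fract (f j l))"
      using P ij by (simp add: B_def scalar_prod_def)
    also have "\<dots> = (\<Sum>l\<in>insert i {i<..<n}. P $$ (i, l) * to_fract (f j l))"
      using ij ut P by (intro sum.mono_neutral_right) (auto dest: upper_triangularD)
    also have "\<dots> = ?a i * to_fract (f j i) + to_fract (\<Sum>l\<in>{i<..<n}. p i l * f j l)"
      using ij by (simp add: r p)
    finally have "(map_mat \<delta> B + P * B) $$ (i, j)
      = to_fract (euler_poly (f j i)) + ?a i * to_fract (f j i) + to_fract (\<Sum>l\<in>{i<..<n}. p i l * f j l)"
      using P ij B by (simp add: \<delta>_to_fract) (simp add: B_def \<delta>_to_fract)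
    also have "\<dots> = to_fract (euler_poly (f j i) + smult (?r i - ?r j) (f j i) + (\<Sum>l\<in>{i<..<n}. p i l * f j l))
        + ?a j * to_fract (f j i)"
    proof -
      have s: "smult c q = [:c:] * q" for c :: 'a and q by simp
      have "to_fract (smult (?r i - ?r j) (f j i)) = (?a i - ?a j) * to_fract (f j i)"
        unfolding s to_fract_mult by (simp flip: const_fract_def)
      then show ?thesis by (simp add: algebra_simps)
    qed
    also have "\<dots> = (B * mat_diag n ?a) $$ (i, j)"
      using ij f(3)[OF ij] by (simp add: mat_diag_mult_right[OF B]) (simp add: B_def)
    finally show "(map_mat \<delta> B + P * B) $$ (i, j) = (B * mat_diag n ?a) $$ (i, j)" .
  qed (use P B in \<open>auto simp: mat_diag_def\<close>)
  then show ?thesis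
    by (intro splitting_gauge_criterion[OF K.derivation P B C])
      (auto intro: rational_in_log_derivative_set)
qed

end

section \<open>Algebraic exponentials and logarithms\<close>

lemma poly_eq_bounded_sum:
  fixes p :: "'r::comm_semiring_1 poly"
  assumes "degree p \<le> N"
  shows "poly p x = (\<Sum>i\<le>N. coeff p i * x ^ i)"
  unfolding poly_altdef using assms by (intro sum.mono_neutral_left) (auto simp: coeff_eq_0)

context differential_subfield
begin

lemma d_power_exponential:
  assumes "y \<in> E" "d y = c * y"
  shows "d (y ^ i) = of_nat i * c * y ^ i"
proof (cases i)
  case (Suc k)
  have "d (y ^ i) = of_nat i * y ^ (i - 1) * (c * y)" using d_power[OF assms(1), of i] assms(2) by simp
  then show ?thesis by (simp add: Suc ac_simps del: of_nat_Suc)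
qed simp

text \<open>
  Applying \<open>d\<close> and subtracting \<open>\<mu> a\<close> times the relation removes \<open>v a\<close> from it and multiplies the other
  vectors by the nonzero constants \<open>\<mu> k - \<mu> a\<close>.
\<close>
lemma eigenvectors_independent:
  assumes "finite I" "inj_on \<mu> I"
    and "\<And>k. k \<in> I \<Longrightarrow> \<mu> k \<in> E \<and> d (\<mu> k) = 0"
    and "\<And>k. k \<in> I \<Longrightarrow> v k \<in> E \<and> d (v k) = \<mu> k * v k"
    and "sum v I = 0"
  shows "\<forall>k\<in>I. v k = 0"
  using assms
proof (induction I arbitrary: v rule: finite_induct)
  case (insert a I)
  have v: "v k \<in> E" "d (v k) = \<mu> k * v k" and \<mu>: "\<mu> k \<in> E" "d (\<mu> k) = 0" if "k \<in> insert a I" for k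
    using insert.prems that by blast+
  have sum0: "v a + sum v I = 0" using insert by simp
  have "d (v a + sum v I) = 0" by (simp add: sum0)
  moreover have "d (v a + sum v I) = \<mu> a * v a + (\<Sum>k\<in>I. \<mu> k * v k)"
    using v by (simp add: d_add d_sum closed_sum)
  ultimately have "(\<mu> a * v a + (\<Sum>k\<in>I. \<mu> k * v k)) - \<mu> a * (v a + sum v I) = 0"
    using sum0 by simp
  then have "(\<Sum>k\<in>I. (\<mu> k - \<mu> a) * v k) = 0"
    by (simp add: algebra_simps sum_subtractf sum_distrib_left)
  moreover have "(\<mu> k - \<mu> a) * v k \<in> E \<and> d ((\<mu> k - \<mu> a) * v k) = \<mu> k * ((\<mu> k - \<mu> a) * v k)"
    if "k \<in> I" for k
    using v[of k] \<mu>[of k] \<mu>[of a] that by (simp add: d_mult d_diff algebra_simps)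
  ultimately have "\<forall>k\<in>I. (\<mu> k - \<mu> a) * v k = 0"
    using insert.prems(1,2) by (intro insert.IH) auto
  moreover have "\<mu> k \<noteq> \<mu> a" if "k \<in> I" for k
    using insert.prems(1) insert.hyps(2) that by (auto simp: inj_on_def)
  ultimately have "\<forall>k\<in>I. v k = 0" by simp
  then show ?case using sum0 by simp
qed simp

end

lemma common_denominator:
  fixes a :: "'i \<Rightarrow> 'r::idom fract"
  assumes "finite I"
  shows "\<exists>w\<noteq>0. \<forall>i\<in>I. a i * to_fract w \<in> range to_fract"
  using assms
proof (induction I rule: finite_induct)
  case empty show ?case by (intro exI[of _ 1]) simp
next
  case (insert i I)
  then obtain w where w: "w \<noteq> 0" "\<forall>k\<in>I. a k * to_fract w \<in> range to_fract" by blast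
  obtain u v where uv: "v \<noteq> 0" "a i = to_fract u / to_fract v" by (rule fract_as_quotient)
  have "a k * to_fract (w * v) \<in> range to_fract" if "k \<in> insert i I" for k
  proof (cases "k = i")
    case True
    then have "a k * to_fract (w * v) = to_fract (u * w)" using uv by simp
    then show ?thesis by (rule range_eqI)
  next
    case False
    then have "a k * to_fract w \<in> range to_fract" using w(2) that by blast
    then obtain g where "a k * to_fract w = to_fract g" by auto
    then have "a k * to_fract (w * v) = to_fract (g * v)" by (simp add: mult.assoc[symmetric])
    then show ?thesis by (rule range_eqI)
  qed
  then show ?case using w uv by (intro exI[of _ "w * v"]) auto
qed

locale euler_extension =
  finite_differential_extension \<delta> \<iota> E d + euler_derivation_field \<delta>
  for \<delta> :: "'a::field_char_0 poly fract \<Rightarrow> 'a poly fract"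
    and \<iota> :: "'a poly fract \<Rightarrow> 'b::field_char_0" and E d
begin

definition t :: 'b where "t = \<iota> (to_fract [:0, 1:])"
definition \<kappa> :: "'a \<Rightarrow> 'b" where "\<kappa> c = \<iota> (const_fract c)"

lemma \<kappa>_hom: "field_hom \<kappa>"
proof -
  interpret h: field_hom \<iota> by (rule hom)
  show ?thesis by unfold_locales (auto simp: \<kappa>_def h.hom_add h.hom_mult)
qed

sublocale \<kappa>: field_hom \<kappa> by (rule \<kappa>_hom)

lemma \<kappa>_closed [simp, intro]: "\<kappa> c \<in> E" by (simp add: \<kappa>_def)

lemma d_\<kappa> [simp]: "d (\<kappa> c) = 0"
proof -
  interpret h: field_hom \<iota> by (rule hom)
  show ?thesis by (simp add: \<kappa>_def d_hom)
qed

lemma t_closed [simp, intro]: "t \<in> E" by (simp add: t_def)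

lemma t_nz [simp]: "t \<noteq> 0"
proof -
  interpret h: field_hom \<iota> by (rule hom)
  show ?thesis by (simp add: t_def)
qed

lemma d_t [simp]: "d t = t" by (simp add: t_def d_hom \<delta>_to_fract pderiv_pCons)

lemma d_t_power: "d (t ^ j) = of_nat j * t ^ j"
  using d_power_exponential[of t 1 j] by simp

lemma d_poly_\<kappa>:
  assumes "u \<in> E"
  shows "d (poly (map_poly \<kappa> g) u) = poly (map_poly \<kappa> (pderiv g)) u * d u"
proof -
  have "map_poly \<kappa> g \<in> poly_over E" by (simp add: poly_over_def coeff_map_poly)
  moreover have "map_poly d (map_poly \<kappa> g) = 0" by (rule poly_eqI) (simp add: coeff_map_poly)
  moreover have "pderiv (map_poly \<kappa> g) = map_poly \<kappa> (pderiv g)"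
    by (rule poly_eqI) (simp add: coeff_pderiv coeff_map_poly \<kappa>.hom_mult \<kappa>.hom_of_nat del: of_nat_Suc)
  ultimately show ?thesis using d_poly[OF _ assms] by simp
qed

lemma \<iota>_to_fract: "\<iota> (to_fract p) = poly (map_poly \<kappa> p) t"
proof -
  interpret h: field_hom \<iota> by (rule hom)
  show ?thesis
  proof (induction p)
    case (pCons a p)
    have "to_fract (pCons a p) = const_fract a + to_fract [:0, 1:] * to_fract p"
      by (simp add: const_fract_def flip: to_fract_add to_fract_mult)
    moreover have "map_poly \<kappa> (pCons a p) = pCons (\<kappa> a) (map_poly \<kappa> p)"
      by (rule poly_eqI) (simp add: coeff_map_poly coeff_pCons split: nat.split)
    ultimately show ?case using pCons.IH by (simp add: h.hom_add h.hom_mult flip: \<kappa>_def t_def)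
  qed simp
qed

text \<open>
  This is an equation of \<open>y\<close> over \<open>F(t)\<close> after clearing denominators. In this form the derivation acts
  on every term separately.
\<close>
lemma polynomial_relation:
  assumes "y \<in> E"
  shows "\<exists>N c. (\<exists>i\<le>N. \<exists>j\<le>N. c i j \<noteq> 0) \<and> (\<Sum>i\<le>N. \<Sum>j\<le>N. \<kappa> (c i j) * t ^ j * y ^ i) = 0"
proof -
  interpret h: field_hom \<iota> by (rule hom)
  obtain p where p: "p \<in> poly_over (range \<iota>)" "p \<noteq> 0" "poly p y = 0" using algebraic[OF assms] by blast
  define a where "a i = (SOME b. coeff p i = \<iota> b)" for i
  have a: "coeff p i = \<iota> (a i)" for i
  proof -
    have "\<exists>b. coeff p i = \<iota> b" using p(1) by (auto simp: poly_over_def)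
    then show ?thesis unfolding a_def by (rule someI_ex)
  qed
  obtain w where w: "w \<noteq> 0" "\<forall>i\<in>{..degree p}. a i * to_fract w \<in> range to_fract"
    using common_denominator[of "{..degree p}" a] by auto
  \<comment> \<open>Beyond the degree of \<open>p\<close> the coefficients vanish, and so must their numerators.\<close>
  define g where "g i = (if i \<le> degree p then SOME g. a i * to_fract w = to_fract g else 0)" for i
  have g: "a i * to_fract w = to_fract (g i)" for i
  proof (cases "i \<le> degree p")
    case True
    then have "\<exists>g. a i * to_fract w = to_fract g" using w(2) by auto
    then have "a i * to_fract w = to_fract (SOME g. a i * to_fract w = to_fract g)" by (rule someI_ex)
    then show ?thesis using True by (simp add: g_def)
  next
    case False
    then have "\<iota> (a i) = 0" using a[of i] by (simp add: coeff_eq_0)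
    then show ?thesis using False by (simp add: g_def)
  qed
  define N where "N = Max (insert (degree p) ((\<lambda>i. degree (g i)) ` {..degree p}))"
  have N: "degree p \<le> N" "degree (g i) \<le> N" for i
  proof -
    show "degree p \<le> N" by (simp add: N_def)
    show "degree (g i) \<le> N"
    proof (cases "i \<le> degree p")
      case True then show ?thesis unfolding N_def by (intro Max_ge) auto
    qed (simp add: g_def)
  qed
  have \<iota>g: "\<iota> (to_fract (g i)) = (\<Sum>j\<le>N. \<kappa> (coeff (g i) j) * t ^ j)" for i
  proof -
    have "degree (map_poly \<kappa> (g i)) \<le> N"
      using map_poly_degree_leq[of \<kappa> "g i"] N(2)[of i] by (auto intro: order_trans)
    from poly_eq_bounded_sum[OF this, of t] show ?thesis by (simp add: \<iota>_to_fract coeff_map_poly)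
  qed
  have "(\<Sum>i\<le>N. coeff p i * y ^ i) = 0"
    using poly_eq_bounded_sum[OF N(1), of y] p(3) by simp
  then have "(\<Sum>i\<le>N. coeff p i * y ^ i) * \<iota> (to_fract w) = 0" by simp
  then have "(\<Sum>i\<le>N. \<iota> (a i * to_fract w) * y ^ i) = 0"
    by (simp add: sum_distrib_right a h.hom_mult mult.assoc mult.commute[of "\<iota> (to_fract w)"]
        del: mult_eq_0_iff)
  then have "(\<Sum>i\<le>N. \<Sum>j\<le>N. \<kappa> (coeff (g i) j) * t ^ j * y ^ i) = 0"
    by (simp add: g \<iota>g sum_distrib_right)
  moreover have "\<exists>i\<le>N. \<exists>j\<le>N. coeff (g i) j \<noteq> 0"
  proof -
    let ?i = "degree p"
    have "a ?i \<noteq> 0" using p(2) a[of ?i] by auto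
    then have "a ?i * to_fract w \<noteq> 0" using w(1) by simp
    then have "g ?i \<noteq> 0" using g[of ?i] by auto
    then have "coeff (g ?i) (degree (g ?i)) \<noteq> 0" by simp
    then show ?thesis using N by blast
  qed
  ultimately show ?thesis by (intro exI[of _ N] exI[of _ "\<lambda>i. coeff (g i)"]) simp
qed

text \<open>
  The terms \<open>c\<^sub>i\<^sub>j t\<^sup>j y\<^sup>i\<close> of an algebraic equation for \<open>y\<close> are eigenvectors for \<open>j + i \<nu>\<close>. If these
  numbers were distinct, all terms would vanish.
\<close>
lemma exponential_rational:
  assumes y: "y \<in> E" "y \<noteq> 0" and \<nu>: "\<nu> \<in> E" "d \<nu> = 0" and dy: "d y = \<nu> * y"
  shows "\<exists>k l :: int. k \<noteq> 0 \<and> of_int k * \<nu> = of_int l"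
proof (rule ccontr)
  assume irr: "\<not> ?thesis"
  obtain N c where c: "\<exists>i\<le>N. \<exists>j\<le>N. c i j \<noteq> 0"
    and rel: "(\<Sum>i\<le>N. \<Sum>j\<le>N. \<kappa> (c i j) * t ^ j * y ^ i) = 0"
    using polynomial_relation[OF y(1)] by blast
  let ?I = "{..N} \<times> {..N}"
  define v where "v = (\<lambda>(i, j). \<kappa> (c i j) * t ^ j * y ^ i)"
  define \<mu> where "\<mu> = (\<lambda>(i, j). of_nat j + of_nat i * \<nu>)"
  have "d (y ^ i) = of_nat i * \<nu> * y ^ i" for i
    using d_power_exponential[OF y(1) dy] .
  then have v: "v k \<in> E \<and> d (v k) = \<mu> k * v k" for k
    using y \<nu> by (cases k) (simp add: v_def \<mu>_def d_mult d_t_power algebra_simps)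
  have "inj_on \<mu> ?I"
  proof (rule inj_onI)
    fix k k' assume eq: "\<mu> k = \<mu> k'"
    obtain i j i' j' where k: "k = (i, j)" "k' = (i', j')" by (cases k, cases k')
    have *: "of_int (int i - int i') * \<nu> = of_int (int j' - int j)"
      using eq by (simp add: k \<mu>_def algebra_simps)
    then have "i = i'" using irr by (metis eq_iff_diff_eq_0 of_nat_eq_iff)
    then show "k = k'" using eq by (simp add: k \<mu>_def)
  qed
  moreover have "sum v ?I = 0" using rel by (simp add: v_def sum.cartesian_product)
  ultimately have "\<forall>k\<in>?I. v k = 0"
    using v \<nu> by (intro eigenvectors_independent[of _ \<mu>]) (auto simp: \<mu>_def d_add d_mult)
  then have "c i j = 0" if "i \<le> N" "j \<le> N" for i j
    using that y by (auto simp: v_def)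
  then show False using c by blast
qed

text \<open>
  Such a \<open>u\<close> is a logarithm of \<open>t\<close>, and the claim is that \<open>t\<close> and \<open>u\<close> are algebraically independent
  over \<open>F\<close>. The operator \<open>d - k\<close> preserves the degree of \<open>g j\<close> for \<open>j \<noteq> k\<close> and lowers that of \<open>g k\<close>;
  repeating it shrinks a nontrivial relation to a single term \<open>b t\<^sup>k\<close>.
\<close>
lemma log_polynomials_independent:
  fixes g :: "nat \<Rightarrow> 'a poly"
  assumes u: "u \<in> E" "d u = 1" and J: "finite J"
    and "(\<Sum>j\<in>J. t ^ j * poly (map_poly \<kappa> (g j)) u) = 0"
  shows "\<forall>j\<in>J. g j = 0"
  using assms(4)
proof (induction "\<Sum>j\<in>J. if g j = 0 then 0 else Suc (degree (g j))" arbitrary: g rule: less_induct)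
  case less
  show ?case
  proof (rule ccontr)
    assume "\<not> ?case"
    then obtain k where k: "k \<in> J" "g k \<noteq> 0" by auto
    define h where "h j = smult (of_nat j - of_nat k) (g j) + pderiv (g j)" for j
    have hk: "h k = pderiv (g k)" by (simp add: h_def)
    have h_deg: "degree (h j) = degree (g j)" and h0: "h j = 0 \<longleftrightarrow> g j = 0" if "j \<noteq> k" for j
    proof -
      have nz: "of_nat j - of_nat k \<noteq> (0 :: 'a)" using that by simp
      have "degree (h j) \<le> degree (g j)"
        unfolding h_def by (intro degree_add_le) (auto simp: degree_pderiv degree_smult_le)
      moreover have lc: "coeff (h j) (degree (g j)) = (of_nat j - of_nat k) * lead_coeff (g j)"
        by (simp add: h_def coeff_pderiv coeff_eq_0)
      ultimately show "degree (h j) = degree (g j)"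
        using nz by (metis degree_0 le_antisym le_degree leading_coeff_0_iff mult_eq_0_iff zero_le)
      show "h j = 0 \<longleftrightarrow> g j = 0"
      proof
        assume "h j = 0"
        then show "g j = 0" using lc nz by simp
      qed (simp add: h_def)
    qed
    let ?G = "\<lambda>j. poly (map_poly \<kappa> (g j)) u" and ?H = "\<lambda>j. poly (map_poly \<kappa> (h j)) u"
    have GE: "?G j \<in> E" for j
      using u by (intro closed_poly) (simp add: poly_over_def coeff_map_poly)
    have H: "?H j = (of_nat j - of_nat k) * ?G j + poly (map_poly \<kappa> (pderiv (g j))) u" for j
    proof -
      have "map_poly \<kappa> (h j) = smult (of_nat j - of_nat k) (map_poly \<kappa> (g j)) + map_poly \<kappa> (pderiv (g j))"
        by (rule poly_eqI)
          (simp add: h_def coeff_map_poly \<kappa>.hom_add \<kappa>.hom_mult \<kappa>.hom_minus \<kappa>.hom_of_nat)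
      then show ?thesis by simp
    qed
    have "d (\<Sum>j\<in>J. t ^ j * ?G j) = (\<Sum>j\<in>J. of_nat j * t ^ j * ?G j + t ^ j * poly (map_poly \<kappa> (pderiv (g j))) u)"
      using GE u by (subst d_sum) (auto simp: d_mult d_t_power d_poly_\<kappa>)
    also have "\<dots> = (\<Sum>j\<in>J. t ^ j * ?H j + of_nat k * (t ^ j * ?G j))"
      by (rule sum.cong) (simp_all add: H algebra_simps)
    also have "\<dots> = (\<Sum>j\<in>J. t ^ j * ?H j)"
      using less.prems by (simp add: sum.distrib flip: sum_distrib_left)
    finally have sumH: "(\<Sum>j\<in>J. t ^ j * ?H j) = 0" using less.prems by simp
    have "(\<Sum>j\<in>J. if h j = 0 then 0 else Suc (degree (h j)))
        < (\<Sum>j\<in>J. if g j = 0 then 0 else Suc (degree (g j)))"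
    proof (rule sum_strict_mono_ex1[OF J])
      show "\<forall>j\<in>J. (if h j = 0 then 0 else Suc (degree (h j))) \<le> (if g j = 0 then 0 else Suc (degree (g j)))"
      proof
        fix j
        show "(if h j = 0 then 0 else Suc (degree (h j))) \<le> (if g j = 0 then 0 else Suc (degree (g j)))"
          using h0[of j] h_deg[of j] k by (cases "j = k") (auto simp: hk degree_pderiv)
      qed
      have "(if h k = 0 then 0 else Suc (degree (h k))) < Suc (degree (g k))"
        by (auto simp: hk pderiv_eq_0_iff degree_pderiv)
      then show "\<exists>j\<in>J. (if h j = 0 then 0 else Suc (degree (h j))) < (if g j = 0 then 0 else Suc (degree (g j)))"
        using k by (intro bexI[of _ k]) auto
    qed
    from less.hyps[OF this sumH] have h_zero: "\<forall>j\<in>J. h j = 0" .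
    then have others: "g j = 0" if "j \<in> J" "j \<noteq> k" for j using that h0 by blast
    have "degree (g k) = 0" using h_zero k hk by (simp add: pderiv_eq_0_iff)
    then obtain b where b: "g k = [:b:]" "b \<noteq> 0" using k by (metis degree_eq_zeroE pCons_eq_0_iff)
    have "(\<Sum>j\<in>J. t ^ j * ?G j) = (\<Sum>j\<in>J. if j = k then t ^ j * \<kappa> b else 0)"
      using others b by (intro sum.cong) (auto simp: map_poly_pCons)
    then show False using less.prems J k b by simp
  qed
qed

lemma no_logarithm: "\<not> (\<exists>u\<in>E. d u = 1)"
proof
  assume "\<exists>u\<in>E. d u = 1"
  then obtain u where u: "u \<in> E" "d u = 1" by blast
  obtain N c where c: "\<exists>i\<le>N. \<exists>j\<le>N. c i j \<noteq> 0"
    and rel: "(\<Sum>i\<le>N. \<Sum>j\<le>N. \<kappa> (c i j) * t ^ j * u ^ i) = 0"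
    using polynomial_relation[OF u(1)] by blast
  define g where "g j = (\<Sum>i\<le>N. monom (c i j) i)" for j
  have g: "coeff (g j) i = (if i \<le> N then c i j else 0)" for i j
    unfolding g_def coeff_sum by (simp add: coeff_monom)
  have "poly (map_poly \<kappa> (g j)) u = (\<Sum>i\<le>N. \<kappa> (c i j) * u ^ i)" for j
  proof -
    have "degree (map_poly \<kappa> (g j)) \<le> N" by (rule degree_le) (simp add: coeff_map_poly g)
    from poly_eq_bounded_sum[OF this, of u] show ?thesis by (simp add: coeff_map_poly g)
  qed
  then have "(\<Sum>j\<le>N. t ^ j * poly (map_poly \<kappa> (g j)) u) = (\<Sum>j\<le>N. \<Sum>i\<le>N. \<kappa> (c i j) * t ^ j * u ^ i)"
    by (simp add: sum_distrib_left ac_simps)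
  also have "\<dots> = 0" using rel by (subst sum.swap) simp
  finally have "\<forall>j\<in>{..N}. g j = 0" by (intro log_polynomials_independent[OF u]) simp_all
  then have "c i j = 0" if "i \<le> N" "j \<le> N" for i j
    using that g[of j i] by simp
  then show False using c by blast
qed

end

section \<open>Horizontal matrices of a split algebra\<close>

lemma hom_on_poly:
  assumes L: "subfield_set L" and s: "hom_on L \<sigma>" and p: "p \<in> poly_over L" and x: "x \<in> L"
  shows "\<sigma> (poly p x) = poly (map_poly \<sigma> p) (\<sigma> x) \<and> poly p x \<in> L"
  using p
proof (induction p)
  case 0 show ?case using hom_on_0[OF s L] L by (simp add: subfield_set_def)
next
  case (pCons a p)
  then have ap: "a \<in> L" "p \<in> poly_over L" by (auto simp: poly_over_pCons)
  have "map_poly \<sigma> (pCons a p) = pCons (\<sigma> a) (map_poly \<sigma> p)"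
    by (rule poly_eqI) (simp add: coeff_map_poly hom_on_0[OF s L] coeff_pCons split: nat.split)
  moreover have "x * poly p x \<in> L" using pCons.IH[OF ap(2)] x L by (simp add: subfield_set_def)
  ultimately show ?case
    using pCons.IH[OF ap(2)] ap x s L by (simp add: hom_on_def subfield_set_def)
qed

text \<open>
  The ambient field of a splitting field contains no distinguished copy of the algebraic closure of
  \<open>F\<close>, but it is algebraically closed, so finitely many algebraic elements can be mapped into it one
  after the other.
\<close>
lemma embed_algebraic_elements:
  fixes \<kappa> :: "'a::field \<Rightarrow> 'b::alg_closed_field" and S :: "'a alg_closure set"
  assumes hom: "field_hom \<kappa>" and S: "finite S"
  shows "\<exists>L \<tau>. subfield_set L \<and> hom_on L \<tau> \<and> range to_ac \<subseteq> L \<and> S \<subseteq> L \<and> (\<forall>c. \<tau> (to_ac c) = \<kappa> c)"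
  using S
proof (induction S rule: finite_induct)
  case empty
  interpret k: field_hom \<kappa> by (rule hom)
  have "subfield_set (range (to_ac :: 'a \<Rightarrow> _))"
    unfolding subfield_set_def
    by (safe; (simp flip: to_ac_add to_ac_mult to_ac_minus to_ac_inverse to_ac_0 to_ac_1)?)
  moreover have "hom_on (range to_ac) (\<lambda>y. \<kappa> (of_ac y))"
    unfolding hom_on_def
  proof (intro conjI ballI)
    show "\<kappa> (of_ac 1) = 1" using of_ac_to_ac[of "1 :: 'a"] by simp
    fix x y :: "'a alg_closure" assume "x \<in> range to_ac" "y \<in> range to_ac"
    then obtain a b where ab: "x = to_ac a" "y = to_ac b" by auto
    show "\<kappa> (of_ac (x + y)) = \<kappa> (of_ac x) + \<kappa> (of_ac y)"
      using of_ac_to_ac[of "a + b"] by (simp add: ab k.hom_add)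
    show "\<kappa> (of_ac (x * y)) = \<kappa> (of_ac x) * \<kappa> (of_ac y)"
      using of_ac_to_ac[of "a * b"] by (simp add: ab k.hom_mult)
  qed
  ultimately show ?case by (intro exI[of _ "range to_ac"] exI[of _ "\<lambda>y. \<kappa> (of_ac y)"]) simp
next
  case (insert x S)
  then obtain L \<tau> where L: "subfield_set L" "hom_on L \<tau>" "range to_ac \<subseteq> L" "S \<subseteq> L"
    "\<And>c. \<tau> (to_ac c) = \<kappa> c" by auto
  obtain p :: "'a poly" where p: "p \<noteq> 0" "poly (map_poly to_ac p) x = 0"
    by (rule alg_closure_algebraic)
  have pL: "map_poly to_ac p \<in> poly_over L" using L(3) by (auto simp: poly_over_def coeff_map_poly)
  have p0: "map_poly to_ac p \<noteq> 0" using p(1) by (simp add: map_poly_eq_0_iff)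
  from hom_on_extend[OF L(1,2) pL p0 p(2)] obtain L' \<tau>' where L': "subfield_set L'" "hom_on L' \<tau>'"
    "L \<subseteq> L'" "x \<in> L'" "\<forall>y\<in>L. \<tau>' y = \<tau> y" by blast
  have "\<tau>' (to_ac c) = \<kappa> c" for c
  proof -
    have "to_ac c \<in> L" using L(3) by blast
    then show ?thesis using L'(5) L(5) by simp
  qed
  then show ?case using L' L(3,4) by (intro exI[of _ L'] exI[of _ \<tau>']) auto
qed

text \<open>
  A polynomial of least degree works, because its derivative is nonzero in characteristic 0 and of
  smaller degree.
\<close>
lemma alg_closure_separable:
  fixes x :: "'a::field_char_0 alg_closure"
  shows "\<exists>f. poly (map_poly to_ac f) x = 0 \<and> poly (map_poly to_ac (pderiv f)) x \<noteq> 0"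
proof -
  let ?P = "\<lambda>f. f \<noteq> 0 \<and> poly (map_poly to_ac f) x = 0"
  obtain p :: "'a poly" where "?P p" using alg_closure_algebraic[of x] by metis
  define f where "f = arg_min degree ?P"
  have f: "f \<noteq> 0" "poly (map_poly to_ac f) x = 0"
    using arg_min_natI[of ?P p degree] \<open>?P p\<close> by (auto simp: f_def)
  have fmin: "degree f \<le> degree g" if "?P g" for g
    unfolding f_def by (rule arg_min_nat_le[of ?P]) (rule that)
  have "degree f \<noteq> 0"
  proof
    assume "degree f = 0"
    then obtain a where "f = [:a:]" by (rule degree_eq_zeroE)
    then show False using f by (simp add: map_poly_pCons)
  qed
  then have "pderiv f \<noteq> 0" "degree (pderiv f) < degree f"
    by (simp_all add: pderiv_eq_0_iff degree_pderiv)
  then show ?thesis using fmin[of "pderiv f"] f by (intro exI[of _ f]) auto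
qed

context differential_subfield
begin

text \<open>
  The derivation vanishes on matrix units, so their preimages under \<open>\<phi>\<close> are killed by the twisted
  derivation; by linearity of \<open>\<phi>\<close> every matrix is an \<open>E\<close>-linear combination of these preimages. A
  functional that vanishes on all horizontal matrices is thus zero.
\<close>
lemma horizontal_matrices_span:
  fixes \<phi> :: "'b mat \<Rightarrow> 'b mat" and f :: "'b mat \<Rightarrow> 'b"
  assumes Q: "Q \<in> matrices_over E n"
    and iso: "differential_algebra_iso E n (twisted_derivation d Q) (map_mat d) \<phi>"
    and f_add: "\<And>A B. A \<in> matrices_over E n \<Longrightarrow> B \<in> matrices_over E n \<Longrightarrow> f (A + B) = f A + f B"
    and f_smult: "\<And>c A. c \<in> E \<Longrightarrow> A \<in> matrices_over E n \<Longrightarrow> f (c \<cdot>\<^sub>m A) = c * f A"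
    and f: "X0 \<in> matrices_over E n" "f X0 \<noteq> 0"
  shows "\<exists>A\<in>matrices_over E n. twisted_derivation d Q A = 0\<^sub>m n n \<and> f A \<noteq> 0"
proof (rule ccontr)
  let ?M = "matrices_over E n" and ?D = "twisted_derivation d Q"
  assume "\<not> ?thesis"
  then have f0: "f A = 0" if "A \<in> ?M" "?D A = 0\<^sub>m n n" for A using that by blast
  have bij: "bij_betw \<phi> ?M ?M"
    and phi_add: "\<And>A B. A \<in> ?M \<Longrightarrow> B \<in> ?M \<Longrightarrow> \<phi> (A + B) = \<phi> A + \<phi> B"
    and phi_smult: "\<And>c A. c \<in> E \<Longrightarrow> A \<in> ?M \<Longrightarrow> \<phi> (c \<cdot>\<^sub>m A) = c \<cdot>\<^sub>m \<phi> A"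
    and phi_D: "\<And>A. A \<in> ?M \<Longrightarrow> \<phi> (?D A) = map_mat d (\<phi> A)"
    using iso unfolding differential_algebra_iso_def by blast+
  have inj: "inj_on \<phi> ?M" using bij by (rule bij_betw_imp_inj_on)
  have zero: "0\<^sub>m n n \<in> ?M" by (simp add: matrices_over_iff)
  have smult: "c \<cdot>\<^sub>m A \<in> ?M" if "c \<in> E" "A \<in> ?M" for c A using that by (auto simp: matrices_over_iff)
  have phi_M: "\<phi> A \<in> ?M" if "A \<in> ?M" for A using bij that by (auto simp: bij_betw_def)
  have phi0: "\<phi> (0\<^sub>m n n) = 0\<^sub>m n n"
  proof -
    have "0 \<cdot>\<^sub>m 0\<^sub>m n n = (0\<^sub>m n n :: 'b mat)" by auto
    then have "\<phi> (0\<^sub>m n n) = 0 \<cdot>\<^sub>m \<phi> (0\<^sub>m n n)" using phi_smult[OF closed(1) zero] by simp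
    also have "\<dots> = 0\<^sub>m n n" using matrices_overD[OF phi_M[OF zero]] by (intro eq_matI) auto
    finally show ?thesis .
  qed
  have D_M: "?D A \<in> ?M" if "A \<in> ?M" for A
  proof -
    show ?thesis
      unfolding twisted_derivation_def
      by (intro matrices_over_diff matrices_over_add matrices_over_mult matrices_over_d that Q)
  qed
  have unit: "f A = 0" if A: "A \<in> ?M" "map_mat d (\<phi> A) = 0\<^sub>m n n" for A
  proof -
    have "\<phi> (?D A) = \<phi> (0\<^sub>m n n)" using phi_D[OF A(1)] A(2) phi0 by simp
    then have "?D A = 0\<^sub>m n n" by (rule inj_onD[OF inj]) (use D_M A zero in auto)
    then show ?thesis using f0 A by blast
  qed
  \<comment> \<open>The matrix \<open>Z\<close> is built up from its entries one position at a time.\<close>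
  define part where "part Z S = Matrix.mat n n (\<lambda>k. if k \<in> S then Z $$ k else 0)" for Z :: "'b mat" and S
  have part: "\<forall>A\<in>?M. \<phi> A = part Z S \<longrightarrow> f A = 0" if Z: "Z \<in> ?M" and S: "finite S" for Z S
    using S
  proof (induction S rule: finite_induct)
    case empty
    have "f A = 0" if "A \<in> ?M" "\<phi> A = part Z {}" for A
      using that by (intro unit) (auto simp: part_def)
    then show ?case by blast
  next
    case (insert k S)
    show ?case
    proof (intro ballI impI)
      fix A assume A: "A \<in> ?M" "\<phi> A = part Z (insert k S)"
      define u where "u = (Matrix.mat n n (\<lambda>l. if l = k then 1 else 0) :: 'b mat)"
      define c where "c = (if fst k < n \<and> snd k < n then Z $$ k else 0)"
      have c: "c \<in> E" using Z by (cases k) (auto simp: c_def matrices_over_iff)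
      have "u \<in> ?M" "part Z S \<in> ?M"
        using Z by (auto simp: u_def part_def matrices_over_iff)
      then obtain V W where V: "V \<in> ?M" "\<phi> V = u" and W: "W \<in> ?M" "\<phi> W = part Z S"
        using bij by (auto simp: bij_betw_def) (metis imageE)
      have "part Z (insert k S) = part Z S + c \<cdot>\<^sub>m u"
        using insert.hyps(2) by (intro eq_matI) (auto simp: part_def u_def c_def)
      then have "\<phi> A = \<phi> (W + c \<cdot>\<^sub>m V)"
        using A V W c smult by (simp add: phi_add phi_smult)
      then have "A = W + c \<cdot>\<^sub>m V"
        by (rule inj_onD[OF inj]) (use A V W c smult in \<open>auto intro: matrices_over_add\<close>)
      then have "f A = f W + c * f V" using V W c smult by (simp add: f_add f_smult)
      moreover have "f V = 0" by (rule unit[OF V(1)]) (auto simp: V(2) u_def)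
      moreover have "f W = 0" using insert.IH W by blast
      ultimately show "f A = 0" by simp
    qed
  qed
  have "part (\<phi> X0) ({..<n} \<times> {..<n}) = \<phi> X0"
    using matrices_overD[OF phi_M[OF f(1)]] by (intro eq_matI) (auto simp: part_def)
  then have "f X0 = 0" using part[OF phi_M[OF f(1)], of "{..<n} \<times> {..<n}"] f(1) by simp
  then show False using f(2) by simp
qed

end

definition bilinear :: "nat \<Rightarrow> (nat \<Rightarrow> 'b::field) \<Rightarrow> 'b mat \<Rightarrow> (nat \<Rightarrow> 'b) \<Rightarrow> 'b" where
  "bilinear n l A r = (\<Sum>i<n. \<Sum>j<n. l i * A $$ (i, j) * r j)"

context differential_subfield
begin

lemma bilinear_closed:
  "A \<in> matrices_over E n \<Longrightarrow> (\<And>i. i < n \<Longrightarrow> l i \<in> E) \<Longrightarrow> (\<And>i. i < n \<Longrightarrow> r i \<in> E) \<Longrightarrow> bilinear n l A r \<in> E"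
  unfolding bilinear_def by (intro closed_sum closed) (auto simp: matrices_over_iff)

text \<open>
  A horizontal \<open>A\<close> has the derivative \<open>A Q - Q A\<close>. The first product moves \<open>Q\<close> to the vector \<open>r\<close>, the
  second one moves it to the left eigenvector \<open>l\<close>.
\<close>
lemma d_bilinear_horizontal:
  assumes Q: "Q \<in> matrices_over E n" and A: "A \<in> matrices_over E n" "twisted_derivation d Q A = 0\<^sub>m n n"
    and l: "\<And>i. i < n \<Longrightarrow> l i \<in> E \<and> d (l i) = 0" and r: "\<And>i. i < n \<Longrightarrow> r i \<in> E \<and> d (r i) = 0"
    and left: "\<And>j. j < n \<Longrightarrow> (\<Sum>i<n. l i * Q $$ (i, j)) = c * l j"
  shows "d (bilinear n l A r) = bilinear n l A (\<lambda>i. \<Sum>j<n. Q $$ (i, j) * r j) - c * bilinear n l A r"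
proof -
  have car: "A \<in> carrier_mat n n" "Q \<in> carrier_mat n n" using A Q by auto
  have dA: "d (A $$ (i, j)) = (\<Sum>k<n. A $$ (i, k) * Q $$ (k, j)) - (\<Sum>k<n. Q $$ (i, k) * A $$ (k, j))"
    if "i < n" "j < n" for i j
  proof -
    have "(twisted_derivation d Q A) $$ (i, j) = 0" using A(2) that by simp
    then show ?thesis
      using car that
      by (simp add: twisted_derivation_def scalar_prod_def lessThan_atLeast0 eq_diff_eq add.commute)
  qed
  have ent: "A $$ (i, j) \<in> E" if "i < n" "j < n" for i j using A(1) that by (simp add: matrices_over_iff)
  have "d (bilinear n l A r) = (\<Sum>i<n. \<Sum>j<n. l i * d (A $$ (i, j)) * r j)"
  proof -
    have "d (bilinear n l A r) = (\<Sum>i<n. d (\<Sum>j<n. l i * A $$ (i, j) * r j))"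
      unfolding bilinear_def by (intro d_sum closed_sum) (use l r ent in auto)
    also have "\<dots> = (\<Sum>i<n. \<Sum>j<n. d (l i * A $$ (i, j) * r j))"
      by (intro sum.cong refl d_sum) (use l r ent in auto)
    also have "\<dots> = (\<Sum>i<n. \<Sum>j<n. l i * d (A $$ (i, j)) * r j)"
      by (intro sum.cong refl) (use l r ent in \<open>simp add: d_mult\<close>)
    finally show ?thesis .
  qed
  also have "\<dots> = (\<Sum>i<n. \<Sum>j<n. l i * (\<Sum>k<n. A $$ (i, k) * Q $$ (k, j)) * r j)
      - (\<Sum>i<n. \<Sum>j<n. l i * (\<Sum>k<n. Q $$ (i, k) * A $$ (k, j)) * r j)"
    by (simp add: dA algebra_simps sum_subtractf)
  also have "(\<Sum>i<n. \<Sum>j<n. l i * (\<Sum>k<n. A $$ (i, k) * Q $$ (k, j)) * r j)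
      = bilinear n l A (\<lambda>i. \<Sum>j<n. Q $$ (i, j) * r j)"
  proof -
    have "(\<Sum>j<n. l i * (\<Sum>k<n. A $$ (i, k) * Q $$ (k, j)) * r j)
        = (\<Sum>k<n. l i * A $$ (i, k) * (\<Sum>j<n. Q $$ (k, j) * r j))" for i
      unfolding sum_distrib_left sum_distrib_right by (subst sum.swap) (simp add: mult.assoc)
    then show ?thesis by (simp add: bilinear_def)
  qed
  also have "(\<Sum>i<n. \<Sum>j<n. l i * (\<Sum>k<n. Q $$ (i, k) * A $$ (k, j)) * r j) = c * bilinear n l A r"
  proof -
    have "(\<Sum>i<n. \<Sum>j<n. l i * (\<Sum>k<n. Q $$ (i, k) * A $$ (k, j)) * r j)
        = (\<Sum>j<n. \<Sum>i<n. \<Sum>k<n. l i * Q $$ (i, k) * A $$ (k, j) * r j)"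
      unfolding sum_distrib_left sum_distrib_right by (subst sum.swap) (simp add: mult.assoc)
    also have "\<dots> = (\<Sum>j<n. \<Sum>k<n. (\<Sum>i<n. l i * Q $$ (i, k)) * A $$ (k, j) * r j)"
      unfolding sum_distrib_left sum_distrib_right by (rule sum.cong[OF refl], subst sum.swap) simp
    also have "\<dots> = (\<Sum>j<n. \<Sum>k<n. c * (l k * A $$ (k, j) * r j))"
      by (intro sum.cong refl) (simp add: left mult.assoc)
    also have "\<dots> = c * bilinear n l A r"
      unfolding bilinear_def sum_distrib_left by (rule sum.swap)
    finally show ?thesis .
  qed
  finally show ?thesis .
qed

lemma horizontal_bilinear_nonzero:
  assumes Q: "Q \<in> matrices_over E n"
    and iso: "differential_algebra_iso E n (twisted_derivation d Q) (map_mat d) \<phi>"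
    and l: "\<exists>i<n. l i \<noteq> 0" and r: "\<exists>i<n. r i \<noteq> 0"
  shows "\<exists>A\<in>matrices_over E n. twisted_derivation d Q A = 0\<^sub>m n n \<and> bilinear n l A r \<noteq> 0"
proof -
  obtain a b where ab: "a < n" "l a \<noteq> 0" "b < n" "r b \<noteq> 0" using l r by blast
  define u where "u = (Matrix.mat n n (\<lambda>k. if k = (a, b) then 1 else 0) :: 'b mat)"
  show ?thesis
  proof (rule horizontal_matrices_span[OF Q iso])
    show "u \<in> matrices_over E n" by (auto simp: u_def matrices_over_iff)
    have "bilinear n l u r = (\<Sum>i<n. \<Sum>j<n. if i = a \<and> j = b then l i * r j else 0)"
      unfolding bilinear_def by (intro sum.cong) (auto simp: u_def)
    also have "\<dots> = (\<Sum>i<n. if i = a then \<Sum>j<n. if j = b then l i * r j else 0 else 0)"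
      by (intro sum.cong) auto
    also have "\<dots> = l a * r b" using ab by simp
    finally show "bilinear n l u r \<noteq> 0" using ab by simp
    fix A B assume "A \<in> matrices_over E n" "B \<in> matrices_over E n"
    then show "bilinear n l (A + B) r = bilinear n l A r + bilinear n l B r"
      by (auto simp: bilinear_def matrices_over_iff algebra_simps sum.distrib)
  next
    fix c A assume "A \<in> matrices_over E n"
    then show "bilinear n l (c \<cdot>\<^sub>m A) r = c * bilinear n l A r"
      by (auto simp: bilinear_def matrices_over_iff sum_distrib_left ac_simps)
  qed
qed

end

section \<open>Eigenvectors, triangular form and Jordan chains over a field\<close>

lemma eigenvalue_right_vector:
  fixes A :: "'k::field mat"
  assumes A: "A \<in> carrier_mat n n" and c: "eigenvalue A c"
  shows "\<exists>r. (\<exists>i<n. r i \<noteq> 0) \<and> (\<forall>i<n. (\<Sum>j<n. A $$ (i, j) * r j) = c * r i)"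
proof -
  obtain v where v: "v \<in> carrier_vec n" "v \<noteq> 0\<^sub>v n" "A *\<^sub>v v = c \<cdot>\<^sub>v v"
    using A c by (auto simp: eigenvalue_def eigenvector_def)
  have "\<exists>i<n. v $ i \<noteq> 0"
  proof (rule ccontr)
    assume "\<not> ?thesis"
    then have "v = 0\<^sub>v n" using v(1) by (intro eq_vecI) auto
    then show False using v(2) by simp
  qed
  moreover have "(\<Sum>j<n. A $$ (i, j) * v $ j) = c * v $ i" if "i < n" for i
  proof -
    have "(A *\<^sub>v v) $ i = (c \<cdot>\<^sub>v v) $ i" by (simp add: v(3))
    then show ?thesis using A v(1) that by (simp add: scalar_prod_def lessThan_atLeast0)
  qed
  ultimately show ?thesis by (intro exI[of _ "\<lambda>i. v $ i"]) simp
qed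

lemma eigenvalue_left_vector:
  fixes A :: "'k::field mat"
  assumes A: "A \<in> carrier_mat n n" and c: "eigenvalue A c"
  shows "\<exists>l. (\<exists>i<n. l i \<noteq> 0) \<and> (\<forall>j<n. (\<Sum>i<n. l i * A $$ (i, j)) = c * l j)"
proof -
  have AT: "transpose_mat A \<in> carrier_mat n n" using A by simp
  have "eigenvalue (transpose_mat A) c"
    using c unfolding eigenvalue_root_char_poly[OF A] eigenvalue_root_char_poly[OF AT]
      char_poly_transpose_mat[OF A] .
  from eigenvalue_right_vector[OF AT this] obtain r where
    r: "\<exists>i<n. r i \<noteq> 0" "\<forall>i<n. (\<Sum>j<n. transpose_mat A $$ (i, j) * r j) = c * r i" by blast
  have "(\<Sum>i<n. r i * A $$ (i, j)) = c * r j" if "j < n" for j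
  proof -
    have "(\<Sum>i<n. r i * A $$ (i, j)) = (\<Sum>i<n. transpose_mat A $$ (j, i) * r i)"
      using A that by (intro sum.cong) (auto simp: mult.commute)
    then show ?thesis using r(2) that by simp
  qed
  then show ?thesis using r(1) by blast
qed

text \<open>
  The matrix is the identity with columns \<open>0\<close> and \<open>k\<close> exchanged and \<open>v\<close> written into column \<open>0\<close>. It
  has a trivial kernel because \<open>v k\<close> is the only nonzero entry of row \<open>k\<close>.
\<close>
lemma invertible_mat_first_column:
  fixes v :: "nat \<Rightarrow> 'k::field"
  assumes k: "k < n" "v k \<noteq> 0"
  shows "\<exists>S\<in>carrier_mat n n. \<exists>T\<in>carrier_mat n n. S * T = 1\<^sub>m n \<and> T * S = 1\<^sub>m n \<and> (\<forall>i<n. S $$ (i, 0) = v i)"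
proof -
  define S where "S = Matrix.mat n n (\<lambda>(i, j). if j = 0 then v i
    else if j = k then (if i = 0 then 1 else 0) else (if i = j then 1 else 0))"
  have S: "S \<in> carrier_mat n n" by (simp add: S_def)
  have "det S \<noteq> 0"
  proof
    assume "det S = 0"
    then obtain w where w: "w \<in> carrier_vec n" "w \<noteq> 0\<^sub>v n" "S *\<^sub>v w = 0\<^sub>v n"
      unfolding det_0_iff_vec_prod_zero_field[OF S] by blast
    have row: "(\<Sum>j<n. S $$ (i, j) * vec_index w j) = 0" if "i < n" for i
    proof -
      have "vec_index (S *\<^sub>v w) i = 0" using w(3) that by simp
      then show ?thesis using S w(1) that by (simp add: scalar_prod_def lessThan_atLeast0)
    qed
    have "(\<Sum>j<n. S $$ (k, j) * vec_index w j) = (\<Sum>j<n. if j = 0 then v k * vec_index w 0 else 0)"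
      using k by (intro sum.cong) (auto simp: S_def)
    then have w0: "vec_index w 0 = 0" using row[OF k(1)] k by simp
    have "vec_index w j = 0" if j: "j < n" "j \<noteq> 0" for j
    proof -
      let ?i = "if j = k then 0 else j"
      have "(\<Sum>l<n. S $$ (?i, l) * vec_index w l) = (\<Sum>l<n. if l = j then vec_index w j else 0)"
        using j w0 by (intro sum.cong) (auto simp: S_def)
      then show ?thesis using row[of ?i] j by (simp split: if_splits)
    qed
    then have "vec_index w i = 0" if "i < n" for i using w0 that by (cases "i = 0") auto
    then have "w = 0\<^sub>v n" using w(1) by (intro eq_vecI) auto
    then show False using w(2) by simp
  qed
  then have "S \<in> Units (ring_mat TYPE('k) n ())" by (rule det_non_zero_imp_unit[OF S])
  then obtain T where "T \<in> carrier_mat n n" "S * T = 1\<^sub>m n" "T * S = 1\<^sub>m n"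
    by (auto simp: Units_def ring_mat_def)
  then show ?thesis using S by (intro bexI[of _ S] bexI[of _ T]) (auto simp: S_def)
qed

text \<open>
  In a basis that starts with an eigenvector the first column of \<open>A\<close> is a multiple of the first unit
  vector; the induction continues with the complementary block.
\<close>
lemma triangularizable_if_char_poly_splits:
  fixes A :: "'k::field mat"
  assumes "A \<in> carrier_mat n n" and "char_poly A = (\<Prod>a\<leftarrow>as. [:- a, 1:])"
  shows "\<exists>B. upper_triangular B \<and> similar_mat A B"
  using assms
proof (induction as arbitrary: n A)
  case Nil
  then have "n = 0" using degree_monic_char_poly[of A n] by simp
  then show ?case using similar_mat_refl[OF Nil.prems(1)] Nil.prems(1) by (intro exI[of _ A]) auto
next
  case (Cons a as)
  note A = Cons.prems(1)
  have cp: "char_poly A = [:- a, 1:] * (\<Prod>b\<leftarrow>as. [:- b, 1:])" using Cons.prems(2) by simp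
  have "eigenvalue A a" unfolding eigenvalue_root_char_poly[OF A] cp by simp
  then obtain v where v: "\<exists>i<n. v i \<noteq> 0" "\<And>i. i < n \<Longrightarrow> (\<Sum>j<n. A $$ (i, j) * v j) = a * v i"
    using eigenvalue_right_vector[OF A] by blast
  then obtain m where n: "n = Suc m" by (metis less_nat_zero_code not0_implies_Suc)
  obtain S T where S: "S \<in> carrier_mat n n" and T: "T \<in> carrier_mat n n"
    and ST: "S * T = 1\<^sub>m n" "T * S = 1\<^sub>m n" and col: "\<And>i. i < n \<Longrightarrow> S $$ (i, 0) = v i"
    using invertible_mat_first_column v(1) by blast
  define A' where "A' = T * A * S"
  have A': "A' \<in> carrier_mat n n" using S T A by (simp add: A'_def)
  have "A = S * A' * T"
  proof -
    have "S * A' * T = (S * T) * A * (S * T)"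
      unfolding A'_def using S T A by (simp add: assoc_mult_mat[of _ n n _ n _ n])
    then show ?thesis using A by (simp add: ST)
  qed
  then have AA': "similar_mat A A'"
    unfolding similar_mat_def using similar_mat_witI[OF ST _ A A' S T] by blast
  have col0: "A' $$ (i, 0) = (if i = 0 then a else 0)" if i: "i < n" for i
  proof -
    have AS: "(A * S) $$ (j, 0) = a * S $$ (j, 0)" if "j < n" for j
    proof -
      have "(A * S) $$ (j, 0) = (\<Sum>l<n. A $$ (j, l) * v l)"
        using A S that n col by (simp add: scalar_prod_def lessThan_atLeast0)
      then show ?thesis using v(2)[OF that] col[OF that] by simp
    qed
    have "A' = T * (A * S)" using S T A by (simp add: A'_def assoc_mult_mat[of _ n n _ n _ n])
    then have "A' $$ (i, 0) = (\<Sum>j<n. T $$ (i, j) * (A * S) $$ (j, 0))"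
      using S T A i n by (simp add: scalar_prod_def lessThan_atLeast0)
    also have "\<dots> = a * (\<Sum>j<n. T $$ (i, j) * S $$ (j, 0))"
      by (simp add: AS sum_distrib_left mult.left_commute)
    also have "(\<Sum>j<n. T $$ (i, j) * S $$ (j, 0)) = (T * S) $$ (i, 0)"
      using S T i n by (simp add: scalar_prod_def lessThan_atLeast0)
    finally show ?thesis using i n by (simp add: ST)
  qed
  define A1 where "A1 = Matrix.mat 1 1 (\<lambda>_. a)"
  define A2 where "A2 = Matrix.mat 1 m (\<lambda>(i, j). A' $$ (0, Suc j))"
  define A3 where "A3 = Matrix.mat m m (\<lambda>(i, j). A' $$ (Suc i, Suc j))"
  have c: "A1 \<in> carrier_mat 1 1" "A2 \<in> carrier_mat 1 m" "A3 \<in> carrier_mat m m"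
    by (simp_all add: A1_def A2_def A3_def)
  have block: "A' = four_block_mat A1 A2 (0\<^sub>m m 1) A3"
  proof (rule eq_matI)
    fix i j assume "i < dim_row (four_block_mat A1 A2 (0\<^sub>m m 1) A3)" "j < dim_col (four_block_mat A1 A2 (0\<^sub>m m 1) A3)"
    then have "i < Suc m" "j < Suc m" using c by auto
    then show "A' $$ (i, j) = four_block_mat A1 A2 (0\<^sub>m m 1) A3 $$ (i, j)"
      using col0[of i] n by (cases i; cases j) (auto simp: A1_def A2_def A3_def)
  qed (use A' n c in auto)
  have "char_poly A = char_poly A1 * char_poly A3"
    using char_poly_similar[OF AA'] char_poly_four_block_zeros_col[OF c] by (simp add: block)
  moreover have "char_poly A1 = [:- a, 1:]" by (simp add: A1_def char_poly_defs det_def sign_def)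
  ultimately have "char_poly A3 = (\<Prod>b\<leftarrow>as. [:- b, 1:])"
    using cp by (metis mult_cancel_left pCons_eq_0_iff zero_neq_one)
  then obtain B where ut: "upper_triangular B" and "similar_mat A3 B" using Cons.IH[OF c(3)] by blast
  then obtain U V where wit: "similar_mat_wit A3 B U V" by (auto simp: similar_mat_def)
  note w = similar_mat_witD2[OF c(3) wit]
  have "similar_mat_wit A' (four_block_mat A1 (A2 * U) (0\<^sub>m m 1) B)
      (four_block_mat (1\<^sub>m 1) (0\<^sub>m 1 m) (0\<^sub>m m 1) U) (four_block_mat (1\<^sub>m 1) (0\<^sub>m 1 m) (0\<^sub>m m 1) V)"
    unfolding block
    by (rule similar_mat_wit_four_block[OF similar_mat_wit_refl[OF c(1)] wit _ _ c(1) c(3)])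
      (use c w in auto)
  then have "similar_mat A' (four_block_mat A1 (A2 * U) (0\<^sub>m m 1) B)" by (auto simp: similar_mat_def)
  moreover have "upper_triangular (four_block_mat A1 (A2 * U) (0\<^sub>m m 1) B)"
    by (rule upper_triangular_four_block[OF c(1) w(5) _ ut]) (auto simp: A1_def)
  ultimately show ?case using similar_mat_trans[OF AA'] by blast
qed

lemma jordan_nf_exists_field:
  fixes A :: "'k::field mat"
  assumes A: "A \<in> carrier_mat n n" and split: "char_poly A = (\<Prod>a\<leftarrow>as. [:- a, 1:])"
  shows "\<exists>n_as. jordan_nf A n_as"
proof -
  obtain B where B: "upper_triangular B" "similar_mat A B"
    using triangularizable_if_char_poly_splits[OF A split] by blast
  then have "B \<in> carrier_mat n n" using A by (auto simp: similar_mat_def similar_mat_wit_def Let_def)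
  then have "jordan_nf B (triangular_to_jnf_vector B)" using B(1) by (rule triangular_to_jnf_vector)
  then show ?thesis using similar_mat_trans[OF B(2)] unfolding jordan_nf_def by blast
qed

text \<open>
  A Jordan matrix is bidiagonal, and an entry above the diagonal is nonzero only inside a block, where
  the diagonal is constant.
\<close>
lemma jordan_matrix_entries:
  assumes "i < sum_list (map fst n_as)" "j < sum_list (map fst n_as)"
  shows "jordan_matrix n_as $$ (i, j) \<noteq> 0 \<Longrightarrow> i = j \<or> j = Suc i"
    and "j = Suc i \<Longrightarrow> jordan_matrix n_as $$ (i, j) \<noteq> 0 \<Longrightarrow>
      jordan_matrix n_as $$ (i, j) = 1 \<and> jordan_matrix n_as $$ (i, i) = jordan_matrix n_as $$ (j, j)"
  using assms
proof (induction n_as arbitrary: i j)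
  case (Cons na n_as)
  obtain m a where na: "na = (m, a)" by (cases na)
  let ?N = "sum_list (map fst n_as)"
  have entry: "jordan_matrix (na # n_as) $$ (i, j) =
      (if i < m then if j < m then jordan_block m a $$ (i, j) else 0
       else if j < m then 0 else jordan_matrix n_as $$ (i - m, j - m))"
    if "i < m + ?N" "j < m + ?N" for i j
    using that unfolding na jordan_matrix_Cons by (subst index_mat_four_block) auto
  {
    case 1
    show ?case
    proof (cases "i < m \<or> j < m")
      case True
      then show ?thesis using 1 entry[of i j] by (auto simp: na split: if_splits)
    next
      case False
      then show ?thesis using Cons.IH(1)[of "i - m" "j - m"] 1 entry[of i j] by (simp add: na) arith
    qed
  next
    case 2
    show ?case
    proof (cases "i < m")
      case True
      then show ?thesis using 2 entry[of i j] entry[of i i] entry[of j j]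
        by (auto simp: na split: if_splits)
    next
      case False
      then have "i - m < ?N" "Suc (i - m) < ?N" using 2 by (auto simp: na)
      then show ?thesis
        using False Cons.IH(2)[where i = "i - m" and j = "Suc (i - m)"] 2 entry[of i j] entry[of i i] entry[of j j]
        by (simp add: na Suc_diff_le)
    qed
  }
qed simp_all

text \<open>
  If the Jordan form is not diagonal, then at its first nonzero entry above the diagonal the two
  adjacent columns of the transition matrix form a chain \<open>s\<close>, \<open>r\<close>.
\<close>
lemma diagonalizable_if_no_jordan_chain:
  fixes A :: "'k::field mat"
  assumes A: "A \<in> carrier_mat n n" and split: "char_poly A = (\<Prod>a\<leftarrow>as. [:- a, 1:])"
    and no_chain: "\<And>c s r. \<exists>i<n. s i \<noteq> 0 \<Longrightarrow> (\<And>i. i < n \<Longrightarrow> (\<Sum>j<n. A $$ (i, j) * s j) = c * s i) \<Longrightarrow>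
      (\<And>i. i < n \<Longrightarrow> (\<Sum>j<n. A $$ (i, j) * r j) = c * r i + s i) \<Longrightarrow> False"
  shows "diagonalizable_mat A"
proof -
  obtain n_as where "jordan_nf A n_as" using jordan_nf_exists_field[OF A split] by blast
  define J where "J = jordan_matrix n_as"
  have sim: "similar_mat A J" using \<open>jordan_nf A n_as\<close> by (simp add: jordan_nf_def J_def)
  then obtain S T where wit: "similar_mat_wit A J S T" by (auto simp: similar_mat_def)
  note w = similar_mat_witD2[OF A wit]
  have n: "sum_list (map fst n_as) = n"
    using w(5) unfolding J_def carrier_mat_def by simp
  have J0: "J $$ (i, j) = 0" if "i < n" "j < n" "i \<noteq> j" "j \<noteq> Suc i" for i j
    using jordan_matrix_entries(1)[of i n_as j] that n by (auto simp: J_def)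
  have J1: "J $$ (i, Suc i) = 1 \<and> J $$ (i, i) = J $$ (Suc i, Suc i)" if "Suc i < n" "J $$ (i, Suc i) \<noteq> 0" for i
    using jordan_matrix_entries(2)[of i n_as "Suc i"] that n by (simp add: J_def)
  have AS: "(\<Sum>j<n. A $$ (i, j) * S $$ (j, k)) = (\<Sum>l<n. S $$ (i, l) * J $$ (l, k))" if "i < n" "k < n" for i k
  proof -
    have "A * S = S * J" using w A by (simp add: assoc_mult_mat[of _ n n _ n _ n])
    then have "(A * S) $$ (i, k) = (S * J) $$ (i, k)" by simp
    then show ?thesis using A w(5,6) that by (simp add: scalar_prod_def lessThan_atLeast0)
  qed
  have "J $$ (i, Suc i) = 0" if i: "Suc i < n" for i
  proof (rule ccontr)
    let ?bad = "\<lambda>k. Suc k < n \<and> J $$ (k, Suc k) \<noteq> 0"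
    assume "J $$ (i, Suc i) \<noteq> 0"
    then have "?bad i" using i by simp
    \<comment> \<open>Minimality of \<open>k\<close> makes column \<open>k\<close> of \<open>J\<close> a multiple of a unit vector, so \<open>s\<close> is an eigenvector.\<close>
    define k where "k = (LEAST k. ?bad k)"
    have k: "Suc k < n" "J $$ (k, Suc k) \<noteq> 0" using LeastI[of ?bad, OF \<open>?bad i\<close>] by (auto simp: k_def)
    have k_min: "J $$ (m, k) = 0" if "m < n" "m \<noteq> k" for m
    proof (cases "k = Suc m")
      case True
      then show ?thesis using not_less_Least[of m ?bad] k(1) by (auto simp: k_def)
    next
      case False
      then show ?thesis using J0[of m k] that k(1) by simp
    qed
    define c where "c = J $$ (k, k)"
    note J1k = J1[OF k]
    show False
    proof (rule no_chain[of "\<lambda>i. S $$ (i, k)" c "\<lambda>i. S $$ (i, Suc k)"])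
      show "\<exists>i<n. S $$ (i, k) \<noteq> 0"
      proof (rule ccontr)
        assume "\<not> ?thesis"
        then have "(T * S) $$ (k, k) = 0" using w(6,7) k(1) by (simp add: scalar_prod_def)
        then show False using w(2) k(1) by simp
      qed
      fix i assume i: "i < n"
      have "(\<Sum>l<n. S $$ (i, l) * J $$ (l, k)) = (\<Sum>l<n. if l = k then S $$ (i, k) * c else 0)"
        using k_min by (intro sum.cong) (auto simp: c_def)
      then show "(\<Sum>j<n. A $$ (i, j) * S $$ (j, k)) = c * S $$ (i, k)"
        using AS[OF i, of k] k(1) by (simp add: mult.commute)
      have "(\<Sum>l<n. S $$ (i, l) * J $$ (l, Suc k))
          = (\<Sum>l<n. (if l = Suc k then S $$ (i, Suc k) * c else 0) + (if l = k then S $$ (i, k) else 0))"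
        using J0[of _ "Suc k"] J1k k(1) by (intro sum.cong) (auto simp: c_def)
      then show "(\<Sum>j<n. A $$ (i, j) * S $$ (j, Suc k)) = c * S $$ (i, Suc k) + S $$ (i, k)"
        using AS[OF i, of "Suc k"] k(1) by (simp add: sum.distrib mult.commute)
    qed
  qed
  then have "J $$ (i, j) = 0" if "i < n" "j < n" "i \<noteq> j" for i j
    using J0[of i j] that by (cases "j = Suc i") auto
  then have "diagonal_mat J" using w(5) by (auto simp: diagonal_mat_def)
  then show ?thesis using sim unfolding diagonalizable_mat_def by blast
qed

lemma trace_similar:
  fixes A B :: "'k::comm_ring_1 mat"
  assumes A: "A \<in> carrier_mat n n" and wit: "similar_mat_wit A B S T"
  shows "(\<Sum>i<n. A $$ (i, i)) = (\<Sum>i<n. B $$ (i, i))"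
proof -
  note w = similar_mat_witD2[OF A wit]
  have trace_comm: "(\<Sum>i<n. (V * W) $$ (i, i)) = (\<Sum>i<n. (W * V) $$ (i, i))"
    if "V \<in> carrier_mat n n" "W \<in> carrier_mat n n" for V W :: "'k mat"
  proof -
    have "(\<Sum>i<n. (V * W) $$ (i, i)) = (\<Sum>i<n. \<Sum>k<n. V $$ (i, k) * W $$ (k, i))"
      using that by (simp add: scalar_prod_def lessThan_atLeast0)
    also have "\<dots> = (\<Sum>k<n. \<Sum>i<n. W $$ (k, i) * V $$ (i, k))"
      by (subst sum.swap) (simp add: mult.commute)
    also have "\<dots> = (\<Sum>i<n. (W * V) $$ (i, i))"
      using that by (simp add: scalar_prod_def lessThan_atLeast0)
    finally show ?thesis .
  qed
  have "T * (S * B) = B" using w by (simp add: assoc_mult_mat[of T n n S n B n, symmetric])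
  then show ?thesis using trace_comm[of "S * B" T] w by simp
qed

lemma alg_closure_char_poly_splits:
  fixes A :: "'k::alg_closed_field mat"
  assumes "A \<in> carrier_mat n n"
  shows "\<exists>as. char_poly A = (\<Prod>a\<leftarrow>as. [:- a, 1:])"
proof -
  have "lead_coeff (char_poly A) = 1" using degree_monic_char_poly[OF assms] by simp
  then have "char_poly A \<noteq> 0" by auto
  from alg_closed_imp_factorization[OF this] obtain M where
    "char_poly A = smult (lead_coeff (char_poly A)) (\<Prod>x\<in>#M. [:- x, 1:])" by blast
  then have M: "char_poly A = (\<Prod>x\<in>#M. [:- x, 1:])" using \<open>lead_coeff _ = 1\<close> by simp
  obtain as where "mset as = M" using ex_mset by blast
  then have "(\<Prod>x\<in>#M. [:- x, 1:]) = (\<Prod>a\<leftarrow>as. [:- a, 1:])"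
    by (metis mset_map prod_mset_prod_list)
  then show ?thesis using M by auto
qed

text \<open>
  The differences of an eigenvalue with all eigenvalues add up to \<open>n\<close> times this eigenvalue, because
  the sum of the eigenvalues is the trace. They are read off the diagonal of a Jordan form.
\<close>
lemma traceless_eigenvalues_rational:
  fixes A :: "'k::{alg_closed_field,field_char_0} mat"
  assumes A: "A \<in> carrier_mat n n" and trace: "(\<Sum>i<n. A $$ (i, i)) = 0"
    and diff: "\<And>\<alpha> \<beta>. eigenvalue A \<alpha> \<Longrightarrow> eigenvalue A \<beta> \<Longrightarrow> \<beta> - \<alpha> \<in> \<rat>"
  shows "\<exists>qs. char_poly A = (\<Prod>q\<leftarrow>qs. [:- of_rat q, 1:])"
proof -
  obtain as where as: "char_poly A = (\<Prod>a\<leftarrow>as. [:- a, 1:])" using alg_closure_char_poly_splits[OF A] by blast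
  obtain n_as where jnf: "jordan_nf A n_as" using jordan_nf_exists_field[OF A as] by blast
  define J where "J = jordan_matrix n_as"
  obtain S T where wit: "similar_mat_wit A J S T"
    using jnf by (auto simp: jordan_nf_def J_def similar_mat_def)
  have J: "J \<in> carrier_mat n n" using similar_mat_witD2[OF A wit] by blast
  have "upper_triangular J"
    using jordan_matrix_upper_triangular J unfolding J_def upper_triangular_def by auto
  moreover have "char_poly A = char_poly J" by (rule char_poly_similar) (use wit in \<open>auto simp: similar_mat_def\<close>)
  ultimately have cp: "char_poly A = (\<Prod>a\<leftarrow>diag_mat J. [:- a, 1:])"
    using char_poly_upper_triangular[OF J] by simp
  have set: "set (diag_mat J) = (\<lambda>i. J $$ (i, i)) ` {..<n}" using J by (auto simp: diag_mat_def)
  have eig: "eigenvalue A a" if "a \<in> set (diag_mat J)" for a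
    unfolding eigenvalue_root_char_poly[OF A] cp using that by (auto simp: poly_prod_list prod_list_zero_iff)
  have rat: "a \<in> \<rat>" if a: "a \<in> set (diag_mat J)" for a
  proof -
    have n: "n > 0" using a set by auto
    have "(\<Sum>i<n. a - J $$ (i, i)) \<in> \<rat>" by (intro Rats_sum diff) (use eig a set in auto)
    moreover have "(\<Sum>i<n. J $$ (i, i)) = 0" using trace trace_similar[OF A wit] by simp
    ultimately have "of_nat n * a \<in> \<rat>" by (simp add: sum_subtractf)
    then have "of_nat n * a / of_nat n \<in> \<rat>" by (intro Rats_divide) auto
    then show ?thesis using n by simp
  qed
  have "\<exists>qs. diag_mat J = map of_rat qs"
    using rat by (metis (no_types, lifting) Rats_def ex_map_conv image_iff)
  then obtain qs where "diag_mat J = map of_rat qs" by blast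
  then show ?thesis using cp by (auto simp: comp_def)
qed

section \<open>Constant systems with a finite splitting field\<close>

text \<open>
  A left eigenvector for \<open>\<alpha>\<close>, a right eigenvector for \<open>\<beta>\<close> and a suitable horizontal matrix combine to
  a nonzero \<open>y\<close> with \<open>y' = (\<beta> - \<alpha>) y\<close>. It lives in the extension \<open>E'\<close> of \<open>E\<close> that is generated by
  the eigenvalues and the entries of the eigenvectors; these are constants of \<open>E'\<close>.
\<close>
lemma split_constant_eigenvalue_difference:
  fixes \<iota> :: "'a::field_char_0 poly fract \<Rightarrow> 'b::{alg_closed_field,field_char_0}"
  assumes ext: "euler_extension \<delta> \<iota> E d" and P0: "P0 \<in> carrier_mat n n"
    and iso: "differential_algebra_iso E n
      (twisted_derivation d (map_mat (euler_extension.\<kappa> \<iota>) P0)) (map_mat d) \<phi>"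
    and \<alpha>: "eigenvalue (map_mat to_ac P0) \<alpha>" and \<beta>: "eigenvalue (map_mat to_ac P0) \<beta>"
  shows "\<exists>k l :: int. k \<noteq> 0 \<and> of_int k * (\<beta> - \<alpha>) = of_int l"
proof -
  interpret X: euler_extension \<delta> \<iota> E d by (rule ext)
  let ?Q = "map_mat X.\<kappa> P0" and ?A = "map_mat to_ac P0"
  have A: "?A \<in> carrier_mat n n" using P0 by simp
  have Q: "?Q \<in> matrices_over E n" using P0 by (auto simp: matrices_over_iff)
  obtain l where l: "\<exists>i<n. l i \<noteq> 0" "\<And>j. j < n \<Longrightarrow> (\<Sum>i<n. l i * ?A $$ (i, j)) = \<alpha> * l j"
    using eigenvalue_left_vector[OF A \<alpha>] by blast
  obtain r where r: "\<exists>i<n. r i \<noteq> 0" "\<And>i. i < n \<Longrightarrow> (\<Sum>j<n. ?A $$ (i, j) * r j) = \<beta> * r i"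
    using eigenvalue_right_vector[OF A \<beta>] by blast
  define S where "S = l ` {..<n} \<union> r ` {..<n} \<union> {\<alpha>, \<beta>}"
  have S: "finite S" "\<And>i. i < n \<Longrightarrow> l i \<in> S" "\<And>i. i < n \<Longrightarrow> r i \<in> S" "\<alpha> \<in> S" "\<beta> \<in> S"
    by (auto simp: S_def)
  obtain L \<tau> where L: "subfield_set L" and \<tau>: "hom_on L \<tau>" and FL: "range to_ac \<subseteq> L" and SL: "S \<subseteq> L"
    and \<tau>\<kappa>: "\<And>c. \<tau> (to_ac c) = X.\<kappa> c"
    using embed_algebraic_elements[OF X.\<kappa>_hom S(1)] by blast
  have \<tau>_add: "\<tau> (x + y) = \<tau> x + \<tau> y" and \<tau>_mult: "\<tau> (x * y) = \<tau> x * \<tau> y"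
    and L_ops: "x + y \<in> L" "x * y \<in> L" "- x \<in> L" if "x \<in> L" "y \<in> L" for x y
    using that \<tau> L by (auto simp: hom_on_def subfield_set_def)
  have \<tau>_inj: "x = y" if "\<tau> x = \<tau> y" "x \<in> L" "y \<in> L" for x y
    using hom_on_inj[OF \<tau> L] that by (auto dest: inj_onD)
  have root: "\<exists>f. poly (map_poly X.\<kappa> f) (\<tau> s) = 0 \<and> poly (map_poly X.\<kappa> (pderiv f)) (\<tau> s) \<noteq> 0"
    if s: "s \<in> S" for s
  proof -
    obtain f where f: "poly (map_poly to_ac f) s = 0" "poly (map_poly to_ac (pderiv f)) s \<noteq> 0"
      using alg_closure_separable by blast
    have "\<tau> (poly (map_poly to_ac g) s) = poly (map_poly X.\<kappa> g) (\<tau> s) \<and> poly (map_poly to_ac g) s \<in> L"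
      for g :: "'a poly"
    proof -
      have "map_poly to_ac g \<in> poly_over L" using FL by (auto simp: poly_over_def coeff_map_poly)
      moreover have "map_poly \<tau> (map_poly to_ac g) = map_poly X.\<kappa> g"
        by (rule poly_eqI) (simp add: coeff_map_poly \<tau>\<kappa> hom_on_0[OF \<tau> L])
      ultimately show ?thesis using hom_on_poly[OF L \<tau>, of "map_poly to_ac g" s] s SL by auto
    qed
    then show ?thesis using f hom_on_0[OF \<tau> L] \<tau>_inj L
      by (intro exI[of _ f]) (metis subfield_set_def)
  qed
  have pderiv_\<kappa>: "pderiv (map_poly X.\<kappa> f) = map_poly X.\<kappa> (pderiv f)" for f
    by (rule poly_eqI) (simp add: coeff_pderiv coeff_map_poly X.\<kappa>.hom_mult X.\<kappa>.hom_of_nat del: of_nat_Suc)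
  have "\<exists>f\<in>poly_over E. poly f x = 0 \<and> poly (pderiv f) x \<noteq> 0" if x: "x \<in> \<tau> ` S" for x
  proof -
    obtain s where s: "s \<in> S" "x = \<tau> s" using x by auto
    obtain f where f: "poly (map_poly X.\<kappa> f) x = 0" "poly (map_poly X.\<kappa> (pderiv f)) x \<noteq> 0"
      using root[OF s(1)] s(2) by blast
    have "map_poly X.\<kappa> f \<in> poly_over E" by (simp add: poly_over_def coeff_map_poly)
    then show ?thesis using f by (intro bexI[of _ "map_poly X.\<kappa> f"]) (simp_all add: pderiv_\<kappa>)
  qed
  then obtain E' d' where E': "finite_differential_extension \<delta> \<iota> E' d'" and EE': "E \<subseteq> E'"
    and SE': "\<tau> ` S \<subseteq> E'" and d': "\<forall>y\<in>E. d' y = d y"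
    using X.adjoin_roots[of "\<tau> ` S"] S(1) by blast
  interpret Y: euler_extension \<delta> \<iota> E' d'
    by (intro euler_extension.intro E' X.euler_derivation_field_axioms)
  \<comment> \<open>Differentiating an equation with constant coefficients at a simple root gives derivative 0.\<close>
  have const: "\<tau> s \<in> E' \<and> d' (\<tau> s) = 0" if s: "s \<in> S" for s
  proof -
    have sE: "\<tau> s \<in> E'" using SE' s by auto
    obtain f where f: "poly (map_poly X.\<kappa> f) (\<tau> s) = 0" "poly (map_poly X.\<kappa> (pderiv f)) (\<tau> s) \<noteq> 0"
      using root[OF s] by blast
    have "d' (poly (map_poly X.\<kappa> f) (\<tau> s)) = 0" using f(1) by simp
    then show ?thesis using Y.d_poly_\<kappa>[OF sE, of f] f(2) sE by simp
  qed
  have nz: "\<exists>i<n. \<tau> (v i) \<noteq> 0" if v: "\<exists>i<n. v i \<noteq> 0" "\<And>i. i < n \<Longrightarrow> v i \<in> S" for v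
  proof -
    obtain i where "i < n" "v i \<noteq> 0" using v(1) by blast
    moreover have "\<tau> (v i) \<noteq> 0"
      using \<tau>_inj[of "v i" 0] hom_on_0[OF \<tau> L] v(2)[OF \<open>i < n\<close>] SL L \<open>v i \<noteq> 0\<close>
      by (auto simp: subfield_set_def)
    ultimately show ?thesis by blast
  qed
  obtain M where M: "M \<in> matrices_over E n" "twisted_derivation d ?Q M = 0\<^sub>m n n"
    and y0: "bilinear n (\<lambda>i. \<tau> (l i)) M (\<lambda>i. \<tau> (r i)) \<noteq> 0"
    using X.horizontal_bilinear_nonzero[OF Q iso nz[of l] nz[of r]] l(1) r(1) S(2,3) by blast
  let ?y = "bilinear n (\<lambda>i. \<tau> (l i)) M (\<lambda>i. \<tau> (r i))"
  have M': "M \<in> matrices_over E' n" "?Q \<in> matrices_over E' n" using M(1) Q EE' by (auto simp: matrices_over_iff)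
  have "map_mat d' M = map_mat d M" using M(1) d' by (intro eq_matI) (auto simp: matrices_over_iff)
  then have horizontal: "twisted_derivation d' ?Q M = 0\<^sub>m n n" using M(2) by (simp add: twisted_derivation_def)
  have prod_L: "to_ac a * s \<in> L" "\<tau> (to_ac a * s) = X.\<kappa> a * \<tau> s" if "s \<in> S" for a s
  proof -
    have "to_ac a \<in> L" "s \<in> L" using FL SL that by auto
    then show "to_ac a * s \<in> L" "\<tau> (to_ac a * s) = X.\<kappa> a * \<tau> s"
      using L_ops \<tau>_mult \<tau>\<kappa> by auto
  qed
  have left: "(\<Sum>i<n. \<tau> (l i) * ?Q $$ (i, j)) = \<tau> \<alpha> * \<tau> (l j)" if j: "j < n" for j
  proof -
    have "(\<Sum>i<n. \<tau> (l i) * ?Q $$ (i, j)) = (\<Sum>i<n. \<tau> (to_ac (P0 $$ (i, j)) * l i))"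
      using P0 j S(2) by (intro sum.cong refl, subst mult.commute) (simp add: prod_L(2))
    also have "\<dots> = \<tau> (\<Sum>i<n. to_ac (P0 $$ (i, j)) * l i)"
      using S(2) prod_L(1) by (intro hom_on_sum[OF \<tau> L, symmetric]) auto
    also have "(\<Sum>i<n. to_ac (P0 $$ (i, j)) * l i) = (\<Sum>i<n. l i * ?A $$ (i, j))"
      using P0 j by (intro sum.cong) (auto simp: mult.commute)
    also have "\<tau> \<dots> = \<tau> \<alpha> * \<tau> (l j)" using l(2)[OF j] S(2)[OF j] S(4) SL \<tau>_mult by auto
    finally show ?thesis .
  qed
  have right: "(\<Sum>j<n. ?Q $$ (i, j) * \<tau> (r j)) = \<tau> \<beta> * \<tau> (r i)" if i: "i < n" for i
  proof -
    have "(\<Sum>j<n. ?Q $$ (i, j) * \<tau> (r j)) = (\<Sum>j<n. \<tau> (to_ac (P0 $$ (i, j)) * r j))"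
      using P0 i S(3) by (intro sum.cong) (auto simp: prod_L(2))
    also have "\<dots> = \<tau> (\<Sum>j<n. to_ac (P0 $$ (i, j)) * r j)"
      using S(3) prod_L(1) by (intro hom_on_sum[OF \<tau> L, symmetric]) auto
    also have "(\<Sum>j<n. to_ac (P0 $$ (i, j)) * r j) = (\<Sum>j<n. ?A $$ (i, j) * r j)"
      using P0 i by (intro sum.cong) auto
    also have "\<tau> \<dots> = \<tau> \<beta> * \<tau> (r i)" using r(2)[OF i] S(3)[OF i] S(5) SL \<tau>_mult by auto
    finally show ?thesis .
  qed
  have "d' ?y = bilinear n (\<lambda>i. \<tau> (l i)) M (\<lambda>i. \<Sum>j<n. ?Q $$ (i, j) * \<tau> (r j)) - \<tau> \<alpha> * ?y"
    by (rule Y.d_bilinear_horizontal[OF M'(2,1) horizontal]) (use const S left in auto)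
  also have "bilinear n (\<lambda>i. \<tau> (l i)) M (\<lambda>i. \<Sum>j<n. ?Q $$ (i, j) * \<tau> (r j)) = \<tau> \<beta> * ?y"
  proof -
    have "\<tau> (l i) * M $$ (i, k) * (\<Sum>j<n. ?Q $$ (k, j) * \<tau> (r j)) = \<tau> \<beta> * (\<tau> (l i) * M $$ (i, k) * \<tau> (r k))"
      if "k < n" for i k by (subst right[OF that]) (simp add: ac_simps)
    then show ?thesis unfolding bilinear_def by (simp add: sum_distrib_left)
  qed
  finally have "d' ?y = (\<tau> \<beta> - \<tau> \<alpha>) * ?y" by (simp add: algebra_simps)
  moreover have "?y \<in> E'" by (rule Y.bilinear_closed[OF M'(1)]) (use const S in auto)
  moreover have "\<tau> \<beta> - \<tau> \<alpha> \<in> E'" "d' (\<tau> \<beta> - \<tau> \<alpha>) = 0"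
    using const[OF S(4)] const[OF S(5)] by (auto simp: Y.d_diff)
  ultimately obtain k m :: int where km: "k \<noteq> 0" "of_int k * (\<tau> \<beta> - \<tau> \<alpha>) = of_int m"
    using Y.exponential_rational[of ?y "\<tau> \<beta> - \<tau> \<alpha>"] y0 by blast
  have int_L: "of_int i \<in> L" "\<tau> (of_int i) = of_int i" for i
  proof -
    have e: "of_int i = to_ac (of_int i)" by simp
    show "of_int i \<in> L" unfolding e using FL by blast
    show "\<tau> (of_int i) = of_int i" unfolding e \<tau>\<kappa> by (simp add: X.\<kappa>.hom_of_int)
  qed
  have ab: "\<alpha> \<in> L" "\<beta> \<in> L" using S SL by auto
  then have diff: "\<beta> - \<alpha> \<in> L" "\<tau> (\<beta> - \<alpha>) = \<tau> \<beta> - \<tau> \<alpha>"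
    using \<tau>_add[of \<beta> "- \<alpha>"] L_ops[of \<beta> "- \<alpha>"] L_ops(3)[of \<alpha> \<alpha>] hom_on_minus[OF \<tau> L] by simp_all
  then have "\<tau> (of_int k * (\<beta> - \<alpha>)) = \<tau> (of_int m)"
    using km(2) int_L \<tau>_mult[OF int_L(1) diff(1)] by simp
  then have "of_int k * (\<beta> - \<alpha>) = of_int m"
    by (rule \<tau>_inj) (use int_L(1) diff(1) L_ops(2) in auto)
  then show ?thesis using km(1) by (intro exI[of _ k] exI[of _ m]) simp
qed

context euler_extension
begin

text \<open>
  With a left eigenvector \<open>l\<close> for \<open>c\<close> and a horizontal \<open>M\<close>, the elements \<open>y = l M r\<close> and \<open>z = l M s\<close>
  satisfy \<open>y' = z\<close> and \<open>z' = 0\<close>. The matrix \<open>M\<close> can be chosen with \<open>z \<noteq> 0\<close>, and then \<open>y / z\<close> has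
  derivative 1.
\<close>
lemma split_constant_no_jordan_chain:
  assumes P0: "P0 \<in> carrier_mat n n"
    and iso: "differential_algebra_iso E n (twisted_derivation d (map_mat \<kappa> P0)) (map_mat d) \<phi>"
    and s: "\<exists>i<n. s i \<noteq> 0" "\<And>i. i < n \<Longrightarrow> (\<Sum>j<n. P0 $$ (i, j) * s j) = c * s i"
    and r: "\<And>i. i < n \<Longrightarrow> (\<Sum>j<n. P0 $$ (i, j) * r j) = c * r i + s i"
  shows False
proof -
  let ?Q = "map_mat \<kappa> P0"
  have Q: "?Q \<in> matrices_over E n" using P0 by (auto simp: matrices_over_iff)
  have "eigenvector P0 (vec n s) c"
    unfolding eigenvector_def
  proof (intro conjI)
    show "vec n s \<noteq> 0\<^sub>v (dim_row P0)"
    proof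
      assume eq: "vec n s = 0\<^sub>v (dim_row P0)"
      obtain i where "i < n" "s i \<noteq> 0" using s(1) by blast
      then show False using arg_cong[OF eq, of "\<lambda>v. vec_index v i"] P0 by simp
    qed
    show "P0 *\<^sub>v vec n s = c \<cdot>\<^sub>v vec n s"
      using P0 s(2) by (intro eq_vecI) (auto simp: scalar_prod_def lessThan_atLeast0)
  qed (use P0 in auto)
  then have "eigenvalue P0 c" by (auto simp: eigenvalue_def)
  then obtain l where l: "\<exists>i<n. l i \<noteq> 0" "\<And>j. j < n \<Longrightarrow> (\<Sum>i<n. l i * P0 $$ (i, j)) = c * l j"
    using eigenvalue_left_vector[OF P0] by blast
  obtain M where M: "M \<in> matrices_over E n" "twisted_derivation d ?Q M = 0\<^sub>m n n"
    and z0: "bilinear n (\<lambda>i. \<kappa> (l i)) M (\<lambda>i. \<kappa> (s i)) \<noteq> 0"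
    using horizontal_bilinear_nonzero[OF Q iso, of "\<lambda>i. \<kappa> (l i)" "\<lambda>i. \<kappa> (s i)"] l(1) s(1) by auto
  let ?B = "\<lambda>v. bilinear n (\<lambda>i. \<kappa> (l i)) M v"
  define z where "z = ?B (\<lambda>i. \<kappa> (s i))"
  define y where "y = ?B (\<lambda>i. \<kappa> (r i))"
  have left: "(\<Sum>i<n. \<kappa> (l i) * ?Q $$ (i, j)) = \<kappa> c * \<kappa> (l j)" if "j < n" for j
  proof -
    have "(\<Sum>i<n. \<kappa> (l i) * ?Q $$ (i, j)) = \<kappa> (\<Sum>i<n. l i * P0 $$ (i, j))"
      unfolding \<kappa>.hom_sum using P0 that by (intro sum.cong) (auto simp: \<kappa>.hom_mult)
    then show ?thesis using l(2)[OF that] by (simp add: \<kappa>.hom_mult)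
  qed
  have dB: "d (?B (\<lambda>i. \<kappa> (v i))) = ?B (\<lambda>i. \<kappa> (\<Sum>j<n. P0 $$ (i, j) * v j)) - \<kappa> c * ?B (\<lambda>i. \<kappa> (v i))" for v
  proof -
    have "d (?B (\<lambda>i. \<kappa> (v i))) = ?B (\<lambda>i. \<Sum>j<n. ?Q $$ (i, j) * \<kappa> (v j)) - \<kappa> c * ?B (\<lambda>i. \<kappa> (v i))"
      by (rule d_bilinear_horizontal[OF Q M]) (use left in auto)
    also have "?B (\<lambda>i. \<Sum>j<n. ?Q $$ (i, j) * \<kappa> (v j)) = ?B (\<lambda>i. \<kappa> (\<Sum>j<n. P0 $$ (i, j) * v j))"
    proof -
      have eq: "(\<Sum>j<n. ?Q $$ (i, j) * \<kappa> (v j)) = \<kappa> (\<Sum>j<n. P0 $$ (i, j) * v j)" if "i < n" for i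
        unfolding \<kappa>.hom_sum using P0 that by (intro sum.cong) (auto simp: \<kappa>.hom_mult)
      show ?thesis unfolding bilinear_def by (intro sum.cong refl) (simp add: eq)
    qed
    finally show ?thesis .
  qed
  have "?B (\<lambda>i. \<kappa> (\<Sum>j<n. P0 $$ (i, j) * s j)) = \<kappa> c * z"
    unfolding z_def bilinear_def sum_distrib_left
    by (intro sum.cong refl, subst s(2)) (simp_all add: \<kappa>.hom_mult ac_simps)
  then have dz: "d z = 0" using dB[of s] by (simp flip: z_def)
  have "?B (\<lambda>i. \<kappa> (\<Sum>j<n. P0 $$ (i, j) * r j)) = \<kappa> c * y + z"
    unfolding y_def z_def bilinear_def sum_distrib_left sum.distrib[symmetric]
    by (intro sum.cong refl, subst r) (simp_all add: \<kappa>.hom_mult \<kappa>.hom_add algebra_simps)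
  then have dy: "d y = z" using dB[of r] by (simp flip: y_def)
  have E: "y \<in> E" "z \<in> E" unfolding y_def z_def by (intro bilinear_closed[OF M(1)] \<kappa>_closed)+
  have z: "z \<noteq> 0" using z0 by (simp add: z_def)
  have "d (y / z * z) = d (y / z) * z" using d_mult[of "y / z" z] E dz by simp
  moreover have "y / z * z = y" using z by simp
  ultimately have "d (y / z) * z = z" using dy by simp
  then have "d (y / z) = 1" using z by simp
  then show False using no_logarithm E by blast
qed

end

context euler_derivation_field
begin

text \<open>
  The eigenvalues are shown to be rational in the algebraic closure of \<open>F\<close>. Being rational they lie in
  \<open>F\<close>, so the characteristic polynomial already splits over \<open>F\<close> and the Jordan form can be taken there.
\<close>
lemma constant_split_imp_rational_diagonalizable:
  assumes P0: "P0 \<in> carrier_mat n n" and trace: "(\<Sum>i<n. P0 $$ (i, i)) = 0"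
    and admits: "admits_finite_splitting_field \<delta> n (map_mat const_fract P0)"
  shows "diagonalizable_mat P0" and "\<And>c. eigenvalue P0 c \<Longrightarrow> c \<in> \<rat>"
proof -
  obtain \<iota> :: "'a poly fract \<Rightarrow> 'a poly fract alg_closure" and E d where
    fin: "finite_extension \<iota> E" and split: "splitting_field \<delta> n (map_mat const_fract P0) \<iota> E d"
    using admits unfolding admits_finite_splitting_field_def by blast
  from split obtain \<phi> where ext: "differential_extension \<delta> \<iota> E d"
    and iso: "differential_algebra_iso E n
      (twisted_derivation d (map_mat \<iota> (map_mat const_fract P0))) (map_mat d) \<phi>"
    unfolding splitting_field_def by blast
  have X: "euler_extension \<delta> \<iota> E d"
    by (intro euler_extension.intro finite_differential_extension.intro ext fin
        euler_derivation_field_axioms)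
  interpret X: euler_extension \<delta> \<iota> E d by (rule X)
  have "map_mat \<iota> (map_mat const_fract P0) = map_mat X.\<kappa> P0"
    by (rule eq_matI) (simp_all add: X.\<kappa>_def)
  then have iso: "differential_algebra_iso E n (twisted_derivation d (map_mat X.\<kappa> P0)) (map_mat d) \<phi>"
    using iso by simp
  let ?h = "to_ac :: 'a \<Rightarrow> 'a alg_closure"
  let ?A = "map_mat ?h P0"
  interpret h: field_hom ?h by unfold_locales auto
  have A: "?A \<in> carrier_mat n n" using P0 by simp
  have "(\<Sum>i<n. ?A $$ (i, i)) = ?h (\<Sum>i<n. P0 $$ (i, i))"
    unfolding to_ac_sum using P0 by (intro sum.cong) auto
  then have traceA: "(\<Sum>i<n. ?A $$ (i, i)) = 0" using trace by simp
  have diff: "\<beta> - \<alpha> \<in> \<rat>" if eig: "eigenvalue ?A \<alpha>" "eigenvalue ?A \<beta>" for \<alpha> \<beta>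
  proof -
    obtain k l :: int where kl: "k \<noteq> 0" "of_int k * (\<beta> - \<alpha>) = of_int l"
      using split_constant_eigenvalue_difference[OF X P0 iso eig] by blast
    then have "\<beta> - \<alpha> = of_int l / of_int k" by (simp add: nonzero_eq_divide_eq mult.commute)
    then show ?thesis by (simp add: Rats_divide)
  qed
  obtain qs where "char_poly ?A = (\<Prod>q\<leftarrow>qs. [:- of_rat q, 1:])"
    using traceless_eigenvalues_rational[OF A traceA diff] by blast
  moreover have "map_poly ?h (\<Prod>q\<leftarrow>qs. [:- of_rat q, 1:]) = (\<Prod>q\<leftarrow>qs. [:- of_rat q, 1:])"
  proof (induction qs)
    case (Cons q qs)
    interpret p: map_poly_inj_idom_hom ?h ..
    have "?h (of_rat q) = of_rat q" by (cases q) (simp add: of_rat_rat)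
    then have "map_poly ?h [:- of_rat q, 1:] = [:- of_rat q, 1:]" by (simp add: map_poly_pCons)
    then show ?case by (simp only: list.map prod_list.Cons p.hom_mult Cons.IH)
  qed simp
  moreover have "char_poly ?A = map_poly ?h (char_poly P0)" by (rule h.char_poly_hom[OF P0])
  ultimately have "map_poly ?h (char_poly P0) = map_poly ?h (\<Prod>q\<leftarrow>qs. [:- of_rat q, 1:])" by simp
  then have cp: "char_poly P0 = (\<Prod>q\<leftarrow>qs. [:- of_rat q, 1:])"
  proof (intro poly_eqI)
    fix i
    have "?h (coeff p i) = coeff (map_poly ?h p) i" for p by (simp add: coeff_map_poly)
    then have "?h (coeff (char_poly P0) i) = ?h (coeff (\<Prod>q\<leftarrow>qs. [:- of_rat q, 1:]) i)"
      using \<open>map_poly ?h (char_poly P0) = _\<close> by presburger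
    then show "coeff (char_poly P0) i = coeff (\<Prod>q\<leftarrow>qs. [:- of_rat q, 1:]) i" by (simp only: to_ac_eq_iff)
  qed
  have "char_poly P0 = (\<Prod>a\<leftarrow>map of_rat qs. [:- a, 1:])" by (simp add: cp comp_def)
  then show "diagonalizable_mat P0"
    by (rule diagonalizable_if_no_jordan_chain[OF P0]) (rule X.split_constant_no_jordan_chain[OF P0 iso])
  fix c assume "eigenvalue P0 c"
  then have "poly (char_poly P0) c = 0" by (simp add: eigenvalue_root_char_poly[OF P0])
  then show "c \<in> \<rat>" unfolding cp by (auto simp: poly_prod_list prod_list_zero_iff)
qed

end

theorem theorem1p2:
  fixes \<delta> :: "'a::field_char_0 poly fract \<Rightarrow> 'a poly fract"
    and n :: nat and P :: "'a poly fract mat"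
  assumes "euler_derivation \<delta>"
    and "0 < n"
    and "P \<in> carrier_mat n n"
    and "(\<Sum>i<n. P $$ (i, i)) = 0"
  shows "(\<forall>P0 \<in> carrier_mat n n. P = map_mat const_fract P0 \<longrightarrow>
            (admits_finite_splitting_field \<delta> n P \<longleftrightarrow>
               diagonalizable_mat P0 \<and> (\<forall>c. eigenvalue P0 c \<longrightarrow> c \<in> \<rat>)))
       \<and> (\<not> (\<exists>P0 \<in> carrier_mat n n. P = map_mat const_fract P0) \<longrightarrow>
            (\<exists>d. P = mat_diag n d \<and> (\<forall>i<n. d i \<in> log_derivative_set \<delta>))
            \<or> (upper_triangular P \<and> elements_mat P \<subseteq> range to_fract \<and>
               (\<exists>r :: nat \<Rightarrow> rat.
                  (\<forall>i<n. P $$ (i, i) = const_fract (of_rat (r i))) \<and>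
                  (\<forall>i<n. \<forall>j<n. i \<noteq> j \<longrightarrow> r i - r j \<notin> \<int>)))
            \<longrightarrow> admits_finite_splitting_field \<delta> n P)"
proof -
  interpret euler_derivation_field \<delta> by unfold_locales (rule assms(1))
  interpret c: field_hom "const_fract :: 'a \<Rightarrow> _" by (rule const_fract_hom)
  show ?thesis
  proof (intro conjI ballI impI)
    fix P0 assume P0: "P0 \<in> carrier_mat n n" and P: "P = map_mat const_fract P0"
    have "const_fract (\<Sum>i<n. P0 $$ (i, i)) = (\<Sum>i<n. P $$ (i, i))"
      unfolding c.hom_sum using P0 by (intro sum.cong) (auto simp: P)
    then have "(\<Sum>i<n. P0 $$ (i, i)) = 0" using assms(4) by (simp add: const_fract_def)
    then show "admits_finite_splitting_field \<delta> n P \<longleftrightarrow>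
        diagonalizable_mat P0 \<and> (\<forall>c. eigenvalue P0 c \<longrightarrow> c \<in> \<rat>)"
      using constant_split_imp_rational_diagonalizable[OF P0] constant_diagonalizable_splits[OF P0]
      unfolding P by blast
  next
    assume "(\<exists>d. P = mat_diag n d \<and> (\<forall>i<n. d i \<in> log_derivative_set \<delta>))
            \<or> (upper_triangular P \<and> elements_mat P \<subseteq> range to_fract \<and>
               (\<exists>r :: nat \<Rightarrow> rat.
                  (\<forall>i<n. P $$ (i, i) = const_fract (of_rat (r i))) \<and>
                  (\<forall>i<n. \<forall>j<n. i \<noteq> j \<longrightarrow> r i - r j \<notin> \<int>)))"
    then show "admits_finite_splitting_field \<delta> n P"
    proof (elim disjE exE conjE)
      fix d assume "P = mat_diag n d" "\<forall>i<n. d i \<in> log_derivative_set \<delta>"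
      then show ?thesis by (intro diagonal_splits) auto
    next
      fix r assume "upper_triangular P" "elements_mat P \<subseteq> range to_fract"
        and "\<forall>i<n. P $$ (i, i) = const_fract (of_rat (r i))"
        and "\<forall>i<n. \<forall>j<n. i \<noteq> j \<longrightarrow> r i - r j \<notin> \<int>"
      then show ?thesis using triangular_splits[OF assms(3), of r] by simp
    qed
  qed
qed

end
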